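(* Let $A$ be a finite abelian group and let $G$ be a polysurface group of length $n$ with filtration $1=G_0\unlhd G_1\unlhd G_2\unlhd\dots\unlhd G_n=G$. For any central extension $$1\to A\to\Gamma\xrightarrow{\phi}G\to1,$$ there is a finite index (normal) subgroup $G_1'$ of $G_1\subset G$ such that $G_1/G_1'$ is cyclic of order $e(A)$ and the induced extension $$1\to A\to\Gamma_1'\to G_1'\to1,\qquad \Gamma_1'=\phi^{-1}(G_1'),$$ is trivial. Moreover, if $i:G_1'\hookrightarrow A\oplus G_1'\cong\Gamma_1'\subset\Gamma$ denotes the resulting inclusion, then the index of the subgroup $\Gamma':=N_\Gamma(i(G_1'))$ of $\Gamma$ is less than $$|A|^{2e(A) g_1(G)}\cdot e(A)\,(e(A)!)^{2g_1(G)+|r(A)|}.$$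
   Context: A surface group is the fundamental group of a closed orientable surface of genus at least $2$. A group $G$ is a polysurface group of length $n$ with filtration $1=G_0<G_1<\dots<G_n=G$ if each $G_i$ is normal in $G$ and each $G_i/G_{i-1}$ ($1\le i\le n$) is a surface group; $g_1(G)$ is the genus of the surface group $G_1$. For a finite abelian group $A$, $e(A)$ is its exponent and $r(A)$ is a generating set of $A$ of minimal size. A central extension is trivial if it is isomorphic as an extension to the product extension. $N_\Gamma(\cdot)$ denotes the normalizer in $\Gamma$.
   Formalization: The strict index bound is claimed only for nontrivial A; for all A the index is shown to be at most the bound. For trivial A the bound equals 1 and the index is 1, so the strict inequality as printed fails. The length n is taken at least 1 so that G_1 exists. *)

theory Defs
  imports
    "HOL-Analysis.Analysis"
    "HOL-Algebra.Elementary_Groups"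
    "HOL-Algebra.Group_Action"
begin

section \<open>The fundamental group of a topological space\<close>

definition loops_at :: "'a topology \<Rightarrow> 'a \<Rightarrow> (real \<Rightarrow> 'a) set" where
  "loops_at X x = {p. pathin X p \<and> p 0 = x \<and> p 1 = x}"

definition loop_homotopic :: "'a topology \<Rightarrow> 'a \<Rightarrow> (real \<Rightarrow> 'a) \<Rightarrow> (real \<Rightarrow> 'a) \<Rightarrow> bool" where
  "loop_homotopic X x p q \<longleftrightarrow>
     homotopic_with (\<lambda>r. r 0 = x \<and> r 1 = x) (top_of_set {0..1::real}) X p q"

definition loop_class :: "'a topology \<Rightarrow> 'a \<Rightarrow> (real \<Rightarrow> 'a) \<Rightarrow> (real \<Rightarrow> 'a) set" where
  "loop_class X x p = {q. loop_homotopic X x p q}"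

text \<open>Same formula as the library's \<open>+++\<close>, whose type requires a topological type class
  that the points of an abstract topology need not have.\<close>

definition loop_concat :: "(real \<Rightarrow> 'a) \<Rightarrow> (real \<Rightarrow> 'a) \<Rightarrow> real \<Rightarrow> 'a" where
  "loop_concat p q = (\<lambda>t. if t \<le> 1/2 then p (2 * t) else q (2 * t - 1))"

definition fundamental_group :: "'a topology \<Rightarrow> 'a \<Rightarrow> (real \<Rightarrow> 'a) set monoid" where
  "fundamental_group X x =
     \<lparr> carrier = loop_class X x ` loops_at X x,
       mult = (\<lambda>C D. \<Union>p\<in>C. \<Union>q\<in>D. loop_class X x (loop_concat p q)),
       one = loop_class X x (\<lambda>t. x) \<rparr>"


section \<open>Closed orientable surfaces\<close>

definition quotient_topology :: "'a topology \<Rightarrow> ('a \<times> 'a) set \<Rightarrow> 'a set topology" where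
  "quotient_topology X r =
     topology (\<lambda>U. U \<subseteq> topspace X // r \<and> openin X {x \<in> topspace X. r `` {x} \<in> U})"

lemma openin_quotient_topology:
  "openin (quotient_topology X r) U \<longleftrightarrow>
     U \<subseteq> topspace X // r \<and> openin X {x \<in> topspace X. r `` {x} \<in> U}"
proof -
  have "istopology (\<lambda>U. U \<subseteq> topspace X // r \<and> openin X {x \<in> topspace X. r `` {x} \<in> U})"
    unfolding istopology_def
  proof (intro conjI allI impI)
    fix S T
    assume S: "S \<subseteq> topspace X // r \<and> openin X {x \<in> topspace X. r `` {x} \<in> S}"
      and T: "T \<subseteq> topspace X // r \<and> openin X {x \<in> topspace X. r `` {x} \<in> T}"
    show "S \<inter> T \<subseteq> topspace X // r" using S by blast
    have "{x \<in> topspace X. r `` {x} \<in> S \<inter> T} =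
        {x \<in> topspace X. r `` {x} \<in> S} \<inter> {x \<in> topspace X. r `` {x} \<in> T}" by blast
    then show "openin X {x \<in> topspace X. r `` {x} \<in> S \<inter> T}" using S T by auto
  next
    fix K :: "'a set set set"
    assume K: "\<forall>S\<in>K. S \<subseteq> topspace X // r \<and> openin X {x \<in> topspace X. r `` {x} \<in> S}"
    show "\<Union>K \<subseteq> topspace X // r" using K by blast
    have "{x \<in> topspace X. r `` {x} \<in> \<Union>K} =
        \<Union>((\<lambda>S. {x \<in> topspace X. r `` {x} \<in> S}) ` K)" by blast
    then show "openin X {x \<in> topspace X. r `` {x} \<in> \<Union>K}" using K by auto
  qed
  then show ?thesis
    unfolding quotient_topology_def by simp
qed

lemma topspace_quotient_topology: "topspace (quotient_topology X r) = topspace X // r"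
proof -
  have "{x \<in> topspace X. r `` {x} \<in> topspace X // r} = topspace X"
    by (auto simp: quotientI)
  then have "openin (quotient_topology X r) (topspace X // r)"
    by (simp add: openin_quotient_topology)
  then show ?thesis
    by (meson openin_quotient_topology openin_subset openin_topspace subset_antisym)
qed

lemma quotient_map_quotient_topology:
  "quotient_map X (quotient_topology X r) (\<lambda>x. r `` {x})"
  unfolding quotient_map_def
  by (auto simp: openin_quotient_topology topspace_quotient_topology quotient_def)

text \<open>The closed unit disc is regarded as a polygon with \<open>4 * g\<close> edges; \<open>polygon_boundary g\<close> is
  its boundary parametrised so that the \<open>k\<close>-th edge is the image of \<open>{k..k+1}\<close>.  The edges
  are glued in pairs, with orientations reversed, according to the boundary word
  \<open>a\<^sub>1 b\<^sub>1 a\<^sub>1\<inverse> b\<^sub>1\<inverse> \<dots> a\<^sub>g b\<^sub>g a\<^sub>g\<inverse> b\<^sub>g\<inverse>\<close>; the quotient is the closed orientable surface of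
  genus \<open>g\<close> for \<open>g \<ge> 1\<close>.\<close>

definition polygon_boundary :: "nat \<Rightarrow> real \<Rightarrow> complex" where
  "polygon_boundary g t = cis (2 * pi * t / real (4 * g))"

definition edge_pairing :: "nat \<Rightarrow> (complex \<times> complex) set" where
  "edge_pairing g =
     (\<Union>j\<in>{..<g}. \<Union>s\<in>{0..1::real}.
        {(polygon_boundary g (4 * real j + s), polygon_boundary g (4 * real j + 3 - s)),
         (polygon_boundary g (4 * real j + 1 + s), polygon_boundary g (4 * real j + 4 - s))})"

definition gluing_relation :: "nat \<Rightarrow> (complex \<times> complex) set" where
  "gluing_relation g =
     (edge_pairing g \<union> (edge_pairing g)\<inverse>)\<^sup>* \<inter> cball 0 1 \<times> cball 0 1"

lemma equiv_gluing_relation: "equiv (cball 0 1) (gluing_relation g)"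
proof (rule equivI)
  show "gluing_relation g \<subseteq> cball 0 1 \<times> cball 0 1"
    by (auto simp: gluing_relation_def)
  show "refl_on (cball 0 1) (gluing_relation g)"
    by (auto simp: gluing_relation_def refl_on_def)
  have "sym ((edge_pairing g \<union> (edge_pairing g)\<inverse>)\<^sup>*)"
    by (intro sym_rtrancl sym_Un_converse)
  then show "sym (gluing_relation g)"
    by (auto simp: gluing_relation_def sym_def)
  show "trans (gluing_relation g)"
    by (auto simp: gluing_relation_def trans_def intro: rtrancl_trans)
qed

definition genus_surface :: "nat \<Rightarrow> complex set topology" where
  "genus_surface g = quotient_topology (top_of_set (cball 0 1)) (gluing_relation g)"


section \<open>Surface groups and polysurface groups\<close>

definition surface_group_of_genus :: "nat \<Rightarrow> 'a monoid \<Rightarrow> bool" where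
  "surface_group_of_genus g G \<longleftrightarrow>
     group G \<and> g \<ge> 2 \<and>
     (\<exists>x \<in> topspace (genus_surface g). G \<cong> fundamental_group (genus_surface g) x)"

definition surface_group :: "'a monoid \<Rightarrow> bool" where
  "surface_group G \<longleftrightarrow> (\<exists>g. surface_group_of_genus g G)"

definition polysurface_group :: "'a monoid \<Rightarrow> nat \<Rightarrow> (nat \<Rightarrow> 'a set) \<Rightarrow> bool" where
  "polysurface_group G n F \<longleftrightarrow>
     group G \<and> F 0 = {\<one>\<^bsub>G\<^esub>} \<and> F n = carrier G \<and>
     (\<forall>i\<le>n. F i \<lhd> G) \<and>
     (\<forall>i\<in>{1..n}. F (i - 1) \<subseteq> F i \<and> surface_group ((G\<lparr>carrier := F i\<rparr>) Mod F (i - 1)))"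


section \<open>Finite abelian groups and central extensions\<close>

definition group_exponent :: "'a monoid \<Rightarrow> nat" where
  "group_exponent A = (LEAST m. m > 0 \<and> (\<forall>a\<in>carrier A. a [^]\<^bsub>A\<^esub> m = \<one>\<^bsub>A\<^esub>))"

definition min_generators :: "'a monoid \<Rightarrow> nat" where
  "min_generators A =
     (LEAST k. \<exists>S\<subseteq>carrier A. finite S \<and> card S = k \<and> generate A S = carrier A)"

definition central_extension ::
  "'a monoid \<Rightarrow> 'b monoid \<Rightarrow> 'c monoid \<Rightarrow> ('a \<Rightarrow> 'b) \<Rightarrow> ('b \<Rightarrow> 'c) \<Rightarrow> bool" where
  "central_extension A \<Gamma> G \<iota> \<phi> \<longleftrightarrow>
     group_hom A \<Gamma> \<iota> \<and> group_hom \<Gamma> G \<phi> \<and>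
     inj_on \<iota> (carrier A) \<and> \<phi> ` carrier \<Gamma> = carrier G \<and>
     kernel \<Gamma> G \<phi> = \<iota> ` carrier A \<and>
     (\<forall>a\<in>carrier A. \<forall>x\<in>carrier \<Gamma>. \<iota> a \<otimes>\<^bsub>\<Gamma>\<^esub> x = x \<otimes>\<^bsub>\<Gamma>\<^esub> \<iota> a)"

text \<open>\<open>\<psi>\<close> is an isomorphism of extensions from the product extension
  \<open>1 \<rightarrow> A \<rightarrow> A \<times> G \<rightarrow> G \<rightarrow> 1\<close> to \<open>1 \<rightarrow> A \<rightarrow> \<Gamma> \<rightarrow> G \<rightarrow> 1\<close>.\<close>

definition extension_trivialization ::
  "'a monoid \<Rightarrow> 'b monoid \<Rightarrow> 'c monoid \<Rightarrow> ('a \<Rightarrow> 'b) \<Rightarrow> ('b \<Rightarrow> 'c) \<Rightarrow> ('a \<times> 'c \<Rightarrow> 'b) \<Rightarrow> bool" where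
  "extension_trivialization A \<Gamma> G \<iota> \<phi> \<psi> \<longleftrightarrow>
     \<psi> \<in> iso (A \<times>\<times> G) \<Gamma> \<and>
     (\<forall>a\<in>carrier A. \<psi> (a, \<one>\<^bsub>G\<^esub>) = \<iota> a) \<and>
     (\<forall>a\<in>carrier A. \<forall>x\<in>carrier G. \<phi> (\<psi> (a, x)) = x)"

definition trivial_extension ::
  "'a monoid \<Rightarrow> 'b monoid \<Rightarrow> 'c monoid \<Rightarrow> ('a \<Rightarrow> 'b) \<Rightarrow> ('b \<Rightarrow> 'c) \<Rightarrow> bool" where
  "trivial_extension A \<Gamma> G \<iota> \<phi> \<longleftrightarrow> (\<exists>\<psi>. extension_trivialization A \<Gamma> G \<iota> \<phi> \<psi>)"

definition restrict_over :: "'b monoid \<Rightarrow> ('b \<Rightarrow> 'c) \<Rightarrow> 'c set \<Rightarrow> 'b monoid" where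
  "restrict_over \<Gamma> \<phi> H = \<Gamma>\<lparr>carrier := {x \<in> carrier \<Gamma>. \<phi> x \<in> H}\<rparr>"

end

theory Submission
  imports Defs "HOL-Algebra.Multiplicative_Group"
begin

text \<open>
  Write \<open>G\<^sub>1 = F 1\<close> and \<open>e\<close> for the exponent of \<open>A\<close>.  The surface group \<open>G\<^sub>1\<close> has generators
  \<open>a\<^sub>j, b\<^sub>j\<close> (\<open>j < g\<close>) and the single relation that a product of commutators is trivial.  Lifting the
  generators to \<open>\<Gamma>\<close>, the same product of commutators becomes an element \<open>z\<close> of \<open>A\<close>, which is the only
  obstruction to lifting \<open>G\<^sub>1\<close> itself.  Adding to the lifts of \<open>a\<^sub>0, b\<^sub>0\<close> the standard generators of
  the integral Heisenberg group, whose central commutator cancels \<open>z\<close>, the obstruction disappears, so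
  there is a section \<open>s\<close> with \<open>s (u w) = s u s w z\<^bsup>x(u) y(w)\<^esup>\<close> for homomorphisms \<open>x, y\<close> to the
  integers with \<open>x a\<^sub>0 = 1\<close>.  Since \<open>z\<^bsup>e\<^esup> = 1\<close>, it is multiplicative on the kernel \<open>G\<^sub>1'\<close> of
  \<open>x mod e\<close>.

  A conjugate of \<open>i(G\<^sub>1')\<close> is the image of a section over the kernel of some homomorphism
  \<open>G\<^sub>1 \<rightarrow> \<int>/e\<close>.  There are at most \<open>e\<^bsup>2g\<^esup>\<close> such kernels, each of them is generated by \<open>2ge\<close>
  elements by Schreier's lemma, and so carries at most \<open>|A|\<^bsup>2ge\<^esup>\<close> sections.

  The presentation of \<open>G\<^sub>1\<close> comes from polar coordinates on the polygon, which exhibit the surface as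
  a quotient of a strip.  Generation: a path is cut into pieces inside contractible open sets.
  Homomorphisms out of the fundamental group: a loop is sampled finely, and the values of a locally
  defined cocycle on successive sample points are multiplied.
\<close>

section \<open>Homotopy of paths\<close>

text \<open>Over \<open>G_1\<close> the extension is classified by an element of
  \<open>H^2(G_1, A) = A\<close>, and pulling it back to an \<open>e\<close>-fold cover multiplies
  it by \<open>e\<close>, hence kills it. The Heisenberg coordinates make this explicit without
  cohomology: the obstruction becomes a product of two integral classes, and the product vanishes
  where \<open>x\<close> is divisible by \<open>e\<close>. Elements of \<Gamma> act on
  \<open>G_1\<close> by conjugation and need not preserve \<open>G_1'\<close>; this forces the count
  to run over the kernels of all homomorphisms to the integers mod \<open>e\<close>. A splitting
  requires homomorphisms out of \<open>G_1\<close>, so the relation found must be shown to be the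
  only one. Instead of covering spaces or van Kampen's theorem, a flat bundle is encoded by ratios
  of group elements at nearby points, an Alexander-Spanier cocycle: its holonomy is a finite
  product, and homotopy invariance is a check on small squares. The count gives
  \<open>|A|^(2ge) * e^(2g)\<close>, which lies below the stated bound because
  \<open>e \<le> e!\<close>.\<close>

definition path_homotopic :: "'a topology \<Rightarrow> (real \<Rightarrow> 'a) \<Rightarrow> (real \<Rightarrow> 'a) \<Rightarrow> bool" where
  "path_homotopic X p q \<longleftrightarrow>
     homotopic_with (\<lambda>r. r 0 = p 0 \<and> r 1 = p 1) (top_of_set {0..1::real}) X p q"

definition reverse_path :: "(real \<Rightarrow> 'a) \<Rightarrow> real \<Rightarrow> 'a" where
  "reverse_path p = (\<lambda>t. p (1 - t))"

lemma loop_homotopic_iff: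
  assumes "p 0 = x" "p 1 = x"
  shows "loop_homotopic X x p q \<longleftrightarrow> path_homotopic X p q"
  using assms by (simp add: loop_homotopic_def path_homotopic_def)

lemma path_homotopic_endpoints:
  assumes "path_homotopic X p q" shows "q 0 = p 0" "q 1 = p 1"
  using homotopic_with_imp_property[OF assms[unfolded path_homotopic_def]] by auto

lemma path_homotopic_pathin:
  assumes "path_homotopic X p q" shows "pathin X p" "pathin X q"
  using homotopic_with_imp_continuous_maps[OF assms[unfolded path_homotopic_def]]
  by (auto simp: pathin_def)

lemma path_homotopic_refl: "pathin X p \<Longrightarrow> path_homotopic X p p"
  by (simp add: path_homotopic_def pathin_def)

lemma path_homotopic_sym:
  assumes "path_homotopic X p q" shows "path_homotopic X q p"
  using homotopic_with_symD[OF assms[unfolded path_homotopic_def]]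
  unfolding path_homotopic_def path_homotopic_endpoints[OF assms] .

lemma path_homotopic_trans [trans]:
  assumes "path_homotopic X p q" "path_homotopic X q r" shows "path_homotopic X p r"
proof -
  have "homotopic_with (\<lambda>r. r 0 = p 0 \<and> r 1 = p 1) (top_of_set {0..1::real}) X q r"
    using assms(2) unfolding path_homotopic_def path_homotopic_endpoints[OF assms(1)] .
  with assms(1) show ?thesis
    unfolding path_homotopic_def by (rule homotopic_with_trans)
qed

text \<open>The straight-line homotopy stays in the convex set \<open>T\<close> and is pushed
  forward by \<open>P\<close>. With \<open>T\<close> the unit interval this yields the groupoid
  laws; with \<open>T\<close> a square or the strip it replaces a path by a broken line.\<close>

lemma path_homotopic_through_convex:
  fixes T :: "'b::real_normed_vector set"
  assumes T: "convex T" and P: "continuous_map (top_of_set T) X P"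
    and f: "continuous_on {0..1} f" "f \<in> {0..1} \<rightarrow> T"
    and g: "continuous_on {0..1} g" "g \<in> {0..1} \<rightarrow> T"
    and eq: "f 0 = g 0" "f 1 = g 1"
  shows "path_homotopic X (\<lambda>t. P (f t)) (\<lambda>t. P (g t))"
proof -
  let ?k = "\<lambda>y::real \<times> real. (1 - fst y) *\<^sub>R f (snd y) + fst y *\<^sub>R g (snd y)"
  have sub: "?k ` ({0..1} \<times> {0..1}) \<subseteq> T"
    using f(2) g(2) convexD_alt[OF T] by (fastforce simp: Pi_iff)
  have "continuous_on ({0..1} \<times> {0..1}) ?k"
    by (intro continuous_intros continuous_on_compose2[OF f(1)] continuous_on_compose2[OF g(1)]) auto
  then have "continuous_map (prod_topology (top_of_set {0..1}) (top_of_set {0..1})) (top_of_set T) ?k"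
    using sub by (auto simp: continuous_map_in_subtopology)
  then have "continuous_map (prod_topology (top_of_set {0..1}) (top_of_set {0..1})) X (P \<circ> ?k)"
    using P continuous_map_compose by blast
  then show ?thesis
    unfolding path_homotopic_def homotopic_with_def
    by (intro exI[of _ "P \<circ> ?k"]) (simp add: eq)
qed

lemma path_homotopic_reparam:
  assumes "pathin X p"
    and "continuous_on {0..1} f" "f \<in> {0..1} \<rightarrow> {0..1}"
    and "continuous_on {0..1} g" "g \<in> {0..1} \<rightarrow> {0..1}"
    and "f 0 = g 0" "f 1 = g 1"
  shows "path_homotopic X (\<lambda>t. p (f t)) (\<lambda>t. p (g t))"
  using assms by (intro path_homotopic_through_convex[of "{0..1::real}" X p f g]) (auto simp: pathin_def)

lemma loop_concat_endpoints [simp]: "loop_concat p q 0 = p 0" "loop_concat p q 1 = q 1"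
  by (auto simp: loop_concat_def)

lemma reverse_path_endpoints [simp]: "reverse_path p 0 = p 1" "reverse_path p 1 = p 0"
  by (auto simp: reverse_path_def)

lemma pathin_const_iff [simp]: "pathin X (\<lambda>t. x) \<longleftrightarrow> x \<in> topspace X"
  by (auto simp: pathin_def)

lemma pathin_in_topspace: "pathin X p \<Longrightarrow> t \<in> {0..1} \<Longrightarrow> p t \<in> topspace X"
  by (auto simp: pathin_def continuous_map_def)

lemma pathin_through:
  assumes "continuous_map (top_of_set T) X P" "continuous_on {0..1} f" "f \<in> {0..1} \<rightarrow> T"
  shows "pathin X (\<lambda>t. P (f t))"
proof -
  have "continuous_map (top_of_set {0..1}) (top_of_set T) f"
    using assms by (auto simp: continuous_map_in_subtopology)
  then show ?thesis
    using continuous_map_compose[of _ _ f, OF _ assms(1)] unfolding pathin_def o_def by blast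
qed

lemma pathin_reparam:
  assumes "pathin X p" "continuous_on {0..1} f" "f \<in> {0..1} \<rightarrow> {0..1}"
  shows "pathin X (\<lambda>t. p (f t))"
  using assms by (intro pathin_through[of "{0..1}" X p f]) (auto simp: pathin_def)

lemma pathin_reverse [simp]: "pathin X p \<Longrightarrow> pathin X (reverse_path p)"
  unfolding reverse_path_def
  by (rule pathin_reparam[of X p "\<lambda>t. 1 - t"]) (auto intro!: continuous_intros)

text \<open>Two homotopies are pasted side by side along the path parameter \<open>snd y\<close>;
  the first coordinate is the stage of the homotopy, so the seam has to match at every
  stage.\<close>

lemma continuous_map_concat_family:
  assumes h: "continuous_map (prod_topology (top_of_set {0..1::real}) (top_of_set {0..1::real})) X h"
    and k: "continuous_map (prod_topology (top_of_set {0..1::real}) (top_of_set {0..1::real})) X k"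
    and hk: "\<And>s. s \<in> {0..1} \<Longrightarrow> h (s, 1) = k (s, 0)"
  shows "continuous_map (prod_topology (top_of_set {0..1::real}) (top_of_set {0..1::real})) X
           (\<lambda>y::real \<times> real. if snd y \<le> 1/2 then h (fst y, 2 * snd y) else k (fst y, 2 * snd y - 1))"
proof -
  let ?Q = "prod_topology (top_of_set {0..1}) (top_of_set {0..1::real}) :: (real \<times> real) topology"
  let ?S = "top_of_set ({0..1} \<times> {0..1}) :: (real \<times> real) topology"
  have h': "continuous_map ?S X h" and k': "continuous_map ?S X k"
    using h k by simp_all
  have "continuous_map ?S X
      (\<lambda>y. if snd y \<le> 1/2 then h (fst y, 2 * snd y) else k (fst y, 2 * snd y - 1))"
  proof (rule continuous_map_cases_le)
    show "continuous_map ?S euclideanreal snd" "continuous_map ?S euclideanreal (\<lambda>x. 1/2)"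
      by (auto intro!: continuous_intros)
    have "continuous_map (subtopology ?S {x \<in> topspace ?S. snd x \<le> 1/2}) X (h \<circ> (\<lambda>y. (fst y, 2 * snd y)))"
      by (rule continuous_map_compose[OF _ h'])
        (auto simp: continuous_map_in_subtopology subtopology_subtopology intro!: continuous_intros)
    then show "continuous_map (subtopology ?S {x \<in> topspace ?S. snd x \<le> 1/2}) X (\<lambda>y. h (fst y, 2 * snd y))"
      by (simp add: o_def)
    have "continuous_map (subtopology ?S {x \<in> topspace ?S. 1/2 \<le> snd x}) X (k \<circ> (\<lambda>y. (fst y, 2 * snd y - 1)))"
      by (rule continuous_map_compose[OF _ k'])
        (auto simp: continuous_map_in_subtopology subtopology_subtopology intro!: continuous_intros)
    then show "continuous_map (subtopology ?S {x \<in> topspace ?S. 1/2 \<le> snd x}) X (\<lambda>y. k (fst y, 2 * snd y - 1))"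
      by (simp add: o_def)
    fix x assume "x \<in> topspace ?S" "snd x = 1/2"
    then have "2 * snd x = 1" "2 * snd x - 1 = 0" "fst x \<in> {0..1}" by (auto simp: mem_Times_iff)
    then show "h (fst x, 2 * snd x) = k (fst x, 2 * snd x - 1)"
      using hk[of "fst x"] by simp
  qed
  then show ?thesis by simp
qed

lemma path_homotopic_concat:
  assumes p: "path_homotopic X p p'" and q: "path_homotopic X q q'" and pq: "p 1 = q 0"
  shows "path_homotopic X (loop_concat p q) (loop_concat p' q')"
proof -
  obtain h where h: "continuous_map (prod_topology (top_of_set {0..1::real}) (top_of_set {0..1::real})) X h"
    "\<forall>x. h (0, x) = p x" "\<forall>x. h (1, x) = p' x" "\<forall>t\<in>{0..1}. h (t, 0) = p 0 \<and> h (t, 1) = p 1"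
    using p unfolding path_homotopic_def homotopic_with_def by blast
  obtain k where k: "continuous_map (prod_topology (top_of_set {0..1::real}) (top_of_set {0..1::real})) X k"
    "\<forall>x. k (0, x) = q x" "\<forall>x. k (1, x) = q' x" "\<forall>t\<in>{0..1}. k (t, 0) = q 0 \<and> k (t, 1) = q 1"
    using q unfolding path_homotopic_def homotopic_with_def by blast
  note c = continuous_map_concat_family[OF h(1) k(1)]
  show ?thesis
    unfolding path_homotopic_def homotopic_with_def
    by (intro exI conjI, rule c) (use h k pq in \<open>auto simp: loop_concat_def\<close>)
qed

lemma pathin_concat:
  assumes "pathin X p" "pathin X q" "p 1 = q 0"
  shows "pathin X (loop_concat p q)"
  by (rule path_homotopic_pathin(1)[OF path_homotopic_concat[OF path_homotopic_refl path_homotopic_refl]])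
    (fact assms)+

lemma path_homotopic_const_left:
  assumes "pathin X p" "p 0 = x" shows "path_homotopic X (loop_concat (\<lambda>t. x) p) p"
proof -
  have "loop_concat (\<lambda>t. x) p = (\<lambda>t. p (if t \<le> 1/2 then 0 else 2 * t - 1))"
    using assms by (auto simp: loop_concat_def)
  moreover have "path_homotopic X (\<lambda>t. p (if t \<le> 1/2 then 0 else 2 * t - 1)) (\<lambda>t. p t)"
    using assms by (intro path_homotopic_reparam continuous_on_cases_1 continuous_intros) auto
  ultimately show ?thesis by simp
qed

lemma path_homotopic_const_right:
  assumes "pathin X p" "p 1 = x" shows "path_homotopic X (loop_concat p (\<lambda>t. x)) p"
proof -
  have "loop_concat p (\<lambda>t. x) = (\<lambda>t. p (if t \<le> 1/2 then 2 * t else 1))"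
    using assms by (auto simp: loop_concat_def)
  moreover have "path_homotopic X (\<lambda>t. p (if t \<le> 1/2 then 2 * t else 1)) (\<lambda>t. p t)"
    using assms by (intro path_homotopic_reparam continuous_on_cases_1 continuous_intros) auto
  ultimately show ?thesis by simp
qed

lemma path_homotopic_assoc:
  assumes "pathin X p" "pathin X q" "pathin X r" "p 1 = q 0" "q 1 = r 0"
  shows "path_homotopic X (loop_concat (loop_concat p q) r) (loop_concat p (loop_concat q r))"
proof -
  let ?m = "loop_concat (loop_concat p q) r"
  \<comment> \<open>Piecewise linear map sending the break points 1/2, 3/4 of the right bracketing
    to the break points 1/4, 1/2 of the left one.\<close>
  let ?g = "\<lambda>t::real. if t \<le> 1/2 then t / 2 else if t \<le> 3/4 then t - 1/4 else 2 * t - 1"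
  have "loop_concat p (loop_concat q r) = (\<lambda>t. ?m (?g t))"
    by (auto simp: loop_concat_def fun_eq_iff algebra_simps add_divide_distrib diff_divide_distrib)
  moreover have "path_homotopic X (\<lambda>t. ?m t) (\<lambda>t. ?m (?g t))"
    using assms
    by (intro path_homotopic_reparam pathin_concat continuous_on_cases_1 continuous_intros) auto
  ultimately show ?thesis by simp
qed

lemma path_homotopic_reverse_right:
  assumes "pathin X p" shows "path_homotopic X (loop_concat p (reverse_path p)) (\<lambda>t. p 0)"
proof -
  have "loop_concat p (reverse_path p) = (\<lambda>t. p (if t \<le> 1/2 then 2 * t else 2 - 2 * t))"
    by (auto simp: loop_concat_def reverse_path_def)
  moreover have "path_homotopic X (\<lambda>t. p (if t \<le> 1/2 then 2 * t else 2 - 2 * t)) (\<lambda>t. p 0)"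
    using assms by (intro path_homotopic_reparam continuous_on_cases_1 continuous_intros) auto
  ultimately show ?thesis by simp
qed

lemma path_homotopic_reverse_left:
  assumes "pathin X p" shows "path_homotopic X (loop_concat (reverse_path p) p) (\<lambda>t. p 1)"
  using path_homotopic_reverse_right[OF pathin_reverse[OF assms]]
  by (simp add: reverse_path_def)

lemma loops_at_iff: "p \<in> loops_at X x \<longleftrightarrow> pathin X p \<and> p 0 = x \<and> p 1 = x"
  by (simp add: loops_at_def)

lemma loop_class_eq_iff:
  assumes "p \<in> loops_at X x" "q \<in> loops_at X x"
  shows "loop_class X x p = loop_class X x q \<longleftrightarrow> path_homotopic X p q"
proof -
  have "loop_class X x p = {r. path_homotopic X p r}" "loop_class X x q = {r. path_homotopic X q r}"
    using assms by (auto simp: loop_class_def loops_at_iff loop_homotopic_iff)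
  then show ?thesis
    using path_homotopic_refl[of X q] path_homotopic_sym[of X p q] path_homotopic_trans[of X p q]
      path_homotopic_trans[of X q p] assms(2) unfolding loops_at_iff by blast
qed

lemma mem_loop_class:
  assumes "p \<in> loops_at X x" "q \<in> loop_class X x p"
  shows "q \<in> loops_at X x" "path_homotopic X p q"
proof -
  have "p 0 = x" "p 1 = x" using assms(1) by (simp_all add: loops_at_iff)
  with assms(2) show pq: "path_homotopic X p q"
    by (simp add: loop_class_def loop_homotopic_def path_homotopic_def)
  show "q \<in> loops_at X x"
    using path_homotopic_endpoints[OF pq] path_homotopic_pathin[OF pq] assms(1)
    by (simp add: loops_at_iff)
qed

lemma self_mem_loop_class: "p \<in> loops_at X x \<Longrightarrow> p \<in> loop_class X x p"
  by (simp add: loop_class_def loops_at_def loop_homotopic_def pathin_def)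

lemma loops_at_concat:
  "p \<in> loops_at X x \<Longrightarrow> q \<in> loops_at X x \<Longrightarrow> loop_concat p q \<in> loops_at X x"
  by (auto simp: loops_at_iff pathin_concat)

lemma fundamental_group_carrier: "carrier (fundamental_group X x) = loop_class X x ` loops_at X x"
  by (simp add: fundamental_group_def)

lemma fundamental_group_one: "\<one>\<^bsub>fundamental_group X x\<^esub> = loop_class X x (\<lambda>t. x)"
  by (simp add: fundamental_group_def)

text \<open>The product is defined as a union over all representatives. By compatibility of
  concatenation with homotopy all the classes in the union coincide, and the index sets are
  nonempty, so the union is a single class.\<close>

lemma fundamental_group_mult:
  assumes "p \<in> loops_at X x" "q \<in> loops_at X x"
  shows "loop_class X x p \<otimes>\<^bsub>fundamental_group X x\<^esub> loop_class X x q = loop_class X x (loop_concat p q)"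
proof -
  have "loop_class X x (loop_concat p' q') = loop_class X x (loop_concat p q)"
    if "p' \<in> loop_class X x p" "q' \<in> loop_class X x q" for p' q'
  proof -
    have "path_homotopic X (loop_concat p q) (loop_concat p' q')"
      using mem_loop_class(2)[OF assms(1) that(1)] mem_loop_class(2)[OF assms(2) that(2)] assms
      by (intro path_homotopic_concat) (auto simp: loops_at_iff)
    then show ?thesis
      using loop_class_eq_iff[OF loops_at_concat[OF assms]
          loops_at_concat[OF mem_loop_class(1)[OF assms(1) that(1)] mem_loop_class(1)[OF assms(2) that(2)]]]
      by simp
  qed
  moreover have "loop_class X x p \<noteq> {}" "loop_class X x q \<noteq> {}"
    using self_mem_loop_class[OF assms(1)] self_mem_loop_class[OF assms(2)] by blast+
  ultimately show ?thesis
    unfolding fundamental_group_def by auto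
qed

lemma group_fundamental_group:
  assumes "x \<in> topspace X" shows "group (fundamental_group X x)"
proof (rule groupI)
  have const: "(\<lambda>t. x) \<in> loops_at X x" using assms by (simp add: loops_at_iff)
  then show "\<one>\<^bsub>fundamental_group X x\<^esub> \<in> carrier (fundamental_group X x)"
    by (simp add: fundamental_group_carrier fundamental_group_one)
  fix a assume "a \<in> carrier (fundamental_group X x)"
  then obtain p where p: "p \<in> loops_at X x" "a = loop_class X x p"
    by (auto simp: fundamental_group_carrier)
  show "\<one>\<^bsub>fundamental_group X x\<^esub> \<otimes>\<^bsub>fundamental_group X x\<^esub> a = a"
    using p const path_homotopic_const_left[of X p x]
    by (simp add: fundamental_group_one fundamental_group_mult loop_class_eq_iff loops_at_concat)
      (simp add: loops_at_iff)
  have "reverse_path p \<in> loops_at X x" using p by (auto simp: loops_at_iff)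
  moreover have "loop_class X x (reverse_path p) \<otimes>\<^bsub>fundamental_group X x\<^esub> a = \<one>\<^bsub>fundamental_group X x\<^esub>"
    using p const calculation path_homotopic_reverse_left[of X p]
    by (simp add: fundamental_group_one fundamental_group_mult loop_class_eq_iff loops_at_concat)
      (simp add: loops_at_iff)
  ultimately show "\<exists>b\<in>carrier (fundamental_group X x).
      b \<otimes>\<^bsub>fundamental_group X x\<^esub> a = \<one>\<^bsub>fundamental_group X x\<^esub>"
    by (auto simp: fundamental_group_carrier)
  fix b assume "b \<in> carrier (fundamental_group X x)"
  then obtain q where q: "q \<in> loops_at X x" "b = loop_class X x q"
    by (auto simp: fundamental_group_carrier)
  show "a \<otimes>\<^bsub>fundamental_group X x\<^esub> b \<in> carrier (fundamental_group X x)"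
    using p q by (auto simp: fundamental_group_mult fundamental_group_carrier loops_at_concat)
  fix c assume "c \<in> carrier (fundamental_group X x)"
  then obtain r where r: "r \<in> loops_at X x" "c = loop_class X x r"
    by (auto simp: fundamental_group_carrier)
  have "path_homotopic X (loop_concat (loop_concat p q) r) (loop_concat p (loop_concat q r))"
    using p q r by (intro path_homotopic_assoc) (auto simp: loops_at_iff)
  then show "a \<otimes>\<^bsub>fundamental_group X x\<^esub> b \<otimes>\<^bsub>fundamental_group X x\<^esub> c
      = a \<otimes>\<^bsub>fundamental_group X x\<^esub> (b \<otimes>\<^bsub>fundamental_group X x\<^esub> c)"
    using p q r by (simp add: fundamental_group_mult loops_at_concat loop_class_eq_iff)
qed

section \<open>Lebesgue numbers and subdivision of paths along an open cover\<close>

lemma Lebesgue_number_continuous_map: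
  fixes h :: "'b::heine_borel \<Rightarrow> 'a"
  assumes T: "compact T" and h: "continuous_map (top_of_set T) X h"
    and U: "\<And>i. i \<in> I \<Longrightarrow> openin X (U i)" and cov: "topspace X \<subseteq> (\<Union>i\<in>I. U i)"
  obtains \<epsilon> where "\<epsilon> > 0" "\<And>a. a \<in> T \<Longrightarrow> \<exists>i\<in>I. \<forall>b\<in>T. dist a b < \<epsilon> \<longrightarrow> h b \<in> U i"
proof -
  have "\<exists>V. open V \<and> {x \<in> T. h x \<in> U i} = T \<inter> V" if "i \<in> I" for i
    using openin_continuous_map_preimage[OF h U[OF that]] by (auto simp: openin_open)
  then obtain V where V: "\<And>i. i \<in> I \<Longrightarrow> open (V i)" "\<And>i. i \<in> I \<Longrightarrow> {x \<in> T. h x \<in> U i} = T \<inter> V i"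
    by metis
  have "T \<subseteq> \<Union>(V ` I)"
  proof
    fix x assume x: "x \<in> T"
    then have "h x \<in> topspace X" using h by (auto simp: continuous_map_def)
    then obtain i where "i \<in> I" "h x \<in> U i" using cov by blast
    then show "x \<in> \<Union>(V ` I)" using V(2) x by blast
  qed
  then obtain \<epsilon> where "\<epsilon> > 0" and \<epsilon>: "\<And>x. x \<in> T \<Longrightarrow> \<exists>G\<in>V ` I. ball x \<epsilon> \<subseteq> G"
    using Heine_Borel_lemma[OF T, of "V ` I"] V(1) by (metis (no_types, lifting) imageE)
  moreover have "\<exists>i\<in>I. \<forall>b\<in>T. dist a b < \<epsilon> \<longrightarrow> h b \<in> U i" if a: "a \<in> T" for a
  proof -
    obtain i where "i \<in> I" "ball a \<epsilon> \<subseteq> V i" using \<epsilon>[OF a] by blast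
    then have "\<forall>b\<in>T. dist a b < \<epsilon> \<longrightarrow> h b \<in> U i" using V(2) by fastforce
    with \<open>i \<in> I\<close> show ?thesis by blast
  qed
  ultimately show ?thesis using that by blast
qed

text \<open>The subdivision works for every \<open>N\<close> beyond a threshold and not just for one
  \<open>N\<close>, so that fine samples of the same path can be compared with each other.\<close>

lemma path_subdivision:
  assumes p: "pathin X p"
    and U: "\<And>i. i \<in> I \<Longrightarrow> openin X (U i)" and cov: "topspace X \<subseteq> (\<Union>i\<in>I. U i)"
  obtains N0 where "N0 > 0"
    "\<And>N m. N \<ge> N0 \<Longrightarrow> m < N \<Longrightarrow> \<exists>i\<in>I. \<forall>t. real m / real N \<le> t \<and> t \<le> real (Suc m) / real N \<longrightarrow> p t \<in> U i"
proof -
  obtain \<epsilon> where \<epsilon>: "\<epsilon> > 0" "\<And>a. a \<in> {0..1} \<Longrightarrow> \<exists>i\<in>I. \<forall>b\<in>{0..1}. dist a b < \<epsilon> \<longrightarrow> p b \<in> U i"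
    using Lebesgue_number_continuous_map[OF compact_Icc p[unfolded pathin_def] U cov] by metis
  obtain N0 where N0: "N0 > 0" "1 / real N0 < \<epsilon>"
    using \<epsilon>(1) nat_approx_posE by (metis of_nat_Suc zero_less_Suc)
  have "\<exists>i\<in>I. \<forall>t. real m / real N \<le> t \<and> t \<le> real (Suc m) / real N \<longrightarrow> p t \<in> U i"
    if "N \<ge> N0" "m < N" for N m
  proof -
    have N: "N > 0" "1 / real N < \<epsilon>"
      using that N0 by (auto intro: le_less_trans[OF _ N0(2)] simp: frac_le)
    have "real m / real N \<in> {0..1}" using that by auto
    then obtain i where i: "i \<in> I" "\<forall>b\<in>{0..1}. dist (real m / real N) b < \<epsilon> \<longrightarrow> p b \<in> U i"
      using \<epsilon>(2) by blast
    have "p t \<in> U i" if t: "real m / real N \<le> t" "t \<le> real (Suc m) / real N" for t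
    proof -
      have s: "real (Suc m) / real N \<le> 1" "0 \<le> real m / real N" using \<open>m < N\<close> by auto
      have "real (Suc m) / real N = real m / real N + 1 / real N" by (simp add: add_divide_distrib)
      then have "dist (real m / real N) t < \<epsilon>" using t N by (auto simp: dist_real_def)
      moreover have "t \<in> {0..1}" using order_trans[OF s(2) t(1)] order_trans[OF t(2) s(1)] by simp
      ultimately show ?thesis using i(2) by blast
    qed
    with i(1) show ?thesis by blast
  qed
  with N0(1) that show ?thesis by blast
qed

section \<open>Representing the path groupoid in the fundamental group\<close>

text \<open>A path from the base point to every point, chosen without continuity in
  \<open>y\<close>, retracts the path groupoid onto the fundamental group: \<open>\<kappa>\<close>
  closes a path up by the chosen paths to its end points. \<open>spoke_base\<close> makes
  \<open>\<kappa>\<close> agree with the class of a loop at \<open>x0\<close>.\<close>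

locale path_groupoid =
  fixes X :: "'a topology" and x0 :: 'a and \<eta> :: "'a \<Rightarrow> real \<Rightarrow> 'a"
  assumes base_in: "x0 \<in> topspace X"
    and spoke: "\<And>y. y \<in> topspace X \<Longrightarrow> pathin X (\<eta> y)"
      "\<And>y. y \<in> topspace X \<Longrightarrow> \<eta> y 0 = x0" "\<And>y. y \<in> topspace X \<Longrightarrow> \<eta> y 1 = y"
    and spoke_base: "path_homotopic X (\<eta> x0) (\<lambda>t. x0)"
begin

abbreviation \<pi> where "\<pi> \<equiv> fundamental_group X x0"

sublocale \<pi>: group \<pi>
  by (rule group_fundamental_group[OF base_in])

definition \<kappa> :: "(real \<Rightarrow> 'a) \<Rightarrow> (real \<Rightarrow> 'a) set" where
  "\<kappa> p = loop_class X x0 (loop_concat (loop_concat (\<eta> (p 0)) p) (reverse_path (\<eta> (p 1))))"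

lemma conjugate_loop:
  assumes "pathin X p"
  shows "loop_concat (loop_concat (\<eta> (p 0)) p) (reverse_path (\<eta> (p 1))) \<in> loops_at X x0"
proof -
  have "p 0 \<in> topspace X" "p 1 \<in> topspace X" using pathin_in_topspace[OF assms] by auto
  then show ?thesis using assms spoke unfolding loops_at_iff
    by (auto intro!: pathin_concat)
qed

lemma \<kappa>_closed [simp]: "pathin X p \<Longrightarrow> \<kappa> p \<in> carrier \<pi>"
  unfolding \<kappa>_def fundamental_group_carrier using conjugate_loop by blast

lemma \<kappa>_cong:
  assumes pq: "path_homotopic X p q" shows "\<kappa> p = \<kappa> q"
proof -
  note e = path_homotopic_endpoints[OF pq]
  have p: "pathin X p" "pathin X q" using path_homotopic_pathin[OF pq] .
  have *: "p 0 \<in> topspace X" "p 1 \<in> topspace X" using pathin_in_topspace[OF p(1)] by auto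
  have "path_homotopic X (loop_concat (loop_concat (\<eta> (p 0)) p) (reverse_path (\<eta> (p 1))))
     (loop_concat (loop_concat (\<eta> (q 0)) q) (reverse_path (\<eta> (q 1))))"
    unfolding e using * pq spoke by (intro path_homotopic_concat path_homotopic_refl) auto
  then show ?thesis unfolding \<kappa>_def
    using loop_class_eq_iff[OF conjugate_loop[OF p(1)] conjugate_loop[OF p(2)]] by simp
qed

text \<open>The spoke returning from the end of \<open>p\<close> and the spoke going out to the
  start of \<open>q\<close> are mutually inverse and cancel; the rest is rebracketing.\<close>

lemma \<kappa>_concat:
  assumes p: "pathin X p" and q: "pathin X q" and pq: "p 1 = q 0"
  shows "\<kappa> (loop_concat p q) = \<kappa> p \<otimes>\<^bsub>\<pi>\<^esub> \<kappa> q"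
proof -
  have T: "p 0 \<in> topspace X" "p 1 \<in> topspace X" "q 0 \<in> topspace X" "q 1 \<in> topspace X"
    using pathin_in_topspace[OF p] pathin_in_topspace[OF q] by auto
  define a b c where "a = \<eta> (p 0)" and "b = \<eta> (p 1)" and "c = reverse_path (\<eta> (q 1))"
  have A: "pathin X a" "a 1 = p 0" "pathin X b" "b 0 = x0" "b 1 = p 1" "pathin X c" "c 0 = q 1"
    using T spoke by (auto simp: a_def b_def c_def)
  note S = p q A
  let ?L = "loop_concat (loop_concat a (loop_concat p q)) c"
  let ?R = "loop_concat (loop_concat (loop_concat a p) (reverse_path b)) (loop_concat (loop_concat b q) c)"
  have "path_homotopic X ?R (loop_concat (loop_concat a p) (loop_concat (reverse_path b) (loop_concat (loop_concat b q) c)))"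
    using S pq by (intro path_homotopic_assoc pathin_concat) auto
  also have "path_homotopic X (loop_concat (loop_concat a p) (loop_concat (reverse_path b) (loop_concat (loop_concat b q) c)))
      (loop_concat (loop_concat a p) (loop_concat (reverse_path b) (loop_concat b (loop_concat q c))))"
    using S pq
    by (intro path_homotopic_concat path_homotopic_assoc path_homotopic_refl pathin_concat) auto
  also have "path_homotopic X (loop_concat (loop_concat a p) (loop_concat (reverse_path b) (loop_concat b (loop_concat q c))))
      (loop_concat (loop_concat a p) (loop_concat (loop_concat (reverse_path b) b) (loop_concat q c)))"
    using S pq
    by (intro path_homotopic_concat path_homotopic_sym[OF path_homotopic_assoc] path_homotopic_refl pathin_concat) auto
  also have "path_homotopic X (loop_concat (loop_concat a p) (loop_concat (loop_concat (reverse_path b) b) (loop_concat q c)))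
      (loop_concat (loop_concat a p) (loop_concat (\<lambda>t. b 1) (loop_concat q c)))"
    using S pq
    by (intro path_homotopic_concat path_homotopic_reverse_left path_homotopic_refl pathin_concat) auto
  also have "path_homotopic X (loop_concat (loop_concat a p) (loop_concat (\<lambda>t. b 1) (loop_concat q c)))
      (loop_concat (loop_concat a p) (loop_concat q c))"
    using S pq
    by (intro path_homotopic_concat path_homotopic_const_left path_homotopic_refl pathin_concat) auto
  also have "path_homotopic X (loop_concat (loop_concat a p) (loop_concat q c)) (loop_concat (loop_concat (loop_concat a p) q) c)"
    using S pq by (intro path_homotopic_sym[OF path_homotopic_assoc] pathin_concat) auto
  also have "path_homotopic X (loop_concat (loop_concat (loop_concat a p) q) c) ?L"
    using S pq by (intro path_homotopic_concat path_homotopic_assoc path_homotopic_refl pathin_concat) auto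
  finally have *: "path_homotopic X ?R ?L" .
  have "\<kappa> p = loop_class X x0 (loop_concat (loop_concat a p) (reverse_path b))"
    "\<kappa> q = loop_class X x0 (loop_concat (loop_concat b q) c)"
    "\<kappa> (loop_concat p q) = loop_class X x0 ?L"
    by (simp_all add: \<kappa>_def a_def b_def c_def pq)
  moreover have L: "loop_concat (loop_concat a p) (reverse_path b) \<in> loops_at X x0"
    "loop_concat (loop_concat b q) c \<in> loops_at X x0" "?L \<in> loops_at X x0"
    using conjugate_loop[OF p] conjugate_loop[OF q] conjugate_loop[OF pathin_concat[OF p q pq]]
    by (simp_all add: a_def b_def c_def pq)
  ultimately show ?thesis
    using * by (simp add: fundamental_group_mult loop_class_eq_iff loops_at_concat path_homotopic_sym)
qed

lemma \<kappa>_const: "y \<in> topspace X \<Longrightarrow> \<kappa> (\<lambda>t. y) = \<one>\<^bsub>\<pi>\<^esub>"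
proof -
  assume y: "y \<in> topspace X"
  have "loop_concat (\<lambda>t. y) (\<lambda>t. y) = (\<lambda>t. y)" by (auto simp: loop_concat_def)
  then have "\<kappa> (\<lambda>t. y) \<otimes>\<^bsub>\<pi>\<^esub> \<kappa> (\<lambda>t. y) = \<kappa> (\<lambda>t. y)"
    using \<kappa>_concat[of "\<lambda>t. y" "\<lambda>t. y"] y by simp
  then show ?thesis using y by (simp add: \<pi>.l_cancel_one')
qed

lemma \<kappa>_reverse:
  assumes "pathin X p" shows "\<kappa> (reverse_path p) = inv\<^bsub>\<pi>\<^esub> \<kappa> p"
proof -
  have "\<kappa> (reverse_path p) \<otimes>\<^bsub>\<pi>\<^esub> \<kappa> p = \<kappa> (loop_concat (reverse_path p) p)"
    using assms by (simp add: \<kappa>_concat)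
  also have "\<dots> = \<kappa> (\<lambda>t. p 1)" using assms by (intro \<kappa>_cong path_homotopic_reverse_left)
  also have "\<dots> = \<one>\<^bsub>\<pi>\<^esub>" using assms pathin_in_topspace[of X p 1] by (simp add: \<kappa>_const)
  finally show ?thesis using assms by (simp add: \<pi>.inv_equality)
qed

lemma \<kappa>_loop:
  assumes "p \<in> loops_at X x0" shows "\<kappa> p = loop_class X x0 p"
proof -
  have p: "pathin X p" "p 0 = x0" "p 1 = x0" using assms by (auto simp: loops_at_iff)
  have s: "pathin X (\<eta> x0)" "\<eta> x0 0 = x0" "\<eta> x0 1 = x0" using spoke base_in by auto
  have "path_homotopic X (loop_concat (\<eta> x0) (reverse_path (\<eta> x0))) (\<lambda>t. x0)"
    using path_homotopic_reverse_right[OF s(1)] s(2) by simp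
  moreover have "path_homotopic X (loop_concat (\<eta> x0) (reverse_path (\<eta> x0)))
      (loop_concat (\<lambda>t. x0) (reverse_path (\<eta> x0)))"
    using s spoke_base by (intro path_homotopic_concat path_homotopic_refl) auto
  moreover have "path_homotopic X (loop_concat (\<lambda>t. x0) (reverse_path (\<eta> x0))) (reverse_path (\<eta> x0))"
    using s by (intro path_homotopic_const_left) auto
  ultimately have r: "path_homotopic X (reverse_path (\<eta> x0)) (\<lambda>t. x0)"
    by (meson path_homotopic_sym path_homotopic_trans)
  have "path_homotopic X (loop_concat (loop_concat (\<eta> x0) p) (reverse_path (\<eta> x0)))
      (loop_concat (loop_concat (\<lambda>t. x0) p) (\<lambda>t. x0))"
    using p s spoke_base r by (intro path_homotopic_concat path_homotopic_refl) auto
  also have "path_homotopic X (loop_concat (loop_concat (\<lambda>t. x0) p) (\<lambda>t. x0)) (loop_concat (\<lambda>t. x0) p)"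
    using p base_in by (intro path_homotopic_const_right pathin_concat) auto
  also have "path_homotopic X (loop_concat (\<lambda>t. x0) p) p"
    using p by (intro path_homotopic_const_left) auto
  finally show ?thesis
    using loop_class_eq_iff[OF conjugate_loop[OF p(1)] assms] by (simp add: \<kappa>_def p)
qed

text \<open>Generation half of van Kampen's theorem: a loop is a product of segments, each inside
  one set of the cover. Since \<open>\<kappa>\<close> closes up every segment, all paths in
  \<open>U i\<close> are considered, not only loops, and connectedness of intersections does not
  enter.\<close>

lemma carrier_eq_if_small_paths:
  assumes H: "subgroup H \<pi>"
    and U: "\<And>i. i \<in> I \<Longrightarrow> openin X (U i)" and cov: "topspace X \<subseteq> (\<Union>i\<in>I. U i)"
    and small: "\<And>i p. i \<in> I \<Longrightarrow> pathin X p \<Longrightarrow> p \<in> {0..1} \<rightarrow> U i \<Longrightarrow> \<kappa> p \<in> H"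
  shows "H = carrier \<pi>"
proof
  show "H \<subseteq> carrier \<pi>" using H by (simp add: subgroup.subset)
  show "carrier \<pi> \<subseteq> H"
  proof
    fix C assume "C \<in> carrier \<pi>"
    then obtain p where p: "p \<in> loops_at X x0" "C = loop_class X x0 p"
      by (auto simp: fundamental_group_carrier)
    then have pin: "pathin X p" by (simp add: loops_at_iff)
    obtain N where N: "N > 0"
      "\<And>m. m < N \<Longrightarrow> \<exists>i\<in>I. \<forall>t. real m / real N \<le> t \<and> t \<le> real (Suc m) / real N \<longrightarrow> p t \<in> U i"
      using path_subdivision[OF pin U cov] by (metis order_refl)
    define seg where "seg = (\<lambda>a b t. p (a + t * (b - a)))"
    have seg: "pathin X (seg a b)" if "0 \<le> a" "a \<le> b" "b \<le> 1" for a b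
    proof -
      have "a + t * (b - a) \<le> 1" if "0 \<le> t" "t \<le> 1" for t
        using that \<open>a \<le> b\<close> \<open>b \<le> 1\<close> mult_left_le_one_le[of "b - a" t] by linarith
      then show ?thesis unfolding seg_def using that
        by (intro pathin_reparam[OF pin, of "\<lambda>t. a + t * (b - a)"]) (auto intro!: continuous_intros)
    qed
    have "\<kappa> (seg 0 (real m / real N)) \<in> H" if "m \<le> N" for m
      using that
    proof (induction m)
      case 0
      have "seg 0 (real 0 / real N) = (\<lambda>t. p 0)" by (simp add: seg_def)
      then show ?case
        using H pathin_in_topspace[OF pin, of 0] by (simp add: \<kappa>_const subgroup.one_closed)
    next
      case (Suc m)
      let ?a = "real m / real N" and ?b = "real (Suc m) / real N"
      have ab: "0 \<le> ?a" "?a \<le> ?b" "?b \<le> 1" using Suc.prems N(1) by (auto simp: divide_simps)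
      obtain i where i: "i \<in> I" "\<forall>t. ?a \<le> t \<and> t \<le> ?b \<longrightarrow> p t \<in> U i"
        using N(2)[of m] Suc.prems by auto
      have "seg ?a ?b \<in> {0..1} \<rightarrow> U i"
      proof
        fix t :: real assume t: "t \<in> {0..1}"
        have "t * (?b - ?a) \<le> 1 * (?b - ?a)" using t ab by (intro mult_right_mono) auto
        moreover have "0 \<le> t * (?b - ?a)" using t ab by simp
        ultimately show "seg ?a ?b t \<in> U i" unfolding seg_def using i(2) by auto
      qed
      then have s: "\<kappa> (seg ?a ?b) \<in> H" using small i(1) seg[OF ab] by blast
      \<comment> \<open>Runs through \<open>{0..?a}\<close> in the first half of the time and
        through \<open>{?a..?b}\<close> in the second, so that \<open>p\<close> composed with it is
        literally a concatenation.\<close>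
      let ?g = "\<lambda>t::real. if t \<le> 1/2 then 2 * t * ?a else ?a + (2 * t - 1) * (?b - ?a)"
      have "path_homotopic X (\<lambda>t. p (t * ?b)) (\<lambda>t. p (?g t))"
      proof (rule path_homotopic_reparam[OF pin])
        show "continuous_on {0..1} ?g"
          by (intro continuous_on_cases_1 continuous_intros) auto
        show "?g \<in> {0..1} \<rightarrow> {0..1}"
        proof
          fix t :: real assume t: "t \<in> {0..1}"
          have "(2 * t - 1) * (?b - ?a) \<le> 1 * (?b - ?a)" using t ab by (intro mult_right_mono) auto
          moreover have "2 * t * ?a \<le> 1 * ?a" if "t \<le> 1/2" using that ab by (intro mult_right_mono) auto
          moreover have "0 \<le> (2 * t - 1) * (?b - ?a)" if "\<not> t \<le> 1/2" using that ab by simp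
          moreover have "0 \<le> 2 * t * ?a" using t ab by simp
          ultimately show "?g t \<in> {0..1}" using ab by (auto simp del: mult_le_cancel_right1)
        qed
        show "(\<lambda>t. t * ?b) \<in> {0..1} \<rightarrow> {0..1}" 
          using ab by (auto simp del: times_divide_eq_right intro!: mult_le_one)
      qed (use N in \<open>auto intro!: continuous_intros\<close>)
      moreover have "(\<lambda>t. p (?g t)) = loop_concat (seg 0 ?a) (seg ?a ?b)"
        by (auto simp: seg_def loop_concat_def)
      moreover have "(\<lambda>t. p (t * ?b)) = seg 0 ?b" by (simp add: seg_def)
      ultimately have "\<kappa> (seg 0 ?b) = \<kappa> (loop_concat (seg 0 ?a) (seg ?a ?b))"
        using \<kappa>_cong by simp
      also have "\<dots> = \<kappa> (seg 0 ?a) \<otimes>\<^bsub>\<pi>\<^esub> \<kappa> (seg ?a ?b)"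
        using seg[of 0 ?a] seg[OF ab] ab by (intro \<kappa>_concat) (auto simp: seg_def)
      finally show ?case using s Suc H by (simp add: subgroup.m_closed)
    qed
    from this[of N] N(1) have "\<kappa> (seg 0 1) \<in> H" by simp
    moreover have "seg 0 1 = p" by (simp add: seg_def)
    ultimately show "C \<in> H" using \<kappa>_loop[OF p(1)] p(2) by simp
  qed
qed

text \<open>The square with value \<open>h (p s, t)\<close> at \<open>(s, t)\<close> has
  \<open>p\<close> as its bottom edge and a constant top edge, so \<open>p\<close> is homotopic to
  the left edge followed by the reversed right edge. The contraction takes place in \<open>X\<close>
  and may leave \<open>U\<close>.\<close>

lemma \<kappa>_in_contractible:
  assumes h: "continuous_map (prod_topology (subtopology X U) (top_of_set {0..1::real})) X h"
    and h0: "\<And>u. u \<in> U \<Longrightarrow> h (u, 0) = u" and h1: "\<And>u. u \<in> U \<Longrightarrow> h (u, 1) = v"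
    and p: "pathin X p" "p \<in> {0..1} \<rightarrow> U"
  shows "\<kappa> p = \<kappa> (\<lambda>t. h (p 0, t)) \<otimes>\<^bsub>\<pi>\<^esub> inv\<^bsub>\<pi>\<^esub> \<kappa> (\<lambda>t. h (p 1, t))"
proof -
  let ?T = "{0..1} \<times> {0..1} :: (real \<times> real) set"
  let ?P = "\<lambda>y. h (p (fst y), snd y)"
  have "continuous_map (top_of_set {0..1}) (subtopology X U) p"
    using p by (auto simp: pathin_def continuous_map_in_subtopology)
  then have "continuous_map (top_of_set ?T) (subtopology X U) (p \<circ> fst)"
    by (rule continuous_map_compose[rotated])
      (auto simp: continuous_map_in_subtopology intro!: continuous_intros)
  moreover have "continuous_map (top_of_set ?T) (top_of_set {0..1}) snd"
    by (auto simp: continuous_map_in_subtopology intro!: continuous_intros)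
  ultimately have "continuous_map (top_of_set ?T) (prod_topology (subtopology X U) (top_of_set {0..1}))
      (\<lambda>y. (p (fst y), snd y))"
    by (simp add: continuous_map_pairedI o_def)
  then have P: "continuous_map (top_of_set ?T) X ?P"
    using continuous_map_compose[OF _ h] by (simp add: o_def)
  have paths: "pathin X (\<lambda>t. h (p s, t))" if "s \<in> {0..1}" for s
    using pathin_through[OF P continuous_on_Pair[OF continuous_on_const continuous_on_id], of s] that
    by auto
  let ?f = "\<lambda>t::real. (t, 0::real)"
  let ?g = "\<lambda>t::real. if t \<le> 1/2 then (0, 2 * t)
     else if t \<le> 3/4 then (4 * t - 2, 1) else (1, 4 - 4 * t)"
  have "path_homotopic X (\<lambda>t. ?P (?f t)) (\<lambda>t. ?P (?g t))"
  proof (rule path_homotopic_through_convex[OF _ P])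
    show "convex ?T" by (intro convex_Times) auto
    show "continuous_on {0..1} ?g"
      by (intro continuous_on_cases_1 continuous_intros) auto
  qed (auto intro!: continuous_intros)
  moreover have "path_homotopic X (\<lambda>t. ?P (?f t)) p"
    unfolding path_homotopic_def
  proof (rule homotopic_with_equal)
    show "continuous_map (top_of_set {0..1}) X (\<lambda>t. ?P (?f t))"
      using path_homotopic_pathin[OF calculation(1)] by (simp add: pathin_def)
  qed (use p h0 in \<open>auto simp: Pi_iff\<close>)
  moreover have "path_homotopic X (\<lambda>t. ?P (?g t))
     (loop_concat (\<lambda>t. h (p 0, t)) (loop_concat (\<lambda>t. v) (reverse_path (\<lambda>t. h (p 1, t)))))"
    unfolding path_homotopic_def
  proof (rule homotopic_with_equal)
    show "continuous_map (top_of_set {0..1}) X (\<lambda>t. ?P (?g t))"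
      using path_homotopic_pathin[OF calculation(1)] by (simp add: pathin_def)
    fix t :: real assume "t \<in> topspace (top_of_set {0..1})"
    then have t: "0 \<le> t" "t \<le> 1" by auto
    consider "t \<le> 1/2" | "1/2 < t" "t \<le> 3/4" | "3/4 < t" by linarith
    then show "?P (?g t) = loop_concat (\<lambda>t. h (p 0, t)) (loop_concat (\<lambda>t. v) (reverse_path (\<lambda>t. h (p 1, t)))) t"
    proof cases
      case 2
      then have "p (4 * t - 2) \<in> U" using p(2) by (auto simp: Pi_iff)
      then show ?thesis using 2 h1 by (simp add: loop_concat_def)
    next
      case 3
      then have "4 - 4 * t = 1 - (2 * (2 * t - 1) - 1)" by simp
      then show ?thesis using 3 by (simp add: loop_concat_def reverse_path_def)
    qed (simp add: loop_concat_def)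
  qed auto
  ultimately have *: "\<kappa> p = \<kappa> (loop_concat (\<lambda>t. h (p 0, t)) (loop_concat (\<lambda>t. v) (reverse_path (\<lambda>t. h (p 1, t)))))"
    by (intro \<kappa>_cong) (rule path_homotopic_trans[OF path_homotopic_trans[OF path_homotopic_sym]])
  have e: "h (p 0, 1) = v" "h (p 1, 1) = v" using h1 p(2) by (auto simp: Pi_iff)
  then have v: "v \<in> topspace X" using pathin_in_topspace[OF paths[of 0], of 1] by simp
  show ?thesis
    unfolding * using paths[of 0] paths[of 1] v e
    by (simp add: \<kappa>_concat pathin_concat \<kappa>_const \<kappa>_reverse)
qed

end

section \<open>Holonomy of a locally defined cocycle\<close>

text \<open>The potentials \<open>f i\<close> need not be continuous: only the ratios \<open>f i x\<inverse> f i y\<close>, which do not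
  depend on \<open>i\<close>, enter.\<close>

locale flat_cocycle = group K for K :: "'k monoid" (structure) +
  fixes X :: "'a topology" and I :: "'i set" and U :: "'i \<Rightarrow> 'a set" and f :: "'i \<Rightarrow> 'a \<Rightarrow> 'k"
  assumes open_U: "\<And>i. i \<in> I \<Longrightarrow> openin X (U i)" and cover: "topspace X \<subseteq> (\<Union>i\<in>I. U i)"
    and f_closed: "\<And>i x. i \<in> I \<Longrightarrow> x \<in> U i \<Longrightarrow> f i x \<in> carrier K"
    and compatible: "\<And>i j x y. \<lbrakk>i \<in> I; j \<in> I; x \<in> U i; y \<in> U i; x \<in> U j; y \<in> U j\<rbrakk>
      \<Longrightarrow> inv (f i x) \<otimes> f i y = inv (f j x) \<otimes> f j y"
begin

text \<open>An Alexander-Spanier 1-cocycle with values in a possibly non-abelian group. By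
  \<open>compatible\<close> the choice of \<open>i\<close> is immaterial when \<open>x\<close> and
  \<open>y\<close> share a patch; other pairs get a meaningless value, and sampling has to be fine
  enough to avoid them.\<close>

definition c :: "'a \<Rightarrow> 'a \<Rightarrow> 'k" where
  "c x y = (let i = (SOME i. i \<in> I \<and> x \<in> U i \<and> y \<in> U i) in inv (f i x) \<otimes> f i y)"

lemma c_eq:
  assumes "i \<in> I" "x \<in> U i" "y \<in> U i" shows "c x y = inv (f i x) \<otimes> f i y"
proof -
  let ?j = "SOME i. i \<in> I \<and> x \<in> U i \<and> y \<in> U i"
  have "?j \<in> I \<and> x \<in> U ?j \<and> y \<in> U ?j" by (rule someI[of _ i]) (use assms in auto)
  then show ?thesis unfolding c_def Let_def using assms compatible by blast
qed

lemma c_closed: "i \<in> I \<Longrightarrow> x \<in> U i \<Longrightarrow> y \<in> U i \<Longrightarrow> c x y \<in> carrier K"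
  by (simp add: c_eq f_closed)

lemma ratio_mult:
  assumes "a \<in> carrier K" "b \<in> carrier K" "d \<in> carrier K"
  shows "(inv a \<otimes> b) \<otimes> (inv b \<otimes> d) = inv a \<otimes> d"
  using assms by (metis inv_closed inv_solve_left m_assoc m_closed)

lemma c_mult:
  assumes "i \<in> I" "x \<in> U i" "y \<in> U i" "z \<in> U i" shows "c x y \<otimes> c y z = c x z"
  using assms by (simp add: c_eq f_closed ratio_mult)

lemma c_self: "x \<in> topspace X \<Longrightarrow> c x x = \<one>"
  using cover c_eq f_closed by (metis UN_E l_inv subsetD)

primrec chain :: "(nat \<Rightarrow> 'a) \<Rightarrow> nat \<Rightarrow> 'k" where
  "chain s 0 = \<one>"
| "chain s (Suc n) = chain s n \<otimes> c (s n) (s (Suc n))"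

lemma chain_closed: "(\<And>m. m < n \<Longrightarrow> c (s m) (s (Suc m)) \<in> carrier K) \<Longrightarrow> chain s n \<in> carrier K"
  by (induction n) auto

lemma chain_cong: "(\<And>m. m \<le> n \<Longrightarrow> s m = s' m) \<Longrightarrow> chain s n = chain s' n"
  by (induction n) auto

lemma chain_add:
  assumes "\<And>m. m < a + b \<Longrightarrow> c (s m) (s (Suc m)) \<in> carrier K"
  shows "chain s (a + b) = chain s a \<otimes> chain (\<lambda>m. s (a + m)) b"
  using assms
proof (induction b)
  case 0
  then show ?case using chain_closed[of a s] by simp
next
  case (Suc b)
  have "chain s a \<in> carrier K" "chain (\<lambda>m. s (a + m)) b \<in> carrier K"
    using Suc.prems by (auto intro!: chain_closed)
  then show ?case using Suc by (simp add: m_assoc)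
qed

lemma chain_ratio:
  assumes "\<And>m. m \<le> n \<Longrightarrow> u m \<in> carrier K"
    and "\<And>m. m < n \<Longrightarrow> c (s m) (s (Suc m)) = inv (u m) \<otimes> u (Suc m)"
  shows "chain s n = inv (u 0) \<otimes> u n"
  using assms by (induction n) (auto simp: ratio_mult)

text \<open>The \<open>M\<close> short steps inside one patch telescope to the single long step that
  they replace.\<close>

lemma chain_refine:
  assumes "\<And>m. m < n \<Longrightarrow> \<exists>i\<in>I. \<forall>k\<le>M. s (M * m + k) \<in> U i"
  shows "chain s (M * n) = chain (\<lambda>m. s (M * m)) n"
  using assms
proof (induction n)
  case (Suc n)
  have cl: "c (s j) (s (Suc j)) \<in> carrier K" if "j < M * n + M" for j
  proof -
    have "M > 0" using that by (cases M) auto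
    then have "j div M < Suc n" "j = M * (j div M) + j mod M" "j mod M < M"
      using that by (auto simp: div_less_iff_less_mult algebra_simps)
    moreover obtain i where "i \<in> I" "\<forall>k\<le>M. s (M * (j div M) + k) \<in> U i"
      using Suc.prems calculation(1) by blast
    ultimately show ?thesis
      using c_closed by (metis Suc_leI add_Suc_right less_imp_le_nat)
  qed
  obtain i where i: "i \<in> I" "\<forall>k\<le>M. s (M * n + k) \<in> U i" using Suc.prems by blast
  have "chain (\<lambda>m. s (M * n + m)) M = inv (f i (s (M * n + 0))) \<otimes> f i (s (M * n + M))"
  proof (rule chain_ratio[of M "\<lambda>k. f i (s (M * n + k))"])
    show "f i (s (M * n + m)) \<in> carrier K" if "m \<le> M" for m using i that by (simp add: f_closed)
    show "c (s (M * n + m)) (s (M * n + Suc m)) = inv f i (s (M * n + m)) \<otimes> f i (s (M * n + Suc m))"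
      if "m < M" for m
      using i(2)[rule_format, of m] i(2)[rule_format, of "Suc m"] that by (intro c_eq[OF i(1)]) auto
  qed
  also have "\<dots> = c (s (M * n)) (s (M * Suc n))"
    using i(2)[rule_format, of 0] i(2)[rule_format, of M] i(1) by (simp add: c_eq add.commute)
  finally have "chain (\<lambda>m. s (M * n + m)) M = c (s (M * n)) (s (M * Suc n))" .
  moreover have "chain s (M * Suc n) = chain s (M * n) \<otimes> chain (\<lambda>m. s (M * n + m)) M"
    using chain_add[of "M * n" M s] cl by (simp add: add.commute)
  ultimately show ?case using Suc by simp
qed simp

section \<open>Holonomy as the eventual value of samples, and its homotopy invariance\<close>

definition sample :: "(real \<Rightarrow> 'a) \<Rightarrow> nat \<Rightarrow> 'k" where
  "sample p N = chain (\<lambda>m. p (real m / real N)) N"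

definition hol :: "(real \<Rightarrow> 'a) \<Rightarrow> 'k" where
  "hol p = (SOME k. \<exists>N0. \<forall>N\<ge>N0. sample p N = k)"

text \<open>Samples at \<open>N\<close> and at \<open>N0\<close> agree because both equal the sample
  at the common refinement \<open>N * N0\<close>; hence the sequence of samples is eventually
  constant and \<open>hol\<close> picks that constant.\<close>

lemma sample_subdivision:
  assumes "pathin X p"
  obtains N0 where "N0 > 0" "\<And>N. N \<ge> N0 \<Longrightarrow> sample p N = hol p"
    "\<And>N m. N \<ge> N0 \<Longrightarrow> m < N \<Longrightarrow> c (p (real m / real N)) (p (real (Suc m) / real N)) \<in> carrier K"
proof -
  obtain N0 where N0: "N0 > 0"
    "\<And>N m. N \<ge> N0 \<Longrightarrow> m < N \<Longrightarrow> \<exists>i\<in>I. \<forall>t. real m / real N \<le> t \<and> t \<le> real (Suc m) / real N \<longrightarrow> p t \<in> U i"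
    using path_subdivision[OF assms open_U cover] by metis
  have refine: "sample p (M * N) = sample p N" if "N \<ge> N0" "M > 0" for M N
  proof -
    have N: "N > 0" using that N0 by simp
    have "\<exists>i\<in>I. \<forall>k\<le>M. p (real (M * m + k) / real (M * N)) \<in> U i" if m: "m < N" for m
    proof -
      obtain i where i: "i \<in> I" "\<forall>t. real m / real N \<le> t \<and> t \<le> real (Suc m) / real N \<longrightarrow> p t \<in> U i"
        using N0(2)[OF \<open>N \<ge> N0\<close> m] by blast
      have "real m / real N \<le> real (M * m + k) / real (M * N)
          \<and> real (M * m + k) / real (M * N) \<le> real (Suc m) / real N" if "k \<le> M" for k
      proof -
        have "real m / real N = real (M * m) / real (M * N)"
          "real (Suc m) / real N = real (M * m + M) / real (M * N)"
          using \<open>M > 0\<close> N by (auto simp: divide_simps algebra_simps)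
        then show ?thesis using that by (auto intro!: divide_right_mono simp del: of_nat_add of_nat_mult)
      qed
      with i show ?thesis by blast
    qed
    then have "sample p (M * N) = chain (\<lambda>m. p (real (M * m) / real (M * N))) N"
      unfolding sample_def by (intro chain_refine) auto
    also have "\<dots> = sample p N"
      unfolding sample_def using \<open>M > 0\<close> by (intro chain_cong) auto
    finally show ?thesis .
  qed
  have "\<forall>N\<ge>N0. sample p N = sample p N0"
    using refine N0(1) by (metis le_trans less_le_trans mult.commute order_refl)
  then have "\<exists>k. \<exists>N0. \<forall>N\<ge>N0. sample p N = k" by blast
  then have "\<exists>N0. \<forall>N\<ge>N0. sample p N = hol p" unfolding hol_def by (rule someI_ex)
  then obtain N1 where "\<forall>N\<ge>N1. sample p N = hol p" by blast
  moreover have "c (p (real m / real N)) (p (real (Suc m) / real N)) \<in> carrier K"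
    if Nm: "N \<ge> N0" "m < N" for N m
  proof -
    obtain i where "i \<in> I" "\<forall>t. real m / real N \<le> t \<and> t \<le> real (Suc m) / real N \<longrightarrow> p t \<in> U i"
      using N0(2)[OF Nm] by blast
    moreover have "real m / real N \<le> real (Suc m) / real N" by (intro divide_right_mono) auto
    ultimately show ?thesis by (auto intro!: c_closed[of i])
  qed
  ultimately show ?thesis using N0(1) by (intro that[of "max N0 N1"]) auto
qed

lemma hol_closed: assumes "pathin X p" shows "hol p \<in> carrier K"
  using sample_subdivision[OF assms] chain_closed unfolding sample_def by (metis order_refl)

lemma hol_unique: assumes "pathin X p" "\<And>N. N \<ge> N0 \<Longrightarrow> sample p N = k" shows "hol p = k"
  using sample_subdivision[OF assms(1)] assms(2) by (metis max.cobounded1 max.cobounded2)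

text \<open>Tool for computing a holonomy: \<open>u\<close> is a potential along the parameter
  interval, possibly with jumps, and the sampled product telescopes.\<close>

lemma hol_ratio:
  assumes p: "pathin X p" and u: "\<And>t. t \<in> {0..1} \<Longrightarrow> u t \<in> carrier K" and "\<epsilon> > 0"
    and ratio: "\<And>s t. \<lbrakk>s \<in> {0..1}; t \<in> {0..1}; s \<le> t; t - s < \<epsilon>\<rbrakk> \<Longrightarrow> c (p s) (p t) = inv (u s) \<otimes> u t"
  shows "hol p = inv (u 0) \<otimes> u 1"
proof -
  obtain N0 where N0: "N0 > 0" "1 / real N0 < \<epsilon>"
    using \<open>\<epsilon> > 0\<close> nat_approx_posE by (metis of_nat_Suc zero_less_Suc)
  show ?thesis
  proof (rule hol_unique[OF p])
    fix N assume N: "N \<ge> N0"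
    have "1 / real N < \<epsilon>"
      using N N0 by (auto intro: le_less_trans[OF _ N0(2)] simp: frac_le)
    then have "sample p N = inv (u (real 0 / real N)) \<otimes> u (real N / real N)"
      unfolding sample_def
      by (intro chain_ratio[of N "\<lambda>m. u (real m / real N)"] u ratio)
        (auto simp: divide_simps)
    then show "sample p N = inv (u 0) \<otimes> u 1" using N N0 by simp
  qed
qed

lemma hol_concat:
  assumes p: "pathin X p" and q: "pathin X q" and pq: "p 1 = q 0"
  shows "hol (loop_concat p q) = hol p \<otimes> hol q"
proof -
  obtain Np where Np: "Np > 0" "\<And>N. N \<ge> Np \<Longrightarrow> sample p N = hol p"
    "\<And>N m. N \<ge> Np \<Longrightarrow> m < N \<Longrightarrow> c (p (real m / real N)) (p (real (Suc m) / real N)) \<in> carrier K"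
    using sample_subdivision[OF p] by metis
  obtain Nq where Nq: "Nq > 0" "\<And>N. N \<ge> Nq \<Longrightarrow> sample q N = hol q"
    "\<And>N m. N \<ge> Nq \<Longrightarrow> m < N \<Longrightarrow> c (q (real m / real N)) (q (real (Suc m) / real N)) \<in> carrier K"
    using sample_subdivision[OF q] by metis
  obtain Nr where Nr: "Nr > 0" "\<And>N. N \<ge> Nr \<Longrightarrow> sample (loop_concat p q) N = hol (loop_concat p q)"
    "\<And>N m. N \<ge> Nr \<Longrightarrow> m < N \<Longrightarrow>
      c (loop_concat p q (real m / real N)) (loop_concat p q (real (Suc m) / real N)) \<in> carrier K"
    using sample_subdivision[OF pathin_concat[OF p q pq]] by metis
  define N where "N = max (max Np Nq) Nr"
  have N: "N \<ge> Np" "N \<ge> Nq" "N + N \<ge> Nr" "N > 0" using Np(1) by (auto simp: N_def)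
  define s where "s = (\<lambda>m. loop_concat p q (real m / real (N + N)))"
  have "hol (loop_concat p q) = chain s (N + N)"
    using Nr(2)[OF N(3)] by (simp add: sample_def s_def)
  also have "\<dots> = chain s N \<otimes> chain (\<lambda>m. s (N + m)) N"
    using Nr(3)[OF N(3)] by (intro chain_add) (simp add: s_def)
  also have "chain s N = sample p N"
    unfolding sample_def
  proof (rule chain_cong)
    fix m assume "m \<le> N"
    then have "real m / real (N + N) \<le> 1/2" "2 * (real m / real (N + N)) = real m / real N"
      using N(4) by (auto simp: divide_simps)
    then show "s m = p (real m / real N)" by (simp add: s_def loop_concat_def del: of_nat_add)
  qed
  also have "chain (\<lambda>m. s (N + m)) N = sample q N"
    unfolding sample_def
  proof (rule chain_cong)
    fix m assume "m \<le> N"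
    have *: "real (N + m) / real (N + N) = 1/2 + real m / real N / 2"
      using N(4) by (auto simp: divide_simps)
    \<comment> \<open>For \<open>m = 0\<close> the sample point is the parameter 1/2, where
      \<open>loop_concat\<close> still follows \<open>p\<close>; there \<open>p 1 = q 0\<close> is
      what counts.\<close>
    show "s (N + m) = q (real m / real N)"
    proof (cases "m = 0")
      case True
      then have "real (N + m) / real (N + N) = 1/2" using * by simp
      then show ?thesis using True pq N(4) by (simp add: s_def loop_concat_def)
    next
      case False
      then have "real m / real N > 0" using N(4) by simp
      then show ?thesis using * by (simp add: s_def loop_concat_def del: of_nat_add)
    qed
  qed
  finally show ?thesis using Np(2)[OF N(1)] Nq(2)[OF N(2)] by simp
qed

text \<open>On a grid so fine that each cell lies in one patch, the product of the cocycle around a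
  cell is trivial. Pushing a vertical step across a row compares neighbouring rows, and on the two
  sides of the square the vertical steps are trivial since the end points are fixed.\<close>

lemma hol_homotopic:
  assumes pq: "path_homotopic X p q" shows "hol p = hol q"
proof -
  let ?T = "{0..1} \<times> {0..1} :: (real \<times> real) set"
  have pin: "pathin X p" "pathin X q" using path_homotopic_pathin[OF pq] .
  obtain h where h: "continuous_map (prod_topology (top_of_set {0..1::real}) (top_of_set {0..1::real})) X h"
    "\<forall>x. h (0, x) = p x" "\<forall>x. h (1, x) = q x" "\<forall>t\<in>{0..1}. h (t, 0) = p 0 \<and> h (t, 1) = p 1"
    using pq unfolding path_homotopic_def homotopic_with_def by blast
  have h': "continuous_map (top_of_set ?T) X h" using h(1) by simp
  have "compact ?T" by (intro compact_Times) auto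
  then obtain \<epsilon> where \<epsilon>: "\<epsilon> > 0" "\<And>a. a \<in> ?T \<Longrightarrow> \<exists>i\<in>I. \<forall>b\<in>?T. dist a b < \<epsilon> \<longrightarrow> h b \<in> U i"
    using Lebesgue_number_continuous_map[OF _ h' open_U cover] by metis
  obtain N0 where N0: "N0 > 0" "1 / real N0 < \<epsilon> / 2"
    using half_gt_zero[OF \<epsilon>(1)] nat_approx_posE by (metis of_nat_Suc zero_less_Suc)
  obtain Np where Np: "\<And>N. N \<ge> Np \<Longrightarrow> sample p N = hol p" using sample_subdivision[OF pin(1)] by metis
  obtain Nq where Nq: "\<And>N. N \<ge> Nq \<Longrightarrow> sample q N = hol q" using sample_subdivision[OF pin(2)] by metis
  define N where "N = max (max Np Nq) N0"
  have N: "N \<ge> Np" "N \<ge> Nq" "N \<ge> N0" "N > 0" using N0(1) by (auto simp: N_def)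
  \<comment> \<open>Any corner of a cell is within \<open>1 / N + 1 / N\<close> of its lower left
    corner.\<close>
  have eN: "2 / real N < \<epsilon>"
  proof -
    have "1 / real N \<le> 1 / real N0" using N N0 by (simp add: frac_le)
    then show ?thesis using N0(2) by linarith
  qed
  define x where "x = (\<lambda>a b. h (real a / real N, real b / real N))"
  have cell: "\<exists>i\<in>I. x a b \<in> U i \<and> x (Suc a) b \<in> U i \<and> x a (Suc b) \<in> U i \<and> x (Suc a) (Suc b) \<in> U i"
    if ab: "a < N" "b < N" for a b
  proof -
    have T: "(real a' / real N, real b' / real N) \<in> ?T" if "a' \<le> N" "b' \<le> N" for a' b'
      using that N(4) by auto
    obtain i where i: "i \<in> I" "\<forall>b'\<in>?T. dist (real a / real N, real b / real N) b' < \<epsilon> \<longrightarrow> h b' \<in> U i"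
      using \<epsilon>(2)[OF T[of a b]] ab by auto
    have "x a' b' \<in> U i" if "a' \<in> {a, Suc a}" "b' \<in> {b, Suc b}" for a' b'
    proof -
      have "dist (real a / real N, real b / real N) (real a' / real N, real b' / real N)
          \<le> dist (real a / real N) (real a' / real N) + dist (real b / real N) (real b' / real N)"
        unfolding dist_Pair_Pair by (rule sqrt_sum_squares_le_sum) auto
      also have "\<dots> \<le> 1 / real N + 1 / real N"
        using that by (intro add_mono) (auto simp: dist_real_def add_divide_distrib)
      also have "\<dots> < \<epsilon>" using eN by simp
      finally show ?thesis
        unfolding x_def using i(2) T[of a' b'] ab that by auto
    qed
    with i(1) show ?thesis by blast
  qed
  \<comment> \<open>Commutation of a vertical step with the first \<open>b\<close> horizontal steps,
    one cell at a time.\<close>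
  have inner: "chain (x a) b \<otimes> c (x a b) (x (Suc a) b)
      = c (x a 0) (x (Suc a) 0) \<otimes> chain (x (Suc a)) b" if aN: "a < N" and "b \<le> N" for a b
    using that(2)
  proof (induction b)
    case 0
    obtain i where "i \<in> I" "x a 0 \<in> U i" "x (Suc a) 0 \<in> U i" using cell[OF aN, of 0] N(4) by blast
    then show ?case using c_closed by simp
  next
    case (Suc b)
    obtain i where i: "i \<in> I" "x a b \<in> U i" "x (Suc a) b \<in> U i" "x a (Suc b) \<in> U i" "x (Suc a) (Suc b) \<in> U i"
      using cell[OF aN, of b] Suc.prems by auto
    have cl: "c (x a m) (x a (Suc m)) \<in> carrier K" "c (x (Suc a) m) (x (Suc a) (Suc m)) \<in> carrier K"
      if "m < N" for m
      using cell[OF \<open>a < N\<close> that] c_closed by blast+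
    have ch: "chain (x a) b \<in> carrier K" "chain (x (Suc a)) b \<in> carrier K"
      using cl Suc.prems by (auto intro!: chain_closed)
    obtain i0 where "i0 \<in> I" "x a 0 \<in> U i0" "x (Suc a) 0 \<in> U i0" using cell[OF aN, of 0] N(4) by blast
    then have c0: "c (x a 0) (x (Suc a) 0) \<in> carrier K" using c_closed by blast
    note clos = c_closed[OF i(1)] i
    have "chain (x a) (Suc b) \<otimes> c (x a (Suc b)) (x (Suc a) (Suc b))
        = chain (x a) b \<otimes> (c (x a b) (x a (Suc b)) \<otimes> c (x a (Suc b)) (x (Suc a) (Suc b)))"
      using ch clos by (simp add: m_assoc)
    also have "c (x a b) (x a (Suc b)) \<otimes> c (x a (Suc b)) (x (Suc a) (Suc b))
        = c (x a b) (x (Suc a) b) \<otimes> c (x (Suc a) b) (x (Suc a) (Suc b))"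
      using i by (simp add: c_mult[OF i(1)])
    also have "chain (x a) b \<otimes> \<dots> = (chain (x a) b \<otimes> c (x a b) (x (Suc a) b)) \<otimes> c (x (Suc a) b) (x (Suc a) (Suc b))"
      using ch clos by (simp add: m_assoc)
    also have "\<dots> = c (x a 0) (x (Suc a) 0) \<otimes> chain (x (Suc a)) (Suc b)"
      using Suc ch clos c0 by (simp add: m_assoc)
    finally show ?case .
  qed
  have row: "chain (x (Suc a)) N = chain (x a) N \<and> chain (x a) N \<in> carrier K" if "a < N" for a
  proof -
    have "x a 0 = p 0" "x (Suc a) 0 = p 0" "x a N = p 1" "x (Suc a) N = p 1"
      using that N(4) h(4) by (auto simp: x_def)
    moreover have "p 0 \<in> topspace X" "p 1 \<in> topspace X" using pathin_in_topspace[OF pin(1)] by auto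
    moreover have "chain (x a) N \<in> carrier K" "chain (x (Suc a)) N \<in> carrier K"
      using cell[OF that] c_closed by (auto intro!: chain_closed)
    ultimately show ?thesis using inner[OF that order_refl] by (simp add: c_self)
  qed
  have "a \<le> N \<Longrightarrow> chain (x a) N = chain (x 0) N" for a
  proof (induction a)
    case (Suc a)
    then show ?case using row[of a] by simp
  qed simp
  from this[OF order_refl] have "chain (x N) N = chain (x 0) N" .
  moreover have "x 0 = (\<lambda>m. p (real m / real N))" "x N = (\<lambda>m. q (real m / real N))"
    using h N(4) by (auto simp: x_def)
  ultimately have "sample p N = sample q N" by (simp add: sample_def)
  then show ?thesis using Np[OF N(1)] Nq[OF N(2)] by simp
qed

lemma hol_reverse:
  assumes "pathin X p" shows "hol (reverse_path p) = inv (hol p)"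
proof -
  have t: "p 1 \<in> topspace X" using pathin_in_topspace[OF assms] by simp
  have "hol (\<lambda>t. p 1) = inv \<one> \<otimes> \<one>"
    using t by (intro hol_ratio[where u = "\<lambda>_. \<one>" and \<epsilon> = 1]) (auto simp: c_self)
  moreover have "hol (loop_concat (reverse_path p) p) = hol (\<lambda>t. p 1)"
    using assms by (intro hol_homotopic path_homotopic_reverse_left)
  ultimately have "hol (reverse_path p) \<otimes> hol p = \<one>"
    using assms by (simp add: hol_concat)
  then show ?thesis using assms by (simp add: hol_closed inv_equality)
qed

definition monodromy :: "(real \<Rightarrow> 'a) set \<Rightarrow> 'k" where
  "monodromy C = hol (SOME p. p \<in> C)"

lemma monodromy_loop_class:
  assumes "p \<in> loops_at X x" shows "monodromy (loop_class X x p) = hol p"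
proof -
  have "(SOME q. q \<in> loop_class X x p) \<in> loop_class X x p"
    using someI[of "\<lambda>q. q \<in> loop_class X x p" p] self_mem_loop_class[OF assms] by blast
  then show ?thesis
    unfolding monodromy_def using mem_loop_class(2)[OF assms] hol_homotopic by metis
qed

lemma monodromy_hom: "monodromy \<in> hom (fundamental_group X x) K"
proof (rule homI)
  fix C assume "C \<in> carrier (fundamental_group X x)"
  then obtain p where p: "p \<in> loops_at X x" "C = loop_class X x p"
    by (auto simp: fundamental_group_carrier)
  then show "monodromy C \<in> carrier K" by (simp add: monodromy_loop_class hol_closed loops_at_iff)
  fix D assume "D \<in> carrier (fundamental_group X x)"
  then obtain q where q: "q \<in> loops_at X x" "D = loop_class X x q"
    by (auto simp: fundamental_group_carrier)
  have "monodromy (loop_class X x p \<otimes>\<^bsub>fundamental_group X x\<^esub> loop_class X x q) = hol (loop_concat p q)"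
    using p q by (simp add: fundamental_group_mult monodromy_loop_class loops_at_concat)
  also have "\<dots> = hol p \<otimes> hol q" using p q by (intro hol_concat) (auto simp: loops_at_iff)
  finally show "monodromy (C \<otimes>\<^bsub>fundamental_group X x\<^esub> D) = monodromy C \<otimes> monodromy D"
    using p q by (simp add: monodromy_loop_class)
qed

end

section \<open>The surface as a quotient of a strip\<close>

text \<open>Radius and angle, with the angle left unbounded: the period \<open>4 * g\<close> is then
  a translation, and formulas have no seam. Edge \<open>k\<close> of the polygon is the segment from
  \<open>(1, k)\<close> to \<open>(1, k + 1)\<close>.\<close>

definition strip :: "(real \<times> real) set" where
  "strip = {0..1} \<times> UNIV"

definition polar :: "nat \<Rightarrow> real \<times> real \<Rightarrow> complex" where
  "polar g a = of_real (fst a) * polygon_boundary g (snd a)"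

definition glue :: "nat \<Rightarrow> real \<times> real \<Rightarrow> complex set" where
  "glue g a = gluing_relation g `` {polar g a}"

text \<open>The edge \<open>{k..k+1}\<close> is glued to the edge \<open>{mate k..mate k + 1}\<close> with reversed orientation.\<close>

definition mate :: "int \<Rightarrow> int" where
  "mate k = (if k mod 4 < 2 then k + 2 else k - 2)"

text \<open>The three identifications made by \<open>glue\<close>: the centre, the period and the
  edges. The codomain is arbitrary because the notion is applied to sets, as predicates, and to
  partially defined homotopies, as option-valued maps.\<close>

definition glue_invariant :: "nat \<Rightarrow> (real \<times> real \<Rightarrow> 'z) \<Rightarrow> bool" where
  "glue_invariant g \<Phi> \<longleftrightarrow>
     (\<forall>t t'. \<Phi> (0, t) = \<Phi> (0, t')) \<and>
     (\<forall>r\<in>{0..1}. \<forall>t. \<Phi> (r, t + 4 * real g) = \<Phi> (r, t)) \<and>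
     (\<forall>k. \<forall>s\<in>{0..1}. \<Phi> (1, of_int k + s) = \<Phi> (1, of_int (mate k) + 1 - s))"

lemma mate_mate [simp]: "mate (mate k) = k"
proof (cases "k mod 4 < 2")
  case True
  then have "\<not> (k + 2) mod 4 < 2" by presburger
  with True show ?thesis by (simp add: mate_def)
next
  case False
  then have "(k - 2) mod 4 < 2" by presburger
  with False show ?thesis by (simp add: mate_def)
qed

lemma mate_add: "mate (k + 4 * m) = mate k + 4 * m"
  by (simp add: mate_def)

lemma in_strip [simp]: "(r, t) \<in> strip \<longleftrightarrow> 0 \<le> r \<and> r \<le> 1"
  by (simp add: strip_def)

lemma convex_strip: "convex strip"
  unfolding strip_def by (intro convex_Times) auto

lemma norm_polar: "a \<in> strip \<Longrightarrow> norm (polar g a) = fst a"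
  by (auto simp: polar_def polygon_boundary_def norm_mult strip_def)

lemma polygon_boundary_eq_iff:
  assumes "g > 0"
  shows "polygon_boundary g t = polygon_boundary g t' \<longleftrightarrow> (\<exists>n::int. t' = t + 4 * real g * of_int n)"
proof -
  have "polygon_boundary g t = polygon_boundary g t' \<longleftrightarrow>
      (\<exists>n::int. 2 * pi * t' / real (4 * g) = 2 * pi * t / real (4 * g) + 2 * pi * of_int n)"
    using sin_cos_eq_iff[of "2 * pi * t' / real (4 * g)" "2 * pi * t / real (4 * g)"]
    unfolding polygon_boundary_def by (auto simp: complex_eq_iff)
  also have "\<dots> \<longleftrightarrow> (\<exists>n::int. t' = t + 4 * real g * of_int n)"
  proof (rule ex_cong1)
    fix n :: int
    define u where "u = 2 * pi / real (4 * g)"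
    have u: "u \<noteq> 0" "2 * pi * t' / real (4 * g) = u * t'"
      "2 * pi * t / real (4 * g) + 2 * pi * of_int n = u * (t + 4 * real g * of_int n)"
      using assms by (auto simp: u_def distrib_left)
    show "2 * pi * t' / real (4 * g) = 2 * pi * t / real (4 * g) + 2 * pi * of_int n \<longleftrightarrow>
        t' = t + 4 * real g * of_int n" unfolding u(2,3) using u(1) by simp
  qed
  finally show ?thesis .
qed

lemma polar_eqD:
  assumes "g > 0" "polar g (r, t) = polar g (r', t')" "(r, t) \<in> strip" "(r', t') \<in> strip"
  shows "r = r'" "r = 0 \<or> (\<exists>n::int. t' = t + 4 * real g * of_int n)"
proof -
  show r: "r = r'" using norm_polar[OF assms(3), of g] norm_polar[OF assms(4), of g] assms(2) by simp
  show "r = 0 \<or> (\<exists>n::int. t' = t + 4 * real g * of_int n)"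
    using assms(2) r polygon_boundary_eq_iff[OF assms(1)] by (auto simp: polar_def)
qed

lemma polar_onto:
  assumes "g > 0" "z \<in> cball 0 1"
  obtains r t where "(r, t) \<in> strip" "0 \<le> t" "t \<le> 4 * real g" "z = polar g (r, t)"
proof -
  define t where "t = Arg2pi z * (4 * real g) / (2 * pi)"
  have "2 * pi * t / real (4 * g) = Arg2pi z" using assms by (simp add: t_def)
  then have "z = polar g (norm z, t)"
    using Arg2pi[of z] by (simp add: polar_def polygon_boundary_def is_Arg_def cis_conv_exp)
  moreover have "0 \<le> t" "t \<le> 4 * real g"
    using Arg2pi[of z] assms(1) by (auto simp: t_def divide_simps mult_right_mono)
  ultimately show ?thesis using assms(2) by (intro that[of "norm z" t]) auto
qed

lemma polar_in_disc: "a \<in> strip \<Longrightarrow> polar g a \<in> cball 0 1"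
  using norm_polar[of a g] by (auto simp: strip_def)

lemma continuous_on_polar: "continuous_on S (polar g)"
  unfolding polar_def polygon_boundary_def divide_inverse by (intro continuous_intros)

text \<open>The strip is not compact, but one period of it is, and it already covers the Hausdorff
  disc; a continuous map whose restriction to a subspace is a quotient map is itself one.\<close>

lemma quotient_map_polar:
  assumes "g > 0"
  shows "quotient_map (top_of_set strip) (top_of_set (cball 0 1)) (polar g)"
proof -
  let ?C = "{0..1} \<times> {0..4 * real g} :: (real \<times> real) set"
  have C: "?C \<subseteq> strip" by (auto simp: strip_def)
  have pc: "continuous_map (top_of_set S) (top_of_set (cball 0 1)) (polar g)" if "S \<subseteq> strip" for S
    using that polar_in_disc continuous_on_polar
    by (auto simp: continuous_map_in_subtopology Pi_iff subset_iff simp del: mem_cball)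
  have "compact ?C" by (intro compact_Times) auto
  then have "compact_space (top_of_set ?C)" by (simp add: compact_space_subtopology)
  moreover have "polar g ` topspace (top_of_set ?C) = topspace (top_of_set (cball 0 1))"
  proof -
    have "z \<in> polar g ` ?C" if z: "z \<in> cball 0 1" for z
    proof -
      obtain r t where "(r, t) \<in> strip" "0 \<le> t" "t \<le> 4 * real g" "z = polar g (r, t)"
        using polar_onto[OF assms z] .
      then show ?thesis by auto
    qed
    moreover have "polar g a \<in> cball 0 1" if "a \<in> ?C" for a
      using polar_in_disc[of a g] C that by blast
    ultimately show ?thesis unfolding topspace_euclidean_subtopology by blast
  qed
  moreover have "Hausdorff_space (top_of_set (cball (0::complex) 1))"
    by (simp add: Hausdorff_space_subtopology)
  ultimately have "quotient_map (top_of_set ?C) (top_of_set (cball 0 1)) (polar g \<circ> id)"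
    using pc[OF C] by (simp add: continuous_imp_quotient_map)
  then show ?thesis
  proof (rule quotient_map_from_composition[rotated 2])
    show "continuous_map (top_of_set ?C) (top_of_set strip) id"
      using C by (auto simp: continuous_map_in_subtopology)
  qed (rule pc, simp)
qed

lemma quotient_map_glue:
  assumes "g > 0" shows "quotient_map (top_of_set strip) (genus_surface g) (glue g)"
proof -
  have "glue g = (\<lambda>z. gluing_relation g `` {z}) \<circ> polar g" by (auto simp: glue_def)
  then show ?thesis
    using quotient_map_compose[OF quotient_map_polar[OF assms] quotient_map_quotient_topology]
    unfolding genus_surface_def by simp
qed

lemma glue_eq_if_related:
  assumes "(polar g a, polar g b) \<in> edge_pairing g \<union> (edge_pairing g)\<inverse>" "a \<in> strip" "b \<in> strip"
  shows "glue g a = glue g b"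
proof -
  have "(polar g a, polar g b) \<in> gluing_relation g"
    unfolding gluing_relation_def using assms polar_in_disc by blast
  then show ?thesis
    unfolding glue_def using equiv_gluing_relation by (metis equiv_class_eq_iff)
qed

lemma glue_period:
  assumes "g > 0" shows "glue g (r, t + 4 * real g * of_int n) = glue g (r, t)"
proof -
  have "polygon_boundary g t = polygon_boundary g (t + 4 * real g * of_int n)"
    unfolding polygon_boundary_eq_iff[OF assms] by blast
  then show ?thesis by (simp add: glue_def polar_def)
qed

lemma glue_centre: "glue g (0, t) = glue g (0, t')"
  by (simp add: glue_def polar_def)

lemma glue_edge:
  assumes "g > 0" "s \<in> {0..1}"
  shows "glue g (1, of_int k + s) = glue g (1, of_int (mate k) + 1 - s)"
proof -
  define m where "m = k mod (4 * int g)"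
  define n where "n = k div (4 * int g)"
  have k: "k = m + 4 * (int g * n)"
    using mod_mult_div_eq[of k "4 * int g"] unfolding m_def n_def by linarith
  have m: "0 \<le> m" "m < 4 * int g" using assms by (auto simp: m_def)
  define j where "j = nat (m div 4)"
  have j: "j < g" "int j = m div 4" using m by (auto simp: j_def)
  have E: "(polygon_boundary g (4 * real j + u), polygon_boundary g (4 * real j + 3 - u)) \<in> edge_pairing g"
    "(polygon_boundary g (4 * real j + 1 + u), polygon_boundary g (4 * real j + 4 - u)) \<in> edge_pairing g"
    if "u \<in> {0..1}" for u
    unfolding edge_pairing_def using j(1) that by blast+
  have s': "1 - s \<in> {0..1}" using assms(2) by auto
  have "glue g (1, of_int m + s) = glue g (1, of_int (mate m) + 1 - s)"
  proof (rule glue_eq_if_related)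
    have "m = 4 * int j + m mod 4" using j(2) by simp
    moreover have "m mod 4 \<in> {0, 1, 2, 3}" by auto
    ultimately consider "m = 4 * int j" "mate m = 4 * int j + 2" | "m = 4 * int j + 1" "mate m = 4 * int j + 3"
      | "m = 4 * int j + 2" "mate m = 4 * int j" | "m = 4 * int j + 3" "mate m = 4 * int j + 1"
      unfolding mate_def by (smt (verit) insert_iff singletonD)
    then show "(polar g (1, of_int m + s), polar g (1, of_int (mate m) + 1 - s)) \<in> edge_pairing g \<union> (edge_pairing g)\<inverse>"
    proof cases
      case 1 then show ?thesis using E(1)[OF assms(2)] by (simp add: polar_def algebra_simps)
    next
      case 2 then show ?thesis using E(2)[OF assms(2)] by (simp add: polar_def algebra_simps)
    next
      \<comment> \<open>Edges congruent to 2 or 3 mod 4 are the second members of their pairs, so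
        the pairing is read backwards at the parameter \<open>1 - s\<close>.\<close>
      case 3 then show ?thesis using E(1)[OF s'] by (simp add: polar_def algebra_simps)
    next
      case 4 then show ?thesis using E(2)[OF s'] by (simp add: polar_def algebra_simps)
    qed
  qed auto
  moreover have "glue g (1, of_int k + s) = glue g (1, of_int m + s)"
    using glue_period[OF assms(1), of 1 "of_int m + s" n] by (simp add: k algebra_simps)
  moreover have "glue g (1, of_int (mate k) + 1 - s) = glue g (1, of_int (mate m) + 1 - s)"
    using glue_period[OF assms(1), of 1 "of_int (mate m) + 1 - s" n] 
    unfolding k mate_add by (simp add: algebra_simps)
  ultimately show ?thesis by simp
qed

section \<open>Descent of functions, open sets and homotopies from the strip to the surface\<close>

lemma glue_invariant_period:
  assumes "glue_invariant g \<Phi>" "r \<in> {0..1}"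
  shows "\<Phi> (r, t + 4 * real g * of_int n) = \<Phi> (r, t)"
proof -
  have *: "\<Phi> (r, t + 4 * real g * real m) = \<Phi> (r, t)" for m t
  proof (induction m)
    case (Suc m)
    have "\<Phi> (r, (t + 4 * real g * real m) + 4 * real g) = \<Phi> (r, t + 4 * real g * real m)"
      using assms unfolding glue_invariant_def by blast
    then show ?case using Suc by (simp add: algebra_simps)
  qed simp
  show ?thesis
  proof (cases "n \<ge> 0")
    case True
    then show ?thesis using *[of t "nat n"] by simp
  next
    case False
    then show ?thesis using *[of "t + 4 * real g * of_int n" "nat (- n)"] by simp
  qed
qed

text \<open>An invariant function factors through \<open>polar\<close> as \<open>\<Psi>\<close>, and
  \<open>\<Psi>\<close> respects the edge pairing, hence the equivalence relation generated by it,
  by induction on the closure.\<close>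

lemma glue_invariantD:
  assumes g: "g > 0" and inv: "glue_invariant g \<Phi>" and ab: "a \<in> strip" "b \<in> strip" and eq: "glue g a = glue g b"
  shows "\<Phi> a = \<Phi> b"
proof -
  define \<Psi> where "\<Psi> = (\<lambda>z. \<Phi> (SOME a. a \<in> strip \<and> polar g a = z))"
  have \<Psi>: "\<Psi> (polar g a) = \<Phi> a" if a: "a \<in> strip" for a
  proof -
    obtain b where b: "b \<in> strip" "polar g b = polar g a" "\<Psi> (polar g a) = \<Phi> b"
      unfolding \<Psi>_def using someI[of "\<lambda>b. b \<in> strip \<and> polar g b = polar g a" a] a by metis
    obtain r t r' t' where rt: "b = (r, t)" "a = (r', t')" by fastforce
    have "r = r'" "r = 0 \<or> (\<exists>n::int. t' = t + 4 * real g * of_int n)"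
      using polar_eqD[OF g, of r t r' t'] a b rt by auto
    moreover have "r \<in> {0..1}" using b rt by simp
    ultimately have "\<Phi> b = \<Phi> a"
      using inv glue_invariant_period[OF inv, of r t] unfolding rt glue_invariant_def by metis
    then show ?thesis using b by simp
  qed
  have E: "\<Psi> z = \<Psi> w" if zw: "(z, w) \<in> edge_pairing g" for z w
  proof -
    obtain j s where js: "s \<in> {0..1}" "(z = polygon_boundary g (4 * real j + s) \<and> w = polygon_boundary g (4 * real j + 3 - s))
        \<or> (z = polygon_boundary g (4 * real j + 1 + s) \<and> w = polygon_boundary g (4 * real j + 4 - s))"
      using zw unfolding edge_pairing_def by blast
    have p: "polygon_boundary g t = polar g (1, t)" for t by (simp add: polar_def)
    have q: "\<Psi> (polygon_boundary g t) = \<Phi> (1, t)" for t unfolding p by (rule \<Psi>) simp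
    have glue: "\<Phi> (1, of_int k + s) = \<Phi> (1, of_int (mate k) + 1 - s)" for k
      using inv js(1) unfolding glue_invariant_def by blast
    have "mate (4 * int j) = 4 * int j + 2" "mate (4 * int j + 1) = 4 * int j + 3"
      by (simp_all add: mate_def)
    then show ?thesis
      using js(2) glue[of "4 * int j"] glue[of "4 * int j + 1"] by (auto simp: q add.commute)
  qed
  have "(polar g a, polar g b) \<in> gluing_relation g"
    using eq_equiv_class[OF eq[unfolded glue_def] equiv_gluing_relation] polar_in_disc ab by blast
  then have "(polar g a, polar g b) \<in> (edge_pairing g \<union> (edge_pairing g)\<inverse>)\<^sup>*"
    by (simp add: gluing_relation_def)
  then have "\<Psi> (polar g a) = \<Psi> (polar g b)"
    by (induction rule: rtrancl_induct) (use E in auto)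
  then show ?thesis using \<Psi> ab by simp
qed

lemma glue_onto:
  assumes "g > 0" "x \<in> topspace (genus_surface g)"
  obtains a where "a \<in> strip" "glue g a = x"
proof -
  have "x \<in> glue g ` strip"
    using quotient_imp_surjective_map[OF quotient_map_glue[OF assms(1)]] assms(2) by simp
  then show ?thesis using that by blast
qed

lemma glue_in_topspace:
  assumes "g > 0" "a \<in> strip" shows "glue g a \<in> topspace (genus_surface g)"
proof -
  have "glue g ` strip = topspace (genus_surface g)"
    using quotient_imp_surjective_map[OF quotient_map_glue[OF assms(1)]] by simp
  then show ?thesis using assms(2) by blast
qed

lemma continuous_map_glue: "g > 0 \<Longrightarrow> continuous_map (top_of_set strip) (genus_surface g) (glue g)"
  by (rule quotient_imp_continuous_map[OF quotient_map_glue])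

text \<open>An invariant set is the full preimage of its image, so its openness passes through the
  quotient map.\<close>

lemma glue_saturated_open:
  assumes g: "g > 0" and V: "openin (top_of_set strip) V" and inv: "glue_invariant g (\<lambda>a. a \<in> V)"
  shows "openin (genus_surface g) (glue g ` V)" "{a \<in> strip. glue g a \<in> glue g ` V} = V"
proof -
  have sub: "V \<subseteq> strip" using openin_subset[OF V] by simp
  show *: "{a \<in> strip. glue g a \<in> glue g ` V} = V"
  proof
    show "{a \<in> strip. glue g a \<in> glue g ` V} \<subseteq> V"
      using glue_invariantD[OF g inv] sub by blast
  qed (use sub in auto)
  have "glue g ` V \<subseteq> topspace (genus_surface g)" using sub glue_in_topspace[OF g] by blast
  then show "openin (genus_surface g) (glue g ` V)"
    using quotient_map_glue[OF g] V * unfolding quotient_map_def by auto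
qed

text \<open>Since the unit interval is locally compact Hausdorff, the product of the quotient map
  with its identity is again a quotient map, and the homotopy descends. The option type in
  \<open>Hinv\<close> turns a homotopy on \<open>V\<close> into a function on the whole
  strip.\<close>

lemma glue_homotopy:
  assumes g: "g > 0" and V: "openin (top_of_set strip) V" and inv: "glue_invariant g (\<lambda>a. a \<in> V)"
    and H: "continuous_on (V \<times> {0..1::real}) H" "H \<in> V \<times> {0..1} \<rightarrow> strip"
    and Hinv: "\<And>\<tau>. \<tau> \<in> {0..1} \<Longrightarrow> glue_invariant g (\<lambda>a. if a \<in> V then Some (glue g (H (a, \<tau>))) else None)"
  obtains h where
    "continuous_map (prod_topology (subtopology (genus_surface g) (glue g ` V)) (top_of_set {0..1::real})) (genus_surface g) h"
    "\<And>a \<tau>. a \<in> V \<Longrightarrow> \<tau> \<in> {0..1} \<Longrightarrow> h (glue g a, \<tau>) = glue g (H (a, \<tau>))"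
proof -
  let ?X = "genus_surface g"
  have sub: "V \<subseteq> strip" using openin_subset[OF V] by simp
  have "quotient_map (subtopology (top_of_set strip) V) (subtopology ?X (glue g ` V)) (glue g)"
    using glue_saturated_open[OF g V inv] quotient_map_glue[OF g]
    by (intro quotient_map_restriction) auto
  then have "quotient_map (top_of_set V) (subtopology ?X (glue g ` V)) (glue g)"
    using sub by (simp add: subtopology_subtopology inf_absorb2)
  moreover have "locally_compact_space (top_of_set {0..1::real})" "Hausdorff_space (top_of_set {0..1::real})"
    by (auto intro!: compact_imp_locally_compact_space simp: compact_space_subtopology Hausdorff_space_subtopology)
  ultimately have q: "quotient_map (prod_topology (top_of_set V) (top_of_set {0..1::real}))
      (prod_topology (subtopology ?X (glue g ` V)) (top_of_set {0..1})) (\<lambda>(x, y). (glue g x, y))"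
    by (intro quotient_map_prod_left) auto
  have "continuous_map (top_of_set (V \<times> {0..1})) (top_of_set strip) H"
    using H by (simp add: continuous_map_in_subtopology image_subset_iff_funcset)
  then have c: "continuous_map (prod_topology (top_of_set V) (top_of_set {0..1::real})) ?X (glue g \<circ> H)"
    using continuous_map_compose[OF _ continuous_map_glue[OF g]] 
    by (simp only: prod_topology_subtopology_eu)
  have "(glue g \<circ> H) x = (glue g \<circ> H) y"
    if xy: "x \<in> topspace (prod_topology (top_of_set V) (top_of_set {0..1::real}))"
      "y \<in> topspace (prod_topology (top_of_set V) (top_of_set {0..1::real}))"
      "(\<lambda>(x, y). (glue g x, y)) x = (\<lambda>(x, y). (glue g x, y)) y" for x y
  proof -
    obtain a b \<tau> where ab: "x = (a, \<tau>)" "y = (b, \<tau>)" "a \<in> V" "b \<in> V" "\<tau> \<in> {0..1}" "glue g a = glue g b"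
      using xy by auto
    then show ?thesis
      using glue_invariantD[OF g Hinv[OF ab(5)], of a b] sub by auto
  qed
  then obtain h where "continuous_map (prod_topology (subtopology ?X (glue g ` V)) (top_of_set {0..1})) ?X h"
    "\<And>x. x \<in> topspace (prod_topology (top_of_set V) (top_of_set {0..1::real})) \<Longrightarrow>
        h ((\<lambda>(x, y). (glue g x, y)) x) = (glue g \<circ> H) x"
    using quotient_map_lift_exists[OF q c] by metis
  then show ?thesis by (intro that[of h]) auto
qed

lemma (in group) ratio_swap:
  assumes "a \<in> carrier G" "b \<in> carrier G" "c \<in> carrier G" "d \<in> carrier G"
    and "inv a \<otimes> b = inv c \<otimes> d"
  shows "a \<otimes> inv c = b \<otimes> inv d"
proof -
  have "b = a \<otimes> (inv c \<otimes> d)" using assms by (metis inv_closed inv_solve_left m_closed)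
  then have "b \<otimes> inv d = a \<otimes> inv c \<otimes> (d \<otimes> inv d)" using assms by (simp add: m_assoc)
  then show ?thesis using assms by simp
qed

lemma (in path_groupoid) \<kappa>_eq_on:
  assumes "pathin X p" "\<And>t. t \<in> {0..1} \<Longrightarrow> p t = q t" shows "\<kappa> p = \<kappa> q"
proof (rule \<kappa>_cong)
  show "path_homotopic X p q" unfolding path_homotopic_def
    by (rule homotopic_with_equal) (use assms in \<open>auto simp: pathin_def\<close>)
qed

lemma (in path_groupoid) \<kappa>_spoke:
  assumes "y \<in> topspace X" shows "\<kappa> (\<eta> y) = \<one>\<^bsub>\<pi>\<^esub>"
proof -
  have y: "pathin X (\<eta> y)" "\<eta> y 0 = x0" "\<eta> y 1 = y" using spoke assms by auto
  have b: "pathin X (\<eta> x0)" "\<eta> x0 0 = x0" "\<eta> x0 1 = x0" using spoke base_in by auto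
  have "path_homotopic X (loop_concat (loop_concat (\<eta> x0) (\<eta> y)) (reverse_path (\<eta> y)))
     (loop_concat (\<eta> x0) (loop_concat (\<eta> y) (reverse_path (\<eta> y))))"
    using y b by (intro path_homotopic_assoc) auto
  also have "path_homotopic X (loop_concat (\<eta> x0) (loop_concat (\<eta> y) (reverse_path (\<eta> y))))
      (loop_concat (\<lambda>t. x0) (\<lambda>t. \<eta> y 0))"
    using y b spoke_base by (intro path_homotopic_concat path_homotopic_reverse_right) auto
  also have "path_homotopic X (loop_concat (\<lambda>t. x0) (\<lambda>t. \<eta> y 0)) (\<lambda>t. x0)"
    unfolding y(2) using base_in by (intro path_homotopic_const_left) auto
  finally have h: "path_homotopic X (loop_concat (loop_concat (\<eta> x0) (\<eta> y)) (reverse_path (\<eta> y))) (\<lambda>t. x0)" .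
  have "loop_concat (loop_concat (\<eta> x0) (\<eta> y)) (reverse_path (\<eta> y)) \<in> loops_at X x0"
    using conjugate_loop[OF y(1)] y by simp
  moreover have "(\<lambda>t. x0) \<in> loops_at X x0" using base_in by (simp add: loops_at_iff)
  ultimately show ?thesis
    using h unfolding \<kappa>_def y fundamental_group_one by (simp add: loop_class_eq_iff)
qed

section \<open>Radii, spokes and the loops dual to the edges\<close>

locale surface =
  fixes g :: nat and x0 :: "complex set"
  assumes g_pos: "g > 0" and x0_in: "x0 \<in> topspace (genus_surface g)"
begin

definition rep :: "complex set \<Rightarrow> real \<times> real" where
  "rep y = (SOME a. a \<in> strip \<and> glue g a = y)"

definition rad :: "real \<times> real \<Rightarrow> real \<Rightarrow> complex set" where
  "rad a = (\<lambda>s. glue g (s * fst a, snd a))"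

text \<open>Along a radius to the centre of the polygon and out again along the radius of the chosen
  representative of \<open>y\<close>. For \<open>y = x0\<close> the path retraces itself, as
  \<open>spoke_base\<close> requires.\<close>

definition spoke_path :: "complex set \<Rightarrow> real \<Rightarrow> complex set" where
  "spoke_path y = loop_concat (reverse_path (rad (rep x0))) (rad (rep y))"

lemma rep:
  assumes "y \<in> topspace (genus_surface g)" shows "rep y \<in> strip" "glue g (rep y) = y"
proof -
  obtain a where "a \<in> strip" "glue g a = y" using glue_onto[OF g_pos assms] .
  then have "rep y \<in> strip \<and> glue g (rep y) = y"
    unfolding rep_def by (intro someI[of "\<lambda>a. a \<in> strip \<and> glue g a = y" a]) simp
  then show "rep y \<in> strip" "glue g (rep y) = y" by auto
qed

lemma pathin_strip:
  assumes "continuous_on {0..1} f" "f \<in> {0..1} \<rightarrow> strip"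
  shows "pathin (genus_surface g) (\<lambda>s. glue g (f s))"
  using pathin_through[OF continuous_map_glue[OF g_pos] assms] .

lemma pathin_rad:
  assumes "a \<in> strip" shows "pathin (genus_surface g) (rad a)"
proof -
  have "(\<lambda>s. (s * fst a, snd a)) \<in> {0..1} \<rightarrow> strip"
    using assms by (auto simp: strip_def intro: mult_le_one)
  then show ?thesis unfolding rad_def by (intro pathin_strip) (auto intro!: continuous_intros)
qed

lemma rad_endpoints: "rad a 0 = glue g (0, 0)" "rad a 1 = glue g a"
  using glue_centre[of g "snd a" 0] by (auto simp: rad_def)

sublocale path_groupoid "genus_surface g" x0 spoke_path
proof
  show "x0 \<in> topspace (genus_surface g)" by (rule x0_in)
  fix y assume y: "y \<in> topspace (genus_surface g)"
  show "pathin (genus_surface g) (spoke_path y)"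
    unfolding spoke_path_def using rep(1)[OF x0_in] rep(1)[OF y]
    by (intro pathin_concat pathin_reverse pathin_rad) (auto simp: rad_endpoints)
  show "spoke_path y 0 = x0" "spoke_path y 1 = y"
    using rep(2)[OF x0_in] rep(2)[OF y] by (auto simp: spoke_path_def rad_endpoints)
next
  show "path_homotopic (genus_surface g) (spoke_path x0) (\<lambda>t. x0)"
    using path_homotopic_reverse_left[OF pathin_rad[OF rep(1)[OF x0_in]]] rep(2)[OF x0_in]
    by (simp add: spoke_path_def rad_endpoints)
qed

abbreviation S where "S \<equiv> genus_surface g"

text \<open>Compares the radius to \<open>a\<close> with the radius to the chosen representative of
  the same point of the surface. It carries information on the boundary, where a point has polar
  representatives that differ by more than the period.\<close>

definition v :: "real \<times> real \<Rightarrow> (real \<Rightarrow> complex set) set" where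
  "v a = \<kappa> (rad a)"

lemma v_closed [simp]: "a \<in> strip \<Longrightarrow> v a \<in> carrier \<pi>"
  unfolding v_def by (intro \<kappa>_closed pathin_rad)

lemma v_centre [simp]: "v (0, t) = \<one>\<^bsub>\<pi>\<^esub>"
  unfolding v_def rad_def using \<kappa>_const glue_in_topspace[OF g_pos, of "(0, t)"] by simp

lemma v_period: "v (r, t + 4 * real g * of_int n) = v (r, t)"
  unfolding v_def rad_def using glue_period[OF g_pos] by simp

lemma v_period_corner: "v (1, of_int (k + 4 * int g * n)) = v (1, of_int k)"
  using v_period[of 1 "of_int k" n] by simp

text \<open>By convexity a path in the strip can be deformed into a detour: down to radius 0, across
  to the new angle, and up again. The middle part is collapsed to the centre by
  \<open>glue\<close>.\<close>

lemma \<kappa>_strip: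
  assumes f: "continuous_on {0..1} f" "f \<in> {0..1} \<rightarrow> strip"
  shows "\<kappa> (\<lambda>s. glue g (f s)) = inv\<^bsub>\<pi>\<^esub> v (f 0) \<otimes>\<^bsub>\<pi>\<^esub> v (f 1)"
proof -
  obtain r t where a: "f 0 = (r, t)" by fastforce
  obtain r' t' where b: "f 1 = (r', t')" by fastforce
  have "f 0 \<in> strip" "f 1 \<in> strip" using f(2) by auto
  then have ab: "(r, t) \<in> strip" "(r', t') \<in> strip" by (simp_all add: a b)
  let ?G = "\<lambda>s::real. if s \<le> 1/2 then ((1 - 2 * s) * r, t)
      else if s \<le> 3/4 then (0, t + (4 * s - 2) * (t' - t)) else ((4 * s - 3) * r', t')"
  have "path_homotopic S (\<lambda>s. glue g (f s)) (\<lambda>s. glue g (?G s))"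
  proof (rule path_homotopic_through_convex[OF convex_strip continuous_map_glue[OF g_pos] f])
    show "continuous_on {0..1} ?G"
      by (intro continuous_on_cases_1 continuous_intros) auto
    have "x * y \<le> 1" if "x \<le> 1" "0 \<le> y" "y \<le> 1" for x y :: real
      using mult_mono[of x 1 y 1] that by simp
    then show "?G \<in> {0..1} \<rightarrow> strip"
      using ab by auto
    show "f 0 = ?G 0" "f 1 = ?G 1" by (auto simp: a b)
  qed
  moreover have "(\<lambda>s. glue g (?G s)) =
      loop_concat (reverse_path (rad (r, t))) (loop_concat (\<lambda>s. glue g (0, 0)) (rad (r', t')))"
  proof
    fix s :: real
    consider "s \<le> 1/2" | "1/2 < s" "s \<le> 3/4" | "3/4 < s" by linarith
    then show "glue g (?G s) = loop_concat (reverse_path (rad (r, t)))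
        (loop_concat (\<lambda>s. glue g (0, 0)) (rad (r', t'))) s"
    proof cases
      case 2
      then show ?thesis using glue_centre[of g "t + (4 * s - 2) * (t' - t)" 0] by (simp add: loop_concat_def)
    next
      case 3
      have "2 * (2 * s - 1) - 1 = 4 * s - 3" by simp
      then show ?thesis using 3 by (simp add: loop_concat_def rad_def)
    qed (simp add: loop_concat_def reverse_path_def rad_def)
  qed
  ultimately have "\<kappa> (\<lambda>s. glue g (f s)) =
      \<kappa> (loop_concat (reverse_path (rad (r, t))) (loop_concat (\<lambda>s. glue g (0, 0)) (rad (r', t'))))"
    using \<kappa>_cong by simp
  also have "\<dots> = inv\<^bsub>\<pi>\<^esub> v (r, t) \<otimes>\<^bsub>\<pi>\<^esub> (\<one>\<^bsub>\<pi>\<^esub> \<otimes>\<^bsub>\<pi>\<^esub> v (r', t'))"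
    using pathin_rad[OF ab(1)] pathin_rad[OF ab(2)] glue_in_topspace[OF g_pos, of "(0, 0)"]
    by (simp add: \<kappa>_concat pathin_concat rad_endpoints \<kappa>_reverse \<kappa>_const v_def)
  finally show ?thesis using ab by (simp add: a b)
qed

text \<open>Triviality of \<open>\<kappa>\<close> on spokes shows that the value does not depend on
  \<open>y\<close>; at the centre of the polygon it is trivial.\<close>

lemma v_rep:
  assumes y: "y \<in> topspace S" shows "v (rep y) = \<one>\<^bsub>\<pi>\<^esub>"
proof -
  have eq: "v (rep y) = v (rep x0)" if y: "y \<in> topspace S" for y
  proof -
    have r: "rep x0 \<in> strip" "rep y \<in> strip" using rep y x0_in by auto
    have "\<one>\<^bsub>\<pi>\<^esub> = \<kappa> (spoke_path y)" using \<kappa>_spoke[OF y] by simp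
    also have "\<dots> = \<kappa> (loop_concat (reverse_path (rad (rep x0))) (rad (rep y)))"
      by (subst spoke_path_def[of y]) (rule refl)
    also have "\<dots> = inv\<^bsub>\<pi>\<^esub> v (rep x0) \<otimes>\<^bsub>\<pi>\<^esub> v (rep y)"
      using pathin_rad[OF r(1)] pathin_rad[OF r(2)]
      by (simp add: \<kappa>_concat rad_endpoints \<kappa>_reverse v_def)
    finally show ?thesis using r by (metis \<pi>.inv_closed \<pi>.inv_equality \<pi>.inv_inv v_closed)
  qed
  let ?c = "glue g (0, 0)"
  have c: "?c \<in> topspace S" using glue_in_topspace[OF g_pos] by simp
  have "glue_invariant g (\<lambda>a. fst a = 0)" by (simp add: glue_invariant_def)
  then have "fst (rep ?c) = 0"
    using glue_invariantD[OF g_pos, of "\<lambda>a. fst a = 0" "rep ?c" "(0, 0)"] rep[OF c] by auto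
  then have "v (rep ?c) = \<one>\<^bsub>\<pi>\<^esub>" using v_centre by (metis prod.collapse)
  then show ?thesis using eq[OF c] eq[OF y] by simp
qed

text \<open>The loop that leaves the centre through edge \<open>k\<close> and comes back through its
  mate, with the crossing point pushed to the corner at which edge \<open>k\<close> starts.\<close>

definition gen :: "int \<Rightarrow> (real \<Rightarrow> complex set) set" where
  "gen k = v (1, of_int k) \<otimes>\<^bsub>\<pi>\<^esub> inv\<^bsub>\<pi>\<^esub> v (1, of_int (mate k) + 1)"

lemma gen_closed [simp]: "gen k \<in> carrier \<pi>"
  by (simp add: gen_def)

text \<open>The crossing point may slide along the edge: the segments from parameter 0 to
  \<open>s\<close> on the two glued edges are the same path on the surface, so their values under
  \<open>\<kappa>\<close> agree.\<close>

lemma gen_eq: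
  assumes s: "s \<in> {0..1}"
  shows "gen k = v (1, of_int k + s) \<otimes>\<^bsub>\<pi>\<^esub> inv\<^bsub>\<pi>\<^esub> v (1, of_int (mate k) + 1 - s)"
proof -
  let ?f = "\<lambda>u::real. (1::real, of_int k + u * s)"
  let ?f' = "\<lambda>u::real. (1::real, of_int (mate k) + 1 - u * s)"
  have c: "continuous_on {0..1} ?f" "continuous_on {0..1} ?f'" by (auto intro!: continuous_intros)
  have "\<kappa> (\<lambda>u. glue g (?f u)) = \<kappa> (\<lambda>u. glue g (?f' u))"
  proof (rule \<kappa>_eq_on)
    show "pathin S (\<lambda>u. glue g (?f u))" using c by (intro pathin_strip) auto
    fix u :: real assume "u \<in> {0..1}"
    then have "u * s \<in> {0..1}" using s by (auto intro: mult_le_one)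
    then show "glue g (?f u) = glue g (?f' u)" using glue_edge[OF g_pos] by simp
  qed
  then have "inv\<^bsub>\<pi>\<^esub> v (?f 0) \<otimes>\<^bsub>\<pi>\<^esub> v (?f 1) = inv\<^bsub>\<pi>\<^esub> v (?f' 0) \<otimes>\<^bsub>\<pi>\<^esub> v (?f' 1)"
    using c by (simp add: \<kappa>_strip Pi_iff)
  then show ?thesis
    unfolding gen_def by (intro \<pi>.ratio_swap) (auto simp: algebra_simps)
qed

lemma gen_alt: "gen k = v (1, of_int k + 1) \<otimes>\<^bsub>\<pi>\<^esub> inv\<^bsub>\<pi>\<^esub> v (1, of_int (mate k))"
  using gen_eq[of 1 k] by simp

lemma gen_mate: "gen (mate k) = inv\<^bsub>\<pi>\<^esub> gen k"
proof -
  have "gen (mate k) = v (1, of_int (mate k)) \<otimes>\<^bsub>\<pi>\<^esub> inv\<^bsub>\<pi>\<^esub> v (1, of_int k + 1)"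
    by (simp add: gen_def)
  also have "\<dots> = inv\<^bsub>\<pi>\<^esub> (v (1, of_int k + 1) \<otimes>\<^bsub>\<pi>\<^esub> inv\<^bsub>\<pi>\<^esub> v (1, of_int (mate k)))"
    by (simp add: \<pi>.inv_mult_group)
  finally show ?thesis by (simp add: gen_alt)
qed

lemma gen_period: "gen (k + 4 * int g * n) = gen k"
proof -
  have "mate (k + 4 * int g * n) + 1 = (mate k + 1) + 4 * int g * n"
    using mate_add[of k "int g * n"] by (simp add: algebra_simps)
  then show ?thesis
    unfolding gen_def using v_period_corner[of k n] v_period_corner[of "mate k + 1" n]
    by (metis of_int_1 of_int_add)
qed

lemma mate_4 [simp]: "mate (4 * j) = 4 * j + 2" "mate (4 * j + 1) = 4 * j + 3"
  "mate (4 * j + 2) = 4 * j" "mate (4 * j + 3) = 4 * j + 1"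
  by (simp_all add: mate_def)

text \<open>Gluing edge \<open>k\<close> identifies corner \<open>k\<close> with corner
  \<open>mate k + 1\<close>. Within a block this links \<open>4 * j\<close>,
  \<open>4 * j + 3\<close>, \<open>4 * j + 2\<close>, \<open>4 * j + 1\<close>,
  \<open>4 * j + 4\<close> in this order, so the polygon has a single vertex class. The relation is
  arbitrary because membership in a subgroup is propagated in the same way as equality of
  points.\<close>

lemma corner_induct:
  assumes refl: "\<And>i. R i i" and sym: "\<And>i j. R i j \<Longrightarrow> R j i" and trans: "\<And>i j l. R i j \<Longrightarrow> R j l \<Longrightarrow> R i l"
    and edge: "\<And>k. R k (mate k + 1)"
  shows "R i j"
proof -
  have e: "R (4 * j) (4 * j + 3)" "R (4 * j + 1) (4 * j + 4)" "R (4 * j + 2) (4 * j + 1)"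
    "R (4 * j + 3) (4 * j + 2)" for j
    using edge[of "4 * j"] edge[of "4 * j + 1"] edge[of "4 * j + 2"] edge[of "4 * j + 3"]
    unfolding mate_4 by (simp_all add: add.commute)
  have block: "R (4 * j) (4 * j + i)" if "i \<in> {0, 1, 2, 3, 4}" for i j
  proof -
    have 2: "R (4 * j) (4 * j + 2)" using trans[OF e(1) e(4)] .
    have 1: "R (4 * j) (4 * j + 1)" using trans[OF 2 e(3)] .
    have "R (4 * j) (4 * j + 4)" using trans[OF 1 e(2)] .
    with 1 2 e(1)[of j] refl[of "4 * j"] that show ?thesis by (elim insertE) simp_all
  qed
  have "R 0 (4 * j)" for j
  proof (induction j rule: int_induct[where k = 0])
    case (step1 i)
    then show ?case using trans[OF _ block[of 4 i]] by (simp add: algebra_simps)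
  next
    case (step2 i)
    then show ?case using trans[OF _ sym[OF block[of 4 "i - 1"]]] by (simp add: algebra_simps)
  qed (simp add: refl)
  then have "R 0 i" for i
  proof -
    have "i mod 4 \<in> {0, 1, 2, 3, 4}" by auto
    then show ?thesis
      using trans[OF \<open>\<And>j. R 0 (4 * j)\<close>[of "i div 4"] block[of "i mod 4" "i div 4"]] by simp
  qed
  then show ?thesis using trans[OF sym] by blast
qed

lemma glue_corner: "glue g (1, of_int i) = glue g (1, of_int j)"
proof (rule corner_induct[where R = "\<lambda>i j. glue g (1, of_int i) = glue g (1, of_int j)"])
  show "glue g (1, real_of_int k) = glue g (1, real_of_int (mate k + 1))" for k
    using glue_edge[OF g_pos, of 0 k] by simp
qed auto

end

section \<open>Generators of the fundamental group of the surface\<close>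

lemma continuous_on_locally_constant:
  fixes f :: "real \<Rightarrow> real" and A :: "'i \<Rightarrow> real set"
  assumes "\<And>i. i \<in> I \<Longrightarrow> open (A i)" "\<And>i t. i \<in> I \<Longrightarrow> t \<in> A i \<Longrightarrow> f t = c i"
  shows "continuous_on (\<Union>i\<in>I. A i) f"
proof (rule continuous_on_open_UN)
  fix i assume "i \<in> I"
  then show "continuous_on (A i) f"
    using assms(2) continuous_on_cong[of "A i" "A i" f "\<lambda>_. c i"] by simp
qed (use assms in auto)

context surface
begin

text \<open>The homotopy moves the representative of a point along a path in the strip. This path
  starts at a point where \<open>v\<close> is trivial, so \<open>\<kappa>_strip\<close> leaves only
  \<open>v\<close> of its end point.\<close>

lemma \<kappa>_contract:
  assumes V: "openin (top_of_set strip) V" and inv: "glue_invariant g (\<lambda>a. a \<in> V)"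
    and H: "continuous_on (V \<times> {0..1::real}) H" "H \<in> V \<times> {0..1} \<rightarrow> strip"
    and Hinv: "\<And>\<tau>. \<tau> \<in> {0..1} \<Longrightarrow> glue_invariant g (\<lambda>a. if a \<in> V then Some (glue g (H (a, \<tau>))) else None)"
    and H0: "\<And>a. a \<in> V \<Longrightarrow> H (a, 0) = a" and H1: "\<And>a. a \<in> V \<Longrightarrow> glue g (H (a, 1)) = w"
    and p: "pathin S p" "p \<in> {0..1} \<rightarrow> glue g ` V"
  shows "\<kappa> p = v (H (rep (p 0), 1)) \<otimes>\<^bsub>\<pi>\<^esub> inv\<^bsub>\<pi>\<^esub> v (H (rep (p 1), 1))"
    "rep (p 0) \<in> V" "rep (p 1) \<in> V"
proof -
  obtain h where
    h: "continuous_map (prod_topology (subtopology S (glue g ` V)) (top_of_set {0..1::real})) S h"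
      "\<And>a \<tau>. a \<in> V \<Longrightarrow> \<tau> \<in> {0..1} \<Longrightarrow> h (glue g a, \<tau>) = glue g (H (a, \<tau>))"
    using glue_homotopy[OF g_pos V inv H Hinv] by metis
  have R: "rep (p s) \<in> V" "glue g (rep (p s)) = p s" "p s \<in> topspace S" if s: "s \<in> {0..1}" for s
  proof -
    show t: "p s \<in> topspace S" using pathin_in_topspace[OF p(1) s] .
    show e: "glue g (rep (p s)) = p s" using rep(2)[OF t] .
    have "rep (p s) \<in> {a \<in> strip. glue g a \<in> glue g ` V}" using rep[OF t] funcset_mem[OF p(2) s] by simp
    then show "rep (p s) \<in> V" using glue_saturated_open(2)[OF g_pos V inv] by simp
  qed
  have spine: "\<kappa> (\<lambda>\<tau>. h (p s, \<tau>)) = v (H (rep (p s), 1))" if s: "s \<in> {0..1}" for s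
  proof -
    let ?a = "rep (p s)"
    note a = R[OF s]
    have c: "continuous_on {0..1} (\<lambda>\<tau>. H (?a, \<tau>))" "(\<lambda>\<tau>. H (?a, \<tau>)) \<in> {0..1} \<rightarrow> strip"
      using a(1) H by (auto intro!: continuous_on_compose2[OF H(1)] continuous_intros)
    have "\<kappa> (\<lambda>\<tau>. h (p s, \<tau>)) = \<kappa> (\<lambda>\<tau>. glue g (H (?a, \<tau>)))"
    proof (rule sym, rule \<kappa>_eq_on)
      show "pathin S (\<lambda>\<tau>. glue g (H (?a, \<tau>)))" using c by (rule pathin_strip)
    qed (use h(2)[OF a(1)] a(2) in simp)
    also have "\<dots> = inv\<^bsub>\<pi>\<^esub> v (H (?a, 0)) \<otimes>\<^bsub>\<pi>\<^esub> v (H (?a, 1))" using c by (rule \<kappa>_strip)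
    also have "\<dots> = v (H (?a, 1))"
    proof -
      have "H (?a, 1) \<in> strip" using c(2) by auto
      then show ?thesis using H0[OF a(1)] v_rep[OF a(3)] by simp
    qed
    finally show ?thesis .
  qed
  have "\<kappa> p = \<kappa> (\<lambda>t. h (p 0, t)) \<otimes>\<^bsub>\<pi>\<^esub> inv\<^bsub>\<pi>\<^esub> \<kappa> (\<lambda>t. h (p 1, t))"
  proof (rule \<kappa>_in_contractible[OF h(1) _ _ p])
    show "h (u, 0) = u" if "u \<in> glue g ` V" for u using that h(2) H0 by auto
    show "h (u, 1) = w" if "u \<in> glue g ` V" for u using that h(2) H1 by auto
  qed
  then show "\<kappa> p = v (H (rep (p 0), 1)) \<otimes>\<^bsub>\<pi>\<^esub> inv\<^bsub>\<pi>\<^esub> v (H (rep (p 1), 1))"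
    by (simp add: spine)
  show "rep (p 0) \<in> V" "rep (p 1) \<in> V" using R by auto
qed

text \<open>The open disc, the points angularly nearer to one corner than to any other, and the
  neighbourhoods of the open edges contract in the surface to the centre, the vertex and the edge
  midpoints. They may be as large as possible, since generation needs each set separately and no
  agreement on overlaps.\<close>

definition disc_part :: "(real \<times> real) set" where
  "disc_part = {0..<1} \<times> UNIV"

definition corner_part :: "(real \<times> real) set" where
  "corner_part = {0<..1} \<times> (\<Union>j::int. {of_int j - 1/2<..<of_int j + 1/2})"

definition edge_class :: "int \<Rightarrow> int set" where
  "edge_class k = {m. \<exists>n. m = k + 4 * int g * n \<or> m = mate k + 4 * int g * n}"

definition edge_part :: "int \<Rightarrow> (real \<times> real) set" where
  "edge_part k = {0<..1} \<times> (\<Union>m\<in>edge_class k. {of_int m<..<of_int m + 1})"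

lemma edge_class_mate: "mate l \<in> edge_class k \<longleftrightarrow> l \<in> edge_class k"
proof -
  have shift: "mate (k + 4 * int g * n) = mate k + 4 * int g * n" for k n
    using mate_add[of k "int g * n"] by (simp add: algebra_simps)
  have "mate l \<in> edge_class k" if l: "l \<in> edge_class k" for l
  proof -
    obtain n where n: "l = k + 4 * int g * n \<or> l = mate k + 4 * int g * n"
      using l unfolding edge_class_def by auto
    then have "mate l = mate k + 4 * int g * n \<or> mate l = k + 4 * int g * n"
      using shift[of k n] shift[of "mate k" n] by auto
    then show ?thesis unfolding edge_class_def by auto
  qed
  from this[of l] this[of "mate l"] show ?thesis by auto
qed

lemma edge_class_shift: "l + 4 * int g \<in> edge_class k \<longleftrightarrow> l \<in> edge_class k"
proof -
  have "l + 4 * int g * d \<in> edge_class k" if l: "l \<in> edge_class k" for l d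
  proof -
    obtain n where "l = k + 4 * int g * n \<or> l = mate k + 4 * int g * n"
      using l unfolding edge_class_def by auto
    then have "l + 4 * int g * d = k + 4 * int g * (n + d) \<or> l + 4 * int g * d = mate k + 4 * int g * (n + d)"
      by (auto simp: distrib_left)
    then show ?thesis unfolding edge_class_def by blast
  qed
  from this[of l 1] this[of "l + 4 * int g" "-1"] show ?thesis by auto
qed

lemma openin_strip_Times:
  assumes "A = {0..1} \<inter> A'" "open A'" "open B" shows "openin (top_of_set strip) (A \<times> B)"
proof -
  have "A \<times> B = strip \<inter> (A' \<times> B)" unfolding strip_def assms(1) by auto
  then show ?thesis using assms by (metis open_Times openin_open_Int)
qed

lemma openin_parts:
  "openin (top_of_set strip) disc_part" "openin (top_of_set strip) corner_part"
  "openin (top_of_set strip) (edge_part k)"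
  unfolding disc_part_def corner_part_def edge_part_def
  by (rule openin_strip_Times[of _ "{..<1}"] openin_strip_Times[of _ "{0<..}"]; auto)+

lemma corner_partI: "0 < r \<Longrightarrow> r \<le> 1 \<Longrightarrow> \<bar>t - of_int j\<bar> < 1/2 \<Longrightarrow> (r, t) \<in> corner_part"
proof -
  assume "0 < r" "r \<le> 1" "\<bar>t - of_int j\<bar> < 1/2"
  then have "t \<in> {of_int j - 1/2<..<of_int j + 1/2}" unfolding greaterThanLessThan_iff by linarith
  with \<open>0 < r\<close> \<open>r \<le> 1\<close> show ?thesis unfolding corner_part_def by auto
qed

lemma corner_partD:
  assumes "(r, t) \<in> corner_part"
  shows "0 < r" "r \<le> 1" "\<bar>t - of_int (round t)\<bar> < 1/2"
proof -
  obtain j :: int where r: "0 < r" "r \<le> 1" and "t \<in> {of_int j - 1/2<..<of_int j + 1/2}"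
    using assms unfolding corner_part_def by auto
  then have j: "\<bar>t - of_int j\<bar> < 1/2" unfolding greaterThanLessThan_iff by linarith
  then have "round t = j" using round_unique'[of t j] by simp
  with r j show "0 < r" "r \<le> 1" "\<bar>t - of_int (round t)\<bar> < 1/2" by blast+
qed

lemma corner_part_iff: "(r, t) \<in> corner_part \<longleftrightarrow> 0 < r \<and> r \<le> 1 \<and> \<bar>t - of_int (round t)\<bar> < 1/2"
  using corner_partI corner_partD by blast

lemma edge_part_iff: "(r, t) \<in> edge_part k \<longleftrightarrow> 0 < r \<and> r \<le> 1 \<and> t \<noteq> of_int \<lfloor>t\<rfloor> \<and> \<lfloor>t\<rfloor> \<in> edge_class k"
proof
  assume "(r, t) \<in> edge_part k"
  then obtain m where m: "m \<in> edge_class k" "of_int m < t" "t < of_int m + 1" "0 < r" "r \<le> 1"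
    unfolding edge_part_def by auto
  moreover have "\<lfloor>t\<rfloor> = m" using m by (simp add: floor_eq_iff)
  ultimately show "0 < r \<and> r \<le> 1 \<and> t \<noteq> of_int \<lfloor>t\<rfloor> \<and> \<lfloor>t\<rfloor> \<in> edge_class k" by simp
next
  assume a: "0 < r \<and> r \<le> 1 \<and> t \<noteq> of_int \<lfloor>t\<rfloor> \<and> \<lfloor>t\<rfloor> \<in> edge_class k"
  then have "of_int \<lfloor>t\<rfloor> < t" "t < of_int \<lfloor>t\<rfloor> + 1" using of_int_floor_le[of t] by linarith+
  then show "(r, t) \<in> edge_part k" using a unfolding edge_part_def by auto
qed

lemma round_shift: "round (t + 4 * real g) = round t + 4 * int g"
proof -
  have "t + 4 * real g + 1/2 = (t + 1/2) + of_int (4 * int g)" by simp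
  then show ?thesis unfolding round_def by (metis floor_add_int)
qed

lemma floor_shift: "\<lfloor>t + 4 * real g\<rfloor> = \<lfloor>t\<rfloor> + 4 * int g"
  using floor_add_int[of t "4 * int g"] by simp

lemma glue_shift: "glue g (r, t + 4 * real g) = glue g (r, t)"
  using glue_period[OF g_pos, of r t 1] by simp

lemma round_edge:
  assumes "0 \<le> s" "s \<le> 1"
  shows "s < 1/2 \<Longrightarrow> round (of_int k + s) = k" "s < 1/2 \<Longrightarrow> round (of_int m + 1 - s) = m + 1"
    "s > 1/2 \<Longrightarrow> round (of_int k + s) = k + 1" "s > 1/2 \<Longrightarrow> round (of_int m + 1 - s) = m"
  using assms by (auto intro!: round_unique' simp: abs_less_iff)

lemma not_corner_half: "(r, of_int k + 1/2) \<notin> corner_part"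
proof
  assume "(r, of_int k + 1/2) \<in> corner_part"
  from corner_partD(3)[OF this]
  have "\<bar>of_int (2 * k + 1 - 2 * round (of_int k + 1/2 :: real)) :: real\<bar> < 1"
    unfolding of_int_diff of_int_add of_int_mult by linarith
  then have "\<bar>2 * k + 1 - 2 * round (of_int k + 1/2 :: real)\<bar> < 1" by linarith
  then show False by presburger
qed

text \<open>Moving to the boundary and linearly to the nearest corner respects the gluing, because
  reversing an edge preserves the distance to the nearest end. The midpoint of an edge, where the
  nearest end is ambiguous, is left out.\<close>

lemma corner_invariant: "glue_invariant g (\<lambda>a. a \<in> corner_part)"
  and corner_homotopy_invariant: "\<tau> \<in> {0..1} \<Longrightarrow> glue_invariant g (\<lambda>a. if a \<in> corner_part
     then Some (glue g (fst a + \<tau> * (1 - fst a), snd a + \<tau> * (of_int (round (snd a)) - snd a))) else None)"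
proof -
  let ?\<Phi> = "\<lambda>\<tau> a. if a \<in> corner_part
     then Some (glue g (fst a + \<tau> * (1 - fst a), snd a + \<tau> * (of_int (round (snd a)) - snd a))) else None"
  have zero: "(0, t) \<notin> corner_part" for t using corner_partD(1) by blast
  have shift: "(r, t + 4 * real g) \<in> corner_part \<longleftrightarrow> (r, t) \<in> corner_part" for r t
    by (simp add: corner_part_iff round_shift)
  have edge: "((1, of_int k + s) \<in> corner_part \<longleftrightarrow> s \<noteq> 1/2) \<and> ((1, of_int m + 1 - s) \<in> corner_part \<longleftrightarrow> s \<noteq> 1/2)"
    if s: "0 \<le> s" "s \<le> 1" for k m :: int and s :: real
  proof (cases "s = 1/2")
    case True
    moreover have "of_int m + 1 - 1/2 = (of_int m + 1/2 :: real)" by simp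
    ultimately show ?thesis using not_corner_half[of 1 k] not_corner_half[of 1 m] by metis
  next
    case False
    then consider "s < 1/2" | "s > 1/2" by linarith
    then show ?thesis using s by cases (auto simp: corner_part_iff round_edge)
  qed
  show "glue_invariant g (\<lambda>a. a \<in> corner_part)"
    unfolding glue_invariant_def using zero shift edge by auto
  show "glue_invariant g (?\<Phi> \<tau>)" if \<tau>: "\<tau> \<in> {0..1}"
    unfolding glue_invariant_def
  proof (intro conjI ballI allI)
    show "?\<Phi> \<tau> (0, t) = ?\<Phi> \<tau> (0, t')" for t t' using zero by simp
    show "?\<Phi> \<tau> (r, t + 4 * real g) = ?\<Phi> \<tau> (r, t)" for r t
      using glue_shift[of "r + \<tau> * (1 - r)" "t + \<tau> * (of_int (round t) - t)"]
      unfolding shift fst_conv snd_conv round_shift by (simp add: algebra_simps)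
    fix k and s :: real assume "s \<in> {0..1}"
    then have s: "0 \<le> s" "s \<le> 1" by auto
    consider "s < 1/2" | "s = 1/2" | "s > 1/2" by linarith
    then show "?\<Phi> \<tau> (1, of_int k + s) = ?\<Phi> \<tau> (1, of_int (mate k) + 1 - s)"
    proof cases
      case 1
      \<comment> \<open>At stage \<tau> the parameter \<open>s\<close> has become
        \<open>(1 - \<tau>) * s\<close> on the edge and, symmetrically, on its mate, so the gluing
        of the edge applies again at the new parameter.\<close>
      have "(1 - \<tau>) * s \<in> {0..1}" using \<tau> s by (auto intro: mult_le_one)
      then have "glue g (1, of_int k + (1 - \<tau>) * s) = glue g (1, of_int (mate k) + 1 - (1 - \<tau>) * s)"
        by (rule glue_edge[OF g_pos])
      then show ?thesis using edge[OF s] round_edge[OF s] 1 by (simp add: algebra_simps)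
    next
      case 2
      then show ?thesis using edge[OF s] by simp
    next
      case 3
      have "\<tau> * (1 - s) \<le> 1 * (1 - s)" using \<tau> s by (intro mult_right_mono) auto
      then have "s + \<tau> * (1 - s) \<in> {0..1}" using \<tau> s by auto
      then have "glue g (1, of_int k + (s + \<tau> * (1 - s))) = glue g (1, of_int (mate k) + 1 - (s + \<tau> * (1 - s)))"
        by (rule glue_edge[OF g_pos])
      then show ?thesis using edge[OF s] round_edge[OF s] 3 by (simp add: algebra_simps)
    qed
  qed
qed

text \<open>Here the motion goes to the midpoint of the edge, which is fixed by reversal; the
  corners have to be left out.\<close>

lemma edge_invariant: "glue_invariant g (\<lambda>a. a \<in> edge_part k)"
  and edge_homotopy_invariant: "\<tau> \<in> {0..1} \<Longrightarrow> glue_invariant g (\<lambda>a. if a \<in> edge_part k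
     then Some (glue g (fst a + \<tau> * (1 - fst a), snd a + \<tau> * (of_int \<lfloor>snd a\<rfloor> + 1/2 - snd a))) else None)"
proof -
  let ?\<Phi> = "\<lambda>\<tau> a. if a \<in> edge_part k
     then Some (glue g (fst a + \<tau> * (1 - fst a), snd a + \<tau> * (of_int \<lfloor>snd a\<rfloor> + 1/2 - snd a))) else None"
  have zero: "(0, t) \<notin> edge_part k" for t by (simp add: edge_part_iff)
  have shift: "(r, t + 4 * real g) \<in> edge_part k \<longleftrightarrow> (r, t) \<in> edge_part k" for r t
    by (simp add: edge_part_iff floor_shift edge_class_shift)
  have fl: "\<lfloor>of_int l + s\<rfloor> = l" "\<lfloor>of_int m + 1 - s\<rfloor> = m" if "0 < s" "s < 1" for l m :: int and s :: real
    using that by (auto simp: floor_eq_iff)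
  have edge: "((1, of_int l + s) \<in> edge_part k \<longleftrightarrow> s \<noteq> 0 \<and> s \<noteq> 1 \<and> l \<in> edge_class k) \<and>
      ((1, of_int (mate l) + 1 - s) \<in> edge_part k \<longleftrightarrow> s \<noteq> 0 \<and> s \<noteq> 1 \<and> l \<in> edge_class k)"
    if s: "0 \<le> s" "s \<le> 1" for l :: int and s :: real
  proof -
    consider "s = 0" | "s = 1" | "0 < s" "s < 1" using s by linarith
    then show ?thesis
    proof cases
      case 1
      have "\<lfloor>real_of_int (mate l) + 1\<rfloor> = mate l + 1" by simp
      then show ?thesis using 1 by (simp add: edge_part_iff)
    next
      case 2
      have "\<lfloor>real_of_int l + 1\<rfloor> = l + 1" by simp
      then show ?thesis using 2 by (simp add: edge_part_iff)
    next
      case 3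
      then show ?thesis using fl[OF 3] by (auto simp: edge_part_iff edge_class_mate)
    qed
  qed
  show "glue_invariant g (\<lambda>a. a \<in> edge_part k)"
    unfolding glue_invariant_def using zero shift edge by auto
  show "glue_invariant g (?\<Phi> \<tau>)" if \<tau>: "\<tau> \<in> {0..1}"
    unfolding glue_invariant_def
  proof (intro conjI ballI allI)
    show "?\<Phi> \<tau> (0, t) = ?\<Phi> \<tau> (0, t')" for t t' using zero by simp
    show "?\<Phi> \<tau> (r, t + 4 * real g) = ?\<Phi> \<tau> (r, t)" for r t
      using glue_shift[of "r + \<tau> * (1 - r)" "t + \<tau> * (of_int \<lfloor>t\<rfloor> + 1/2 - t)"]
      unfolding shift fst_conv snd_conv floor_shift by (simp add: algebra_simps)
    fix l and s :: real assume "s \<in> {0..1}"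
    then have s: "0 \<le> s" "s \<le> 1" by auto
    show "?\<Phi> \<tau> (1, of_int l + s) = ?\<Phi> \<tau> (1, of_int (mate l) + 1 - s)"
    proof (cases "s \<noteq> 0 \<and> s \<noteq> 1 \<and> l \<in> edge_class k")
      case True
      then have s': "0 < s" "s < 1" using s by auto
      have "(1 - \<tau>) * s + \<tau> * (1/2) \<in> {0..1}"
      proof -
        have "(1 - \<tau>) * s \<le> (1 - \<tau>) * 1" using \<tau> s by (intro mult_left_mono) auto
        moreover have "0 \<le> (1 - \<tau>) * s" using \<tau> s by simp
        ultimately show ?thesis using \<tau> by simp
      qed
      then have "glue g (1, of_int l + ((1 - \<tau>) * s + \<tau> * (1/2)))
          = glue g (1, of_int (mate l) + 1 - ((1 - \<tau>) * s + \<tau> * (1/2)))"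
        by (rule glue_edge[OF g_pos])
      then show ?thesis using edge[OF s, of l] fl[OF s'] True by (simp add: algebra_simps)
    next
      case False
      then show ?thesis using edge[OF s, of l] by auto
    qed
  qed
qed

lemma \<kappa>_disc:
  assumes p: "pathin S p" "p \<in> {0..1} \<rightarrow> glue g ` disc_part"
  shows "\<kappa> p = \<one>\<^bsub>\<pi>\<^esub>"
proof -
  let ?H = "\<lambda>b::(real \<times> real) \<times> real. ((1 - snd b) * fst (fst b), snd (fst b))"
  have "\<kappa> p = v (?H (rep (p 0), 1)) \<otimes>\<^bsub>\<pi>\<^esub> inv\<^bsub>\<pi>\<^esub> v (?H (rep (p 1), 1))"
  proof (rule \<kappa>_contract[OF openin_parts(1) _ _ _ _ _ _ p, where w = "glue g (0, 0)"])
    show "glue_invariant g (\<lambda>a. a \<in> disc_part)" by (simp add: glue_invariant_def disc_part_def)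
    show "continuous_on (disc_part \<times> {0..1}) ?H" by (intro continuous_intros)
    show "?H \<in> disc_part \<times> {0..1} \<rightarrow> strip"
      by (auto simp: disc_part_def intro!: mult_le_one)
    show "glue_invariant g (\<lambda>a. if a \<in> disc_part then Some (glue g (?H (a, \<tau>))) else None)" for \<tau>
      by (auto simp: glue_invariant_def disc_part_def glue_shift intro!: glue_centre)
    show "glue g (?H (a, 1)) = glue g (0, 0)" for a using glue_centre by simp
  qed auto
  then show ?thesis by simp
qed

lemma \<kappa>_corner:
  assumes p: "pathin S p" "p \<in> {0..1} \<rightarrow> glue g ` corner_part"
  shows "\<exists>i j :: int. \<kappa> p = v (1, of_int i) \<otimes>\<^bsub>\<pi>\<^esub> inv\<^bsub>\<pi>\<^esub> v (1, of_int j)"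
proof -
  let ?H = "\<lambda>b::(real \<times> real) \<times> real. (fst (fst b) + snd b * (1 - fst (fst b)),
     snd (fst b) + snd b * (of_int (round (snd (fst b))) - snd (fst b)))"
  have "\<kappa> p = v (?H (rep (p 0), 1)) \<otimes>\<^bsub>\<pi>\<^esub> inv\<^bsub>\<pi>\<^esub> v (?H (rep (p 1), 1))"
  proof (rule \<kappa>_contract[OF openin_parts(2) corner_invariant _ _ _ _ _ p, where w = "glue g (1, of_int 0)"])
    have "continuous_on (\<Union>j::int. {of_int j - 1/2<..<of_int j + 1/2}) (\<lambda>t::real. real_of_int (round t))"
      by (rule continuous_on_locally_constant[where c = real_of_int])
        (simp, intro arg_cong[where f = real_of_int] round_unique', unfold greaterThanLessThan_iff, linarith)
    then have "continuous_on (corner_part \<times> {0..1}) (\<lambda>b::(real \<times> real) \<times> real. real_of_int (round (snd (fst b))))"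
      by (rule continuous_on_compose2) (auto simp: corner_part_def intro!: continuous_intros)
    then show "continuous_on (corner_part \<times> {0..1}) ?H"
      by (intro continuous_on_Pair continuous_on_add continuous_on_diff continuous_on_mult
          continuous_on_fst continuous_on_snd continuous_on_const continuous_on_id)
    have "0 < r \<Longrightarrow> r \<le> 1 \<Longrightarrow> 0 \<le> \<tau> \<Longrightarrow> \<tau> \<le> 1 \<Longrightarrow> 0 \<le> r + \<tau> * (1 - r) \<and> r + \<tau> * (1 - r) \<le> 1" for r \<tau> :: real
      using mult_right_mono[of \<tau> 1 "1 - r"] by auto
    then show "?H \<in> corner_part \<times> {0..1} \<rightarrow> strip"
      by (auto simp: corner_part_iff)
    show "glue_invariant g (\<lambda>a. if a \<in> corner_part then Some (glue g (?H (a, \<tau>))) else None)"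
      if "\<tau> \<in> {0..1}" for \<tau> unfolding fst_conv snd_conv by (rule corner_homotopy_invariant[OF that])
    show "glue g (?H (a, 1)) = glue g (1, of_int 0)" for a
      using glue_corner[of "round (snd a)" 0] by simp
  qed auto
  then show ?thesis by auto
qed

text \<open>Both ends of the path contract to lifts of one edge midpoint, each on edge
  \<open>k\<close> or on its mate up to the period. If both are on the same side the two values of
  \<open>v\<close> cancel; otherwise the path crosses the edge and yields \<open>gen k\<close> or
  its inverse.\<close>

lemma \<kappa>_edge:
  assumes p: "pathin S p" "p \<in> {0..1} \<rightarrow> glue g ` edge_part k"
  shows "\<kappa> p \<in> {\<one>\<^bsub>\<pi>\<^esub>, gen k, inv\<^bsub>\<pi>\<^esub> gen k}"
proof -
  let ?H = "\<lambda>b::(real \<times> real) \<times> real. (fst (fst b) + snd b * (1 - fst (fst b)),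
     snd (fst b) + snd b * (of_int \<lfloor>snd (fst b)\<rfloor> + 1/2 - snd (fst b)))"
  have half: "of_int (l + 4 * int g * n) + 1/2 = (of_int l + 1/2) + 4 * real g * of_int n" for l n
    by simp
  have glue_half: "glue g (1, of_int m + 1/2) = glue g (1, of_int k + 1/2)" if "m \<in> edge_class k" for m
  proof -
    obtain n where "m = k + 4 * int g * n \<or> m = mate k + 4 * int g * n"
      using \<open>m \<in> edge_class k\<close> unfolding edge_class_def by auto
    moreover have "glue g (1, of_int (mate k) + 1/2) = glue g (1, of_int k + 1/2)"
      using glue_edge[OF g_pos, of "1/2" k] by (simp add: add.commute)
    ultimately show ?thesis using glue_period[OF g_pos] half by metis
  qed
  have v_half: "v (1, of_int m + 1/2) \<in> {v (1, of_int k + 1/2), v (1, of_int (mate k) + 1/2)}"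
    if "m \<in> edge_class k" for m
  proof -
    obtain n where "m = k + 4 * int g * n \<or> m = mate k + 4 * int g * n"
      using \<open>m \<in> edge_class k\<close> unfolding edge_class_def by auto
    then show ?thesis using v_period half by (metis insertCI)
  qed
  have "continuous_on (\<Union>m\<in>edge_class k. {of_int m<..<of_int m + 1}) (\<lambda>t::real. real_of_int \<lfloor>t\<rfloor>)"
    by (rule continuous_on_locally_constant[where c = real_of_int]) (auto simp: floor_eq_iff)
  then have "continuous_on (edge_part k \<times> {0..1}) (\<lambda>b::(real \<times> real) \<times> real. real_of_int \<lfloor>snd (fst b)\<rfloor>)"
    by (rule continuous_on_compose2) (auto simp: edge_part_def intro!: continuous_intros)
  then have cont: "continuous_on (edge_part k \<times> {0..1}) ?H"
    by (intro continuous_on_Pair continuous_on_add continuous_on_diff continuous_on_mult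
        continuous_on_fst continuous_on_snd continuous_on_const continuous_on_id)
  have "0 < r \<Longrightarrow> r \<le> 1 \<Longrightarrow> 0 \<le> \<tau> \<Longrightarrow> \<tau> \<le> 1 \<Longrightarrow> 0 \<le> r + \<tau> * (1 - r) \<and> r + \<tau> * (1 - r) \<le> 1" for r \<tau> :: real
    using mult_right_mono[of \<tau> 1 "1 - r"] by auto
  then have strip: "?H \<in> edge_part k \<times> {0..1} \<rightarrow> strip"
    by (auto simp: edge_part_iff)
  have inv: "glue_invariant g (\<lambda>a. if a \<in> edge_part k then Some (glue g (?H (a, \<tau>))) else None)"
    if "\<tau> \<in> {0..1}" for \<tau> unfolding fst_conv snd_conv by (rule edge_homotopy_invariant[OF that])
  have const: "glue g (?H (a, 1)) = glue g (1, of_int k + 1/2)" if "a \<in> edge_part k" for a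
    using glue_half[of "\<lfloor>snd a\<rfloor>"] that by (cases a) (simp add: edge_part_iff)
  have H0: "?H (a, 0) = a" for a by simp
  note C = \<kappa>_contract[OF openin_parts(3) edge_invariant cont strip inv H0 const p]
  have fl: "\<lfloor>snd a\<rfloor> \<in> edge_class k" if "a \<in> edge_part k" for a
    using that by (cases a) (simp add: edge_part_iff)
  define m m' where "m = \<lfloor>snd (rep (p 0))\<rfloor>" and "m' = \<lfloor>snd (rep (p 1))\<rfloor>"
  have m: "m \<in> edge_class k" "m' \<in> edge_class k" using fl C(2,3) by (auto simp: m_def m'_def)
  have "\<kappa> p = v (1, of_int m + 1/2) \<otimes>\<^bsub>\<pi>\<^esub> inv\<^bsub>\<pi>\<^esub> v (1, of_int m' + 1/2)"
    using C(1) by (simp add: m_def m'_def)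
  moreover have "gen k = v (1, of_int k + 1/2) \<otimes>\<^bsub>\<pi>\<^esub> inv\<^bsub>\<pi>\<^esub> v (1, of_int (mate k) + 1/2)"
    using gen_eq[of "1/2" k] by (simp add: add.commute)
  moreover have "inv\<^bsub>\<pi>\<^esub> gen k = v (1, of_int (mate k) + 1/2) \<otimes>\<^bsub>\<pi>\<^esub> inv\<^bsub>\<pi>\<^esub> v (1, of_int k + 1/2)"
    using gen_eq[of "1/2" "mate k"] gen_mate[of k] by (simp add: add.commute)
  ultimately show ?thesis using v_half[OF m(1)] v_half[OF m(2)] by auto
qed

lemma generate_gen: "generate \<pi> (gen ` {k. 0 \<le> k \<and> k < 4 * int g \<and> k mod 4 < 2}) = carrier \<pi>"
proof -
  define H where "H = generate \<pi> (gen ` {k. 0 \<le> k \<and> k < 4 * int g \<and> k mod 4 < 2})"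
  have H: "subgroup H \<pi>" unfolding H_def by (intro \<pi>.generate_is_subgroup) auto
  have gen_H: "gen k \<in> H" for k
  proof -
    have base: "gen l \<in> H" if "l mod 4 < 2" for l
    proof -
      define m where "m = l mod (4 * int g)"
      have "l = m + 4 * int g * (l div (4 * int g))"
        unfolding m_def by simp
      then have "gen l = gen m" using gen_period by metis
      moreover have "m mod 4 < 2" using that by (simp add: m_def mod_mod_cancel)
      moreover have "0 \<le> m" "m < 4 * int g" using g_pos by (auto simp: m_def)
      ultimately show ?thesis unfolding H_def by (auto intro: generate.incl)
    qed
    show ?thesis
    proof (cases "k mod 4 < 2")
      case False
      then have "mate k mod 4 < 2" unfolding mate_def by presburger
      then have "gen (mate k) \<in> H" by (rule base)
      then have "inv\<^bsub>\<pi>\<^esub> gen (mate k) \<in> H" using H by (simp add: subgroup.m_inv_closed)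
      then show ?thesis by (simp add: gen_mate)
    qed (rule base)
  qed
  \<comment> \<open>One step of the corner chain, from \<open>k\<close> to
    \<open>mate k + 1\<close>, is \<open>gen k\<close> by definition, so any two corner values
    differ by an element of \<open>H\<close>.\<close>
  have corner: "v (1, of_int i) \<otimes>\<^bsub>\<pi>\<^esub> inv\<^bsub>\<pi>\<^esub> v (1, of_int j) \<in> H" for i j :: int
  proof (rule corner_induct[where R = "\<lambda>i j. v (1, of_int i) \<otimes>\<^bsub>\<pi>\<^esub> inv\<^bsub>\<pi>\<^esub> v (1, of_int j) \<in> H"])
    fix i j l k :: int
    show "v (1, of_int i) \<otimes>\<^bsub>\<pi>\<^esub> inv\<^bsub>\<pi>\<^esub> v (1, of_int i) \<in> H"
      using subgroup.one_closed[OF H] by simp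
    show "v (1, of_int j) \<otimes>\<^bsub>\<pi>\<^esub> inv\<^bsub>\<pi>\<^esub> v (1, of_int i) \<in> H"
      if "v (1, of_int i) \<otimes>\<^bsub>\<pi>\<^esub> inv\<^bsub>\<pi>\<^esub> v (1, of_int j) \<in> H"
      using subgroup.m_inv_closed[OF H that] by (simp add: \<pi>.inv_mult_group)
    show "v (1, of_int i) \<otimes>\<^bsub>\<pi>\<^esub> inv\<^bsub>\<pi>\<^esub> v (1, of_int l) \<in> H"
      if "v (1, of_int i) \<otimes>\<^bsub>\<pi>\<^esub> inv\<^bsub>\<pi>\<^esub> v (1, of_int j) \<in> H" "v (1, of_int j) \<otimes>\<^bsub>\<pi>\<^esub> inv\<^bsub>\<pi>\<^esub> v (1, of_int l) \<in> H"
    proof -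
      have "v (1, of_int i) \<otimes>\<^bsub>\<pi>\<^esub> inv\<^bsub>\<pi>\<^esub> v (1, of_int l) =
          (v (1, of_int i) \<otimes>\<^bsub>\<pi>\<^esub> inv\<^bsub>\<pi>\<^esub> v (1, of_int j)) \<otimes>\<^bsub>\<pi>\<^esub> (v (1, of_int j) \<otimes>\<^bsub>\<pi>\<^esub> inv\<^bsub>\<pi>\<^esub> v (1, of_int l))"
        by (simp add: \<pi>.m_assoc) (simp flip: \<pi>.m_assoc)
      then show ?thesis using subgroup.m_closed[OF H that] by simp
    qed
    show "v (1, of_int k) \<otimes>\<^bsub>\<pi>\<^esub> inv\<^bsub>\<pi>\<^esub> v (1, of_int (mate k + 1)) \<in> H"
      using gen_H[of k] by (simp add: gen_def)
  qed
  define U where "U = (\<lambda>i :: int option option. case i of None \<Rightarrow> glue g ` disc_part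
     | Some None \<Rightarrow> glue g ` corner_part | Some (Some k) \<Rightarrow> glue g ` edge_part k)"
  have "H = carrier \<pi>"
  proof (rule carrier_eq_if_small_paths[OF H, of UNIV U])
    have disc_inv: "glue_invariant g (\<lambda>a. a \<in> disc_part)" by (simp add: glue_invariant_def disc_part_def)
    show "openin S (U i)" for i
      unfolding U_def using glue_saturated_open(1)[OF g_pos openin_parts(1) disc_inv]
        glue_saturated_open(1)[OF g_pos openin_parts(2) corner_invariant]
        glue_saturated_open(1)[OF g_pos openin_parts(3) edge_invariant]
      by (auto split: option.split)
    show "topspace S \<subseteq> (\<Union>i\<in>UNIV. U i)"
    proof
      fix x assume "x \<in> topspace S"
      then obtain a where a: "a \<in> strip" "glue g a = x" using glue_onto[OF g_pos] by metis
      obtain r t where rt: "a = (r, t)" by fastforce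
      have "a \<in> disc_part \<or> a \<in> corner_part \<or> (\<exists>k. a \<in> edge_part k)"
      proof (cases "r < 1")
        case False
        then have r: "r = 1" using a rt by simp
        show ?thesis
        proof (cases "t = of_int \<lfloor>t\<rfloor>")
          case True
          then have "\<bar>t - of_int \<lfloor>t\<rfloor>\<bar> < 1/2" by simp
          then show ?thesis using corner_partI[of 1 t "\<lfloor>t\<rfloor>"] rt r by simp
        next
          case False
          moreover have "\<lfloor>t\<rfloor> \<in> edge_class \<lfloor>t\<rfloor>"
            unfolding edge_class_def by (auto intro: exI[of _ 0])
          ultimately show ?thesis using rt r by (auto simp: edge_part_iff)
        qed
      qed (use a rt in \<open>auto simp: disc_part_def\<close>)
      then have "x \<in> U None \<or> x \<in> U (Some None) \<or> (\<exists>k. x \<in> U (Some (Some k)))"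
        unfolding U_def using a(2) by auto
      then show "x \<in> (\<Union>i\<in>UNIV. U i)" by blast
    qed
    fix i p assume p: "pathin S p" "p \<in> {0..1} \<rightarrow> U i"
    show "\<kappa> p \<in> H"
    proof (cases i)
      case None
      then show ?thesis using \<kappa>_disc[OF p(1)] p(2) subgroup.one_closed[OF H] by (simp add: U_def)
    next
      case (Some j)
      show ?thesis
      proof (cases j)
        case None
        then show ?thesis using \<kappa>_corner[OF p(1)] p(2) corner Some by (auto simp: U_def)
      next
        case (Some k)
        then have "\<kappa> p \<in> {\<one>\<^bsub>\<pi>\<^esub>, gen k, inv\<^bsub>\<pi>\<^esub> gen k}"
          using \<kappa>_edge[OF p(1), of k] p(2) \<open>i = Some j\<close> by (simp add: U_def)
        then show ?thesis using subgroup.one_closed[OF H] gen_H[of k] subgroup.m_inv_closed[OF H gen_H] by auto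
      qed
    qed
  qed
  then show ?thesis by (simp add: H_def)
qed

end

section \<open>Homomorphisms out of the fundamental group of the surface\<close>

text \<open>The boundary patches are kept away from \<open>Disc\<close>, and the sectors bridge the
  gap. \<open>Disc\<close> and the sectors carry trivial potentials, so a sector has to be narrow
  enough for a boundary label to be constant on its overlap with one boundary patch.\<close>

datatype patch_index = Disc | Sector real | Corner | Edge int

lemma (in group) ratio_translate:
  assumes "c \<in> carrier G" "x \<in> carrier G" "y \<in> carrier G"
  shows "inv (c \<otimes> x) \<otimes> (c \<otimes> y) = inv x \<otimes> y"
proof -
  have "inv (c \<otimes> x) \<otimes> (c \<otimes> y) = inv x \<otimes> (inv c \<otimes> (c \<otimes> y))"
    using assms by (simp add: inv_mult_group m_assoc)
  also have "inv c \<otimes> (c \<otimes> y) = y" using assms by (simp flip: m_assoc)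
  finally show ?thesis .
qed

context surface
begin

text \<open>The widths are chosen such that points of one sector which lie in a common corner or edge patch
  lie, up to the period \<open>4 * g\<close>, in the same interval of it.  Larger patches would not admit
  compatible potentials.\<close>

primrec patch :: "patch_index \<Rightarrow> (real \<times> real) set" where
  "patch Disc = {0..<1/2} \<times> UNIV"
| "patch (Sector \<theta>) = {0<..<1} \<times> (\<Union>n::int. {\<theta> + of_int (4 * int g * n) - 1/8<..<\<theta> + of_int (4 * int g * n) + 1/8})"
| "patch Corner = {1/2<..1} \<times> (\<Union>j::int. {of_int j - 1/4<..<of_int j + 1/4})"
| "patch (Edge k) = {1/2<..1} \<times>
     ((\<Union>n::int. {of_int (k + 4 * int g * n) + 1/8<..<of_int (k + 4 * int g * n) + 5/8}) \<union>
      (\<Union>n::int. {of_int (mate k + 4 * int g * n) + 3/8<..<of_int (mate k + 4 * int g * n) + 7/8}))"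

lemma openin_patch: "openin (top_of_set strip) (patch i)"
proof (cases i)
  case Disc
  then show ?thesis by (auto intro!: openin_strip_Times[of _ "{..<1/2}"])
next
  case (Sector \<theta>)
  then show ?thesis by (auto intro!: openin_strip_Times[of _ "{0<..<1}"])
next
  case Corner
  then show ?thesis by (auto intro!: openin_strip_Times[of _ "{1/2<..}"])
next
  case (Edge k)
  then show ?thesis by (auto intro!: openin_strip_Times[of _ "{1/2<..}"] open_Un open_UN)
qed

lemma mate_shift: "mate (k + 4 * int g * n) = mate k + 4 * int g * n"
  using mate_add[of k "int g * n"] by (simp add: algebra_simps)

lemma patch_corner_round:
  assumes "(r, t) \<in> patch Corner" shows "\<bar>t - of_int (round t)\<bar> < 1/4"
proof -
  obtain j :: int where "t \<in> {of_int j - 1/4<..<of_int j + 1/4}" using assms by auto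
  then have j: "\<bar>t - of_int j\<bar> < 1/4" unfolding greaterThanLessThan_iff by linarith
  then have "round t = j" using round_unique'[of t j] by linarith
  with j show ?thesis by simp
qed

text \<open>The asymmetric offsets make the patch meet \<open>Corner\<close> only near the start of
  edge \<open>k\<close> and near the end of its mate, two ends which are glued. The other end of the
  edge is left to the patch of \<open>mate k\<close>. Hence corner and edge labels are tied by a
  single equation for each \<open>k\<close>.\<close>

lemma patch_edge_cases:
  assumes "(r, t) \<in> patch (Edge k)"
  obtains n where "\<lfloor>t\<rfloor> = k + 4 * int g * n" "of_int \<lfloor>t\<rfloor> + 1/8 < t" "t < of_int \<lfloor>t\<rfloor> + 5/8"
  | n where "\<lfloor>t\<rfloor> = mate k + 4 * int g * n" "of_int \<lfloor>t\<rfloor> + 3/8 < t" "t < of_int \<lfloor>t\<rfloor> + 7/8"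
proof -
  consider n where "t \<in> {of_int (k + 4 * int g * n) + 1/8<..<of_int (k + 4 * int g * n) + 5/8}"
    | n where "t \<in> {of_int (mate k + 4 * int g * n) + 3/8<..<of_int (mate k + 4 * int g * n) + 7/8}"
    using assms by auto
  then show ?thesis
  proof cases
    case 1
    then have b: "of_int (k + 4 * int g * n) + 1/8 < t" "t < of_int (k + 4 * int g * n) + 5/8"
      unfolding greaterThanLessThan_iff by auto
    then have "\<lfloor>t\<rfloor> = k + 4 * int g * n" unfolding floor_eq_iff by linarith
    then show ?thesis using b by (intro that(1)[of n]) simp_all
  next
    case 2
    then have b: "of_int (mate k + 4 * int g * n) + 3/8 < t" "t < of_int (mate k + 4 * int g * n) + 7/8"
      unfolding greaterThanLessThan_iff by auto
    then have "\<lfloor>t\<rfloor> = mate k + 4 * int g * n" unfolding floor_eq_iff by linarith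
    then show ?thesis using b by (intro that(2)[of n]) simp_all
  qed
qed

text \<open>Reversing an edge exchanges the offset ranges from 1/8 to 5/8 and from 3/8 to
  7/8.\<close>

lemma patch_edge_opposite:
  assumes s: "0 \<le> s" "s \<le> 1" and l: "(1, of_int l + s) \<in> patch (Edge k)"
  shows "(1, of_int (mate l) + 1 - s) \<in> patch (Edge k)"
  using l
proof (cases rule: patch_edge_cases)
  case (1 n)
  then have "\<bar>of_int (\<lfloor>of_int l + s\<rfloor> - l) :: real\<bar> < 1" using s unfolding of_int_diff by linarith
  then have f: "\<lfloor>of_int l + s\<rfloor> = l" by linarith
  then have "of_int (mate k + 4 * int g * n) + 3/8 < of_int (mate l) + 1 - s"
    "of_int (mate l) + 1 - s < of_int (mate k + 4 * int g * n) + 7/8"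
    using 1 mate_shift[of k n] by auto
  then have "of_int (mate l) + 1 - s \<in> {of_int (mate k + 4 * int g * n) + 3/8<..<of_int (mate k + 4 * int g * n) + 7/8}"
    by simp
  moreover have "(1::real) \<in> {1/2<..1}" by simp
  ultimately show ?thesis unfolding patch.simps by blast
next
  case (2 n)
  then have "\<bar>of_int (\<lfloor>of_int l + s\<rfloor> - l) :: real\<bar> < 1" using s unfolding of_int_diff by linarith
  then have f: "\<lfloor>of_int l + s\<rfloor> = l" by linarith
  then have "of_int (k + 4 * int g * n) + 1/8 < of_int (mate l) + 1 - s"
    "of_int (mate l) + 1 - s < of_int (k + 4 * int g * n) + 5/8"
    using 2 mate_shift[of "mate k" n] by auto
  then have "of_int (mate l) + 1 - s \<in> {of_int (k + 4 * int g * n) + 1/8<..<of_int (k + 4 * int g * n) + 5/8}"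
    by simp
  moreover have "(1::real) \<in> {1/2<..1}" by simp
  ultimately show ?thesis unfolding patch.simps by blast
qed

lemma UN_shift_iff:
  fixes A :: "int \<Rightarrow> real set"
  assumes "\<And>n t. t + 4 * real g \<in> A (n + 1) \<longleftrightarrow> t \<in> A n"
  shows "t + 4 * real g \<in> (\<Union>n. A n) \<longleftrightarrow> t \<in> (\<Union>n. A n)"
proof
  assume "t + 4 * real g \<in> (\<Union>n. A n)"
  then obtain n where "t + 4 * real g \<in> A n" by blast
  then have "t \<in> A (n - 1)" using assms[of t "n - 1"] by simp
  then show "t \<in> (\<Union>n. A n)" by blast
next
  assume "t \<in> (\<Union>n. A n)"
  then show "t + 4 * real g \<in> (\<Union>n. A n)" using assms by blast
qed

lemma patch_shift: "(r, t + 4 * real g) \<in> patch i \<longleftrightarrow> (r, t) \<in> patch i"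
proof (cases i)
  case (Sector \<theta>)
  show ?thesis unfolding Sector patch.simps mem_Times_iff fst_conv snd_conv
    by (subst UN_shift_iff) (auto simp: distrib_left)
next
  case Corner
  have "t + 4 * real g \<in> {of_int j - 1/4<..<of_int j + 1/4} \<longleftrightarrow>
      t \<in> {of_int (j - 4 * int g) - 1/4<..<of_int (j - 4 * int g) + 1/4}" for j :: int by auto
  then have "t + 4 * real g \<in> (\<Union>j::int. {of_int j - 1/4<..<of_int j + 1/4}) \<longleftrightarrow>
      (\<exists>j::int. t \<in> {of_int (j - 4 * int g) - 1/4<..<of_int (j - 4 * int g) + 1/4})" by blast
  also have "\<dots> \<longleftrightarrow> t \<in> (\<Union>j::int. {of_int j - 1/4<..<of_int j + 1/4})"
    by (metis (no_types, lifting) UN_iff UNIV_I add_diff_cancel_right')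
  finally show ?thesis unfolding Corner patch.simps mem_Times_iff fst_conv snd_conv by simp
next
  case (Edge k)
  show ?thesis unfolding Edge patch.simps mem_Times_iff fst_conv snd_conv Un_iff
    by (subst (1 2) UN_shift_iff) (auto simp: distrib_left)
qed simp

lemma patch_invariant: "glue_invariant g (\<lambda>a. a \<in> patch i)"
  unfolding glue_invariant_def
proof (intro conjI ballI allI)
  show "((0, t) \<in> patch i) = ((0, t') \<in> patch i)" for t t' by (cases i) auto
  show "((r, t + 4 * real g) \<in> patch i) = ((r, t) \<in> patch i)" for r t by (rule patch_shift)
  fix k and s :: real assume "s \<in> {0..1}"
  then have s: "0 \<le> s" "s \<le> 1" by auto
  show "((1, of_int k + s) \<in> patch i) = ((1, of_int (mate k) + 1 - s) \<in> patch i)"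
  proof (cases i)
    case Corner
    have "(1, of_int m + u) \<in> patch Corner \<longleftrightarrow> u < 1/4 \<or> u > 3/4" if u: "0 \<le> u" "u \<le> 1" for m :: int and u :: real
    proof
      assume "(1, of_int m + u) \<in> patch Corner"
      then obtain j :: int where "of_int m + u \<in> {of_int j - 1/4<..<of_int j + 1/4}" by auto
      then have b: "of_int j - 1/4 < of_int m + u" "of_int m + u < of_int j + 1/4" by auto
      then have "of_int j < (of_int (m + 2) :: real)" "(of_int (m - 1) :: real) < of_int j" using u by simp_all
      then have "j = m \<or> j = m + 1" by linarith
      then show "u < 1/4 \<or> u > 3/4" using b by auto
    next
      assume "u < 1/4 \<or> u > 3/4"
      then have "of_int m + u \<in> {of_int m - 1/4<..<of_int m + 1/4} \<or>
          of_int m + u \<in> {of_int (m + 1) - 1/4<..<of_int (m + 1) + 1/4}" using u by auto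
      then show "(1, of_int m + u) \<in> patch Corner" unfolding patch.simps by fastforce
    qed
    from this[OF s, of k] this[of "1 - s" "mate k"] show ?thesis using Corner s by (auto simp: algebra_simps)
  next
    case (Edge l)
    show ?thesis
    proof
      assume "(1, of_int k + s) \<in> patch i"
      then show "(1, of_int (mate k) + 1 - s) \<in> patch i" using patch_edge_opposite[OF s] Edge by blast
    next
      assume "(1, of_int (mate k) + 1 - s) \<in> patch i"
      then have "(1, of_int (mate k) + (1 - s)) \<in> patch (Edge l)" using Edge by (simp add: algebra_simps)
      from patch_edge_opposite[OF _ _ this] s show "(1, of_int k + s) \<in> patch i" using Edge by simp
    qed
  qed auto
qed

lemma patch_rep:
  assumes "x \<in> glue g ` patch i" shows "rep x \<in> patch i"
proof -
  have "x \<in> topspace S"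
    using assms openin_subset[OF glue_saturated_open(1)[OF g_pos openin_patch patch_invariant]] by blast
  then have "rep x \<in> {a \<in> strip. glue g a \<in> glue g ` patch i}" using rep assms by auto
  then show ?thesis using glue_saturated_open(2)[OF g_pos openin_patch patch_invariant] by simp
qed

lemma patch_cover: "topspace S \<subseteq> (\<Union>i\<in>UNIV. glue g ` patch i)"
proof
  fix x assume "x \<in> topspace S"
  then obtain a where a: "a \<in> strip" "glue g a = x" using glue_onto[OF g_pos] by metis
  obtain r t where rt: "a = (r, t)" by fastforce
  have "\<exists>i. a \<in> patch i"
  proof -
    have r: "0 \<le> r" "r \<le> 1" using a rt by auto
    consider "r < 1/2" | "1/2 \<le> r" "r < 1" | "r = 1" using r by linarith
    then show ?thesis
    proof cases
      case 1
      then have "a \<in> patch Disc" using r rt by simp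
      then show ?thesis by blast
    next
      case 2
      have "t \<in> {t + of_int (4 * int g * 0) - 1/8<..<t + of_int (4 * int g * 0) + 1/8}" by simp
      then have "a \<in> patch (Sector t)" using 2 rt unfolding patch.simps by fastforce
      then show ?thesis by blast
    next
      case 3
      define k where "k = \<lfloor>t\<rfloor>"
      have k: "of_int k \<le> t" "t < of_int k + 1" by (auto simp: k_def)
      consider "t < of_int k + 1/4" | "of_int k + 1/4 \<le> t" "t < of_int k + 5/8"
        | "of_int k + 5/8 \<le> t" "t < of_int k + 7/8" | "of_int k + 7/8 \<le> t" by linarith
      then show ?thesis
      proof cases
        case 1
        then have "t \<in> {of_int k - 1/4<..<of_int k + 1/4}" using k by simp
        then have "a \<in> patch Corner" using rt 3 unfolding patch.simps by fastforce
        then show ?thesis by blast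
      next
        case 2
        then have "t \<in> {of_int (k + 4 * int g * 0) + 1/8<..<of_int (k + 4 * int g * 0) + 5/8}" by simp
        then have "a \<in> patch (Edge k)" using rt 3 unfolding patch.simps by fastforce
        then show ?thesis by blast
      next
        case 3
        \<comment> \<open>The far part of edge \<open>k\<close> belongs to the patch named after its
          mate, in which edge \<open>k\<close> itself is the mate.\<close>
        then have "t \<in> {of_int (mate (mate k) + 4 * int g * 0) + 3/8<..<of_int (mate (mate k) + 4 * int g * 0) + 7/8}"
          by simp
        then have "a \<in> patch (Edge (mate k))" using rt \<open>r = 1\<close> unfolding patch.simps by fastforce
        then show ?thesis by blast
      next
        case 4
        then have "t \<in> {of_int (k + 1) - 1/4<..<of_int (k + 1) + 1/4}" using k by simp
        then have "a \<in> patch Corner" using rt 3 unfolding patch.simps by fastforce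
        then show ?thesis by blast
      qed
    qed
  qed
  then show "x \<in> (\<Union>i\<in>UNIV. glue g ` patch i)" using a(2) by blast
qed

end

text \<open>\<open>\<omega>\<close> labels the corners and \<open>\<gamma>\<close> the edges of the polygon; passing from an edge to its mate must have
  the same effect whether it is measured along the edges or at their common corner.\<close>

locale surface_labels = surface g x0 + K: group K
  for g :: nat and x0 :: "complex set" and K :: "'k monoid" (structure) +
  fixes \<omega> \<gamma> :: "int \<Rightarrow> 'k"
  assumes \<omega>_closed: "\<And>k. \<omega> k \<in> carrier K" and \<gamma>_closed: "\<And>k. \<gamma> k \<in> carrier K"
    and \<omega>_period: "\<And>k n. \<omega> (k + 4 * int g * n) = \<omega> k"
    and \<gamma>_period: "\<And>k n. \<gamma> (k + 4 * int g * n) = \<gamma> k"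
    and labels: "\<And>k. inv (\<omega> k) \<otimes> \<omega> (mate k + 1) = inv (\<gamma> k) \<otimes> \<gamma> (mate k)"
begin

primrec potential :: "patch_index \<Rightarrow> real \<times> real \<Rightarrow> 'k" where
  "potential Disc a = \<one>"
| "potential (Sector \<theta>) a = \<one>"
| "potential Corner a = \<omega> (round (snd a))"
| "potential (Edge k) a = \<gamma> \<lfloor>snd a\<rfloor>"

lemma potential_closed: "potential i a \<in> carrier K"
  by (cases i) (auto simp: \<omega>_closed \<gamma>_closed)

lemma sector_diff:
  assumes "(r, t) \<in> patch (Sector \<theta>)" "(r', t') \<in> patch (Sector \<theta>)"
  obtains n :: int where "\<bar>t' - t - of_int (4 * int g * n)\<bar> < 1/4"
proof -
  obtain m :: int where m: "t \<in> {\<theta> + of_int (4 * int g * m) - 1/8<..<\<theta> + of_int (4 * int g * m) + 1/8}"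
    using assms(1) by auto
  obtain m' :: int where m': "t' \<in> {\<theta> + of_int (4 * int g * m') - 1/8<..<\<theta> + of_int (4 * int g * m') + 1/8}"
    using assms(2) by auto
  have "of_int (4 * int g * (m' - m)) = (of_int (4 * int g * m') - of_int (4 * int g * m) :: real)"
    by (simp add: right_diff_distrib)
  then have "\<bar>t' - t - of_int (4 * int g * (m' - m))\<bar> < 1/4"
    using m m' unfolding greaterThanLessThan_iff by linarith
  then show ?thesis using that by blast
qed

text \<open>On a sector the nearest corner and the floor of the angle change only by the period.
  Where \<open>Corner\<close> meets \<open>Edge k\<close>, \<open>labels\<close> says that the
  corner label is the edge label times the constant left factor
  \<open>\<omega> k \<otimes> inv \<gamma> k\<close>, which cancels in ratios.\<close>

lemma potential_compatible:
  assumes "a \<in> patch i" "b \<in> patch i" "a \<in> patch j" "b \<in> patch j"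
  shows "inv potential i a \<otimes> potential i b = inv potential j a \<otimes> potential j b"
proof -
  obtain r t r' t' where ab: "a = (r, t)" "b = (r', t')" by fastforce
  have disc: False if "(r, t) \<in> patch Disc" "(r, t) \<in> patch Corner \<or> (r, t) \<in> patch (Edge k)" for k
    using that by auto
  have sector_corner: "\<omega> (round t) = \<omega> (round t')"
    if "(r, t) \<in> patch (Sector \<theta>)" "(r', t') \<in> patch (Sector \<theta>)" "(r, t) \<in> patch Corner" "(r', t') \<in> patch Corner" for \<theta>
  proof -
    obtain n :: int where n: "\<bar>t' - t - of_int (4 * int g * n)\<bar> < 1/4" using sector_diff \<open>(r, t) \<in> patch (Sector \<theta>)\<close> \<open>(r', t') \<in> patch (Sector \<theta>)\<close> .
    have "\<bar>of_int (round t' - (round t + 4 * int g * n)) :: real\<bar> < 1"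
      using n patch_corner_round[OF that(3)] patch_corner_round[OF that(4)]
      unfolding of_int_diff of_int_add by linarith
    then have "round t' = round t + 4 * int g * n" by linarith
    then show ?thesis by (simp add: \<omega>_period)
  qed
  have sector_edge: "\<gamma> \<lfloor>t\<rfloor> = \<gamma> \<lfloor>t'\<rfloor>"
    if "(r, t) \<in> patch (Sector \<theta>)" "(r', t') \<in> patch (Sector \<theta>)" "(r, t) \<in> patch (Edge k)" "(r', t') \<in> patch (Edge k)" for \<theta> k
  proof -
    obtain n :: int where n: "\<bar>t' - t - of_int (4 * int g * n)\<bar> < 1/4" using sector_diff \<open>(r, t) \<in> patch (Sector \<theta>)\<close> \<open>(r', t') \<in> patch (Sector \<theta>)\<close> .
    have b: "of_int \<lfloor>u\<rfloor> + 1/8 < u \<and> u < of_int \<lfloor>u\<rfloor> + 7/8" if "(q, u) \<in> patch (Edge k)" for q u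
      using that by (cases rule: patch_edge_cases) auto
    \<comment> \<open>Offsets between 1/8 and 7/8 differ by less than 3/4, and the sector
      contributes less than 1/4: the total stays below 1, which forces the integers to
      agree.\<close>
    have "\<bar>of_int (\<lfloor>t'\<rfloor> - (\<lfloor>t\<rfloor> + 4 * int g * n)) :: real\<bar> < 1"
      using n b[OF that(3)] b[OF that(4)] unfolding of_int_diff of_int_add by linarith
    then have "\<lfloor>t'\<rfloor> = \<lfloor>t\<rfloor> + 4 * int g * n" by linarith
    then show ?thesis by (simp add: \<gamma>_period)
  qed
  have corner_edge: "\<omega> (round u) = (\<omega> k \<otimes> inv \<gamma> k) \<otimes> \<gamma> \<lfloor>u\<rfloor>"
    if c: "(q, u) \<in> patch Corner" and e: "(q, u) \<in> patch (Edge k)" for q u k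
    using e
  proof (cases rule: patch_edge_cases)
    case (1 n)
    then have "\<bar>of_int (round u - \<lfloor>u\<rfloor>) :: real\<bar> < 1"
      using patch_corner_round[OF c] unfolding of_int_diff by linarith
    then have "round u = \<lfloor>u\<rfloor>" by linarith
    then show ?thesis using 1 by (simp add: \<omega>_period \<gamma>_period \<omega>_closed \<gamma>_closed K.m_assoc)
  next
    case (2 n)
    then have "\<bar>of_int (round u - (\<lfloor>u\<rfloor> + 1)) :: real\<bar> < 1"
      using patch_corner_round[OF c] unfolding of_int_diff of_int_add by linarith
    then have "round u = (mate k + 1) + 4 * int g * n" using 2 by linarith
    then have "\<omega> (round u) = \<omega> (mate k + 1)" by (simp only: \<omega>_period)
    also have "\<dots> = \<omega> k \<otimes> (inv \<omega> k \<otimes> \<omega> (mate k + 1))"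
      by (simp add: \<omega>_closed flip: K.m_assoc)
    also have "\<dots> = (\<omega> k \<otimes> inv \<gamma> k) \<otimes> \<gamma> (mate k)"
      unfolding labels by (simp add: \<omega>_closed \<gamma>_closed K.m_assoc)
    finally show ?thesis using 2 by (simp add: \<gamma>_period)
  qed
  have ce: "inv \<omega> (round t) \<otimes> \<omega> (round t') = inv \<gamma> \<lfloor>t\<rfloor> \<otimes> \<gamma> \<lfloor>t'\<rfloor>"
    if "(r, t) \<in> patch Corner" "(r', t') \<in> patch Corner" "(r, t) \<in> patch (Edge k)" "(r', t') \<in> patch (Edge k)" for k
    using corner_edge[OF that(1,3)] corner_edge[OF that(2,4)]
    by (simp add: K.ratio_translate \<omega>_closed \<gamma>_closed)
  note assms' = assms[unfolded ab]
  show ?thesis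
    unfolding ab
  proof (cases i; cases j)
    fix \<theta> assume "i = Sector \<theta>" "j = Corner"
    then show "inv potential i (r, t) \<otimes> potential i (r', t') = inv potential j (r, t) \<otimes> potential j (r', t')"
      using sector_corner[of \<theta>] assms' by (simp del: patch.simps add: \<omega>_closed)
  next
    fix \<theta> assume "i = Corner" "j = Sector \<theta>"
    then show "inv potential i (r, t) \<otimes> potential i (r', t') = inv potential j (r, t) \<otimes> potential j (r', t')"
      using sector_corner[of \<theta>] assms' by (simp del: patch.simps add: \<omega>_closed)
  next
    fix \<theta> k assume "i = Sector \<theta>" "j = Edge k"
    then show "inv potential i (r, t) \<otimes> potential i (r', t') = inv potential j (r, t) \<otimes> potential j (r', t')"
      using sector_edge[of \<theta> k] assms' by (simp del: patch.simps add: \<gamma>_closed)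
  next
    fix \<theta> k assume "i = Edge k" "j = Sector \<theta>"
    then show "inv potential i (r, t) \<otimes> potential i (r', t') = inv potential j (r, t) \<otimes> potential j (r', t')"
      using sector_edge[of \<theta> k] assms' by (simp del: patch.simps add: \<gamma>_closed)
  qed (use assms' disc ce in \<open>force simp del: patch.simps\<close>)+
qed

text \<open>A patch contains every strip representative of its points, and compatibility was shown
  for arbitrary points of the patches, so the potentials may be read at the chosen
  \<open>rep x\<close>.\<close>

sublocale flat_cocycle K "genus_surface g" UNIV "\<lambda>i. glue g ` patch i" "\<lambda>i x. potential i (rep x)"
proof
  show "openin S (glue g ` patch i)" for i
    by (rule glue_saturated_open(1)[OF g_pos openin_patch patch_invariant])
  show "topspace S \<subseteq> (\<Union>i\<in>UNIV. glue g ` patch i)" by (rule patch_cover)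
  show "potential i (rep x) \<in> carrier K" for i x by (rule potential_closed)
  show "inv potential i (rep x) \<otimes> potential i (rep y) = inv potential j (rep x) \<otimes> potential j (rep y)"
    if "x \<in> glue g ` patch i" "y \<in> glue g ` patch i" "x \<in> glue g ` patch j" "y \<in> glue g ` patch j" for i j x y
    using that by (intro potential_compatible patch_rep)
qed

text \<open>Along the radius the cocycle is trivial until the boundary is reached. At the boundary
  the label jumps from that of corner \<open>j\<close> to that of the chosen representative of the
  vertex, which is the same for all \<open>j\<close>.\<close>

lemma hol_rad_corner:
  "hol (rad (1, of_int j)) = inv \<omega> j \<otimes> \<omega> (round (snd (rep (glue g (1, of_int 0)))))"
proof -
  define \<mu> where "\<mu> = \<omega> (round (snd (rep (glue g (1, of_int 0)))))"
  have \<mu>: "\<mu> \<in> carrier K" by (simp add: \<mu>_def \<omega>_closed)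
  \<comment> \<open>A potential along the radius with its only jump at the end point.\<close>
  define u where "u = (\<lambda>s::real. if s < 1 then \<one> else inv \<omega> j \<otimes> \<mu>)"
  have p: "rad (1, of_int j) s = glue g (s, of_int j)" for s by (simp add: rad_def)
  have inner: "\<omega> (round (snd (rep (glue g (s, of_int j))))) = \<omega> j" if s: "0 < s" "s < 1" for s
  proof -
    let ?\<Phi> = "\<lambda>a. if 0 < fst a \<and> fst a < 1 then Some (\<omega> (round (snd a))) else None"
    have inv: "glue_invariant g ?\<Phi>"
      unfolding glue_invariant_def using \<omega>_period[of _ 1] by (auto simp: round_shift)
    have st: "(s, real_of_int j) \<in> strip" using s by simp
    note r = rep[OF glue_in_topspace[OF g_pos st]]
    from glue_invariantD[OF g_pos inv r(1) st r(2)] show ?thesis using s by (auto split: if_splits)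
  qed
  have "hol (rad (1, of_int j)) = inv u 0 \<otimes> u 1"
  proof (rule hol_ratio[where \<epsilon> = "1/4"])
    show "pathin S (rad (1, of_int j))" by (rule pathin_rad) simp
    show "u t \<in> carrier K" for t using \<mu> by (simp add: u_def \<omega>_closed)
    fix s t :: real assume st: "s \<in> {0..1}" "t \<in> {0..1}" "s \<le> t" "t - s < 1/4"
    \<comment> \<open>With \<open>t - s < 1/4\<close> both parameters lie in \<open>Disc\<close>, or
      both are positive and below 1 and lie in the sector at angle \<open>j\<close>, or
      \<open>t = 1\<close> and both exceed 1/2 and lie in \<open>Corner\<close>.\<close>
    consider "t < 1/2" | "1/2 \<le> t" "t < 1" | "t = 1" using st by fastforce
    then show "c (rad (1, of_int j) s) (rad (1, of_int j) t) = inv u s \<otimes> u t"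
    proof cases
      case 1
      then have "c (glue g (s, of_int j)) (glue g (t, of_int j)) = inv \<one> \<otimes> \<one>"
        using st by (subst c_eq[of Disc]) auto
      then show ?thesis using 1 st by (simp add: p u_def)
    next
      case 2
      have "of_int j \<in> {real_of_int j + of_int (4 * int g * 0) - 1/8<..<of_int j + of_int (4 * int g * 0) + 1/8}" by simp
      then have m: "(q, real_of_int j) \<in> patch (Sector (of_int j))" if "0 < q" "q < 1" for q
        using that unfolding patch.simps by fastforce
      have "c (glue g (s, of_int j)) (glue g (t, of_int j)) = inv \<one> \<otimes> \<one>"
        using 2 st by (subst c_eq[of "Sector (of_int j)"]) (auto simp del: patch.simps intro!: imageI m)
      then show ?thesis using 2 st by (simp add: p u_def)
    next
      case 3
      have "of_int j \<in> {real_of_int j - 1/4<..<of_int j + 1/4}" by simp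
      then have m: "(q, real_of_int j) \<in> patch Corner" if "1/2 < q" "q \<le> 1" for q
        using that unfolding patch.simps by fastforce
      have e: "c (glue g (s, of_int j)) (glue g (t, of_int j)) =
          inv \<omega> (round (snd (rep (glue g (s, of_int j))))) \<otimes> \<omega> (round (snd (rep (glue g (t, of_int j)))))"
        using 3 st by (subst c_eq[of Corner]) (auto simp del: patch.simps intro!: imageI m)
      have t: "\<omega> (round (snd (rep (glue g (t, of_int j))))) = \<mu>"
        unfolding \<mu>_def 3 using glue_corner[of j 0] by simp
      show ?thesis
      proof (cases "s < 1")
        case True
        then show ?thesis using e t inner[of s] 3 st \<mu> by (simp add: p u_def \<omega>_closed)
      next
        case False
        then have "s = t" using 3 st by simp
        then show ?thesis using e t 3 \<mu> by (simp add: p u_def \<omega>_closed)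
      qed
    qed
  qed simp
  then show ?thesis unfolding \<mu>_def[symmetric] using \<mu> by (simp add: u_def \<omega>_closed)
qed

lemma monodromy_\<kappa>:
  assumes "pathin S p"
  shows "monodromy (\<kappa> p) = hol (spoke_path (p 0)) \<otimes> hol p \<otimes> inv hol (spoke_path (p 1))"
proof -
  have T: "p 0 \<in> topspace S" "p 1 \<in> topspace S" using pathin_in_topspace[OF assms] by auto
  have "monodromy (\<kappa> p) = hol (loop_concat (loop_concat (spoke_path (p 0)) p) (reverse_path (spoke_path (p 1))))"
    unfolding \<kappa>_def by (rule monodromy_loop_class[OF conjugate_loop[OF assms]])
  then show ?thesis
    using T spoke assms by (simp add: hol_concat pathin_concat hol_reverse)
qed

text \<open>In \<open>gen k\<close> the vertex label \<mu> and the holonomy \<open>d\<close> of the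
  spoke to the vertex cancel. The holonomy \<open>e\<close> of the spoke to the centre survives as a
  conjugation, which is undone by conjugating the monodromy back.\<close>

lemma hom_exists: "\<exists>h \<in> hom \<pi> K. \<forall>k. h (gen k) = inv \<omega> k \<otimes> \<omega> (mate k + 1)"
proof -
  define e where "e = hol (spoke_path (glue g (0, 0)))"
  define d where "d = hol (spoke_path (glue g (1, of_int 0)))"
  define \<mu> where "\<mu> = \<omega> (round (snd (rep (glue g (1, of_int 0)))))"
  have "glue g (0, 0) \<in> topspace S" "glue g (1, of_int 0) \<in> topspace S"
    using glue_in_topspace[OF g_pos] by auto
  then have cl: "e \<in> carrier K" "d \<in> carrier K" "\<mu> \<in> carrier K"
    unfolding e_def d_def \<mu>_def using spoke(1) hol_closed \<omega>_closed by auto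
  have v: "monodromy (v (1, of_int j)) = e \<otimes> (inv \<omega> j \<otimes> \<mu>) \<otimes> inv d" for j :: int
  proof -
    have "pathin S (rad (1, of_int j))" by (rule pathin_rad) simp
    then show ?thesis
      unfolding v_def using glue_corner[of j 0]
      by (simp add: monodromy_\<kappa> hol_rad_corner rad_endpoints e_def d_def \<mu>_def)
  qed
  interpret M: group_hom \<pi> K monodromy
    by unfold_locales (rule monodromy_hom)
  have gen: "monodromy (gen k) = e \<otimes> (inv \<omega> k \<otimes> \<omega> (mate k + 1)) \<otimes> inv e" for k
  proof -
    have "monodromy (gen k) = monodromy (v (1, of_int k)) \<otimes> inv monodromy (v (1, of_int (mate k + 1)))"
      by (simp add: gen_def)
    also have "\<dots> = (e \<otimes> (inv \<omega> k \<otimes> \<mu>) \<otimes> inv d) \<otimes> inv (e \<otimes> (inv \<omega> (mate k + 1) \<otimes> \<mu>) \<otimes> inv d)"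
      by (simp only: v)
    also have "\<dots> = e \<otimes> (inv \<omega> k \<otimes> (\<mu> \<otimes> (inv d \<otimes> (d \<otimes> (inv \<mu> \<otimes> (\<omega> (mate k + 1) \<otimes> inv e))))))"
      using cl \<omega>_closed by (simp add: K.inv_mult_group K.m_assoc)
    also have "inv d \<otimes> (d \<otimes> (inv \<mu> \<otimes> (\<omega> (mate k + 1) \<otimes> inv e))) = inv \<mu> \<otimes> (\<omega> (mate k + 1) \<otimes> inv e)"
      using cl \<omega>_closed by (simp flip: K.m_assoc)
    also have "\<mu> \<otimes> \<dots> = \<omega> (mate k + 1) \<otimes> inv e"
      using cl \<omega>_closed by (simp flip: K.m_assoc)
    finally show ?thesis using cl \<omega>_closed by (simp add: K.m_assoc)
  qed
  define h where "h = (\<lambda>C. inv e \<otimes> monodromy C \<otimes> e)"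
  have "h \<in> hom \<pi> K"
  proof (rule homI)
    fix C D assume C: "C \<in> carrier \<pi>" and D: "D \<in> carrier \<pi>"
    have m: "monodromy C \<in> carrier K" "monodromy D \<in> carrier K" using C D by simp_all
    show "h C \<in> carrier K" using cl m by (simp add: h_def)
    have "h C \<otimes> h D = inv e \<otimes> (monodromy C \<otimes> (e \<otimes> (inv e \<otimes> (monodromy D \<otimes> e))))"
      using cl m by (simp add: h_def K.m_assoc)
    also have "e \<otimes> (inv e \<otimes> (monodromy D \<otimes> e)) = monodromy D \<otimes> e"
      using cl m by (simp flip: K.m_assoc)
    finally show "h (C \<otimes>\<^bsub>\<pi>\<^esub> D) = h C \<otimes> h D" using C D cl m by (simp add: h_def K.m_assoc)
  qed
  moreover have "h (gen k) = inv \<omega> k \<otimes> \<omega> (mate k + 1)" for k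
  proof -
    define x where "x = inv \<omega> k \<otimes> \<omega> (mate k + 1)"
    have x: "x \<in> carrier K" by (simp add: x_def \<omega>_closed)
    have "h (gen k) = inv e \<otimes> (e \<otimes> (x \<otimes> (inv e \<otimes> e)))"
      using cl x by (simp add: h_def gen flip: x_def) (simp add: K.m_assoc)
    also have "\<dots> = x" using cl x by (simp flip: K.m_assoc)
    finally show ?thesis by (simp add: x_def)
  qed
  ultimately show ?thesis by blast
qed

end

section \<open>Presentation of surface groups\<close>

text \<open>The factors have the form \<open>a b\<inverse> a\<inverse> b\<close> because the generators are dual to the edges: they
  cross the glued pairs of edges instead of running along them.\<close>

primrec surface_relator :: "('k, 'm) monoid_scheme \<Rightarrow> (nat \<Rightarrow> 'k) \<Rightarrow> (nat \<Rightarrow> 'k) \<Rightarrow> nat \<Rightarrow> 'k" where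
  "surface_relator K a b 0 = \<one>\<^bsub>K\<^esub>"
| "surface_relator K a b (Suc j) = surface_relator K a b j \<otimes>\<^bsub>K\<^esub>
     (a j \<otimes>\<^bsub>K\<^esub> inv\<^bsub>K\<^esub> b j \<otimes>\<^bsub>K\<^esub> inv\<^bsub>K\<^esub> a j \<otimes>\<^bsub>K\<^esub> b j)"

lemma (in group) surface_relator_closed:
  assumes "\<And>j. j < n \<Longrightarrow> a j \<in> carrier G" "\<And>j. j < n \<Longrightarrow> b j \<in> carrier G"
  shows "surface_relator G a b n \<in> carrier G"
  using assms by (induction n) auto

lemma (in group_hom) hom_surface_relator:
  assumes "\<And>j. j < n \<Longrightarrow> a j \<in> carrier G" "\<And>j. j < n \<Longrightarrow> b j \<in> carrier G"
  shows "h (surface_relator G a b n) = surface_relator H (\<lambda>j. h (a j)) (\<lambda>j. h (b j)) n"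
  using assms
proof (induction n)
  case (Suc n)
  have "surface_relator G a b n \<in> carrier G" using Suc.prems by (intro G.surface_relator_closed) auto
  then show ?case using Suc by simp
qed simp

context surface
begin

lemma corner_step: "inv\<^bsub>\<pi>\<^esub> v (1, of_int (mate k + 1)) = inv\<^bsub>\<pi>\<^esub> v (1, of_int k) \<otimes>\<^bsub>\<pi>\<^esub> gen k"
  by (simp add: gen_def flip: \<pi>.m_assoc)

text \<open>Following the identified corners around the vertex, in the order \<open>4 * n\<close>,
  \<open>4 * n + 3\<close>, \<open>4 * n + 2\<close>, \<open>4 * n + 1\<close>,
  \<open>4 * n + 4\<close>, multiplies \<open>w\<close> by one generator per step and by one factor
  of the relator per block. After \<open>g\<close> blocks the period brings \<open>w\<close> back to
  its start.\<close>

lemma relator_gen: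
  "surface_relator \<pi> (\<lambda>j. gen (4 * int j)) (\<lambda>j. gen (4 * int j + 1)) g = \<one>\<^bsub>\<pi>\<^esub>"
proof -
  let ?R = "surface_relator \<pi> (\<lambda>j. gen (4 * int j)) (\<lambda>j. gen (4 * int j + 1))"
  define w where "w = (\<lambda>k::int. inv\<^bsub>\<pi>\<^esub> v (1, of_int k))"
  have w: "w k \<in> carrier \<pi>" for k by (simp add: w_def)
  have R: "?R n \<in> carrier \<pi>" for n by (intro \<pi>.surface_relator_closed) auto
  have "w (4 * int n) = w 0 \<otimes>\<^bsub>\<pi>\<^esub> ?R n" for n
  proof (induction n)
    case (Suc n)
    let ?k = "4 * int n"
    have g: "gen (?k + 2) = inv\<^bsub>\<pi>\<^esub> gen ?k" "gen (?k + 3) = inv\<^bsub>\<pi>\<^esub> gen (?k + 1)"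
      using gen_mate[of ?k] gen_mate[of "?k + 1"] by simp_all
    have s: "w (?k + 3) = w ?k \<otimes>\<^bsub>\<pi>\<^esub> gen ?k" "w (?k + 2) = w (?k + 3) \<otimes>\<^bsub>\<pi>\<^esub> gen (?k + 3)"
      "w (?k + 1) = w (?k + 2) \<otimes>\<^bsub>\<pi>\<^esub> gen (?k + 2)" "w (?k + 4) = w (?k + 1) \<otimes>\<^bsub>\<pi>\<^esub> gen (?k + 1)"
      using corner_step[of ?k] corner_step[of "?k + 3"] corner_step[of "?k + 2"] corner_step[of "?k + 1"]
      unfolding mate_4 w_def by (simp_all add: algebra_simps)
    have "w (4 * int (Suc n)) = w (?k + 4)" by (simp add: algebra_simps)
    also have "\<dots> = w ?k \<otimes>\<^bsub>\<pi>\<^esub> (gen ?k \<otimes>\<^bsub>\<pi>\<^esub> inv\<^bsub>\<pi>\<^esub> gen (?k + 1) \<otimes>\<^bsub>\<pi>\<^esub> inv\<^bsub>\<pi>\<^esub> gen ?k \<otimes>\<^bsub>\<pi>\<^esub> gen (?k + 1))"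
      unfolding s g using w by (simp add: \<pi>.m_assoc)
    finally show ?case using Suc w R by (simp add: \<pi>.m_assoc)
  qed (simp add: w)
  moreover have "w (4 * int g) = w 0" using v_period_corner[of 0 1] by (simp add: w_def)
  ultimately have "w 0 = w 0 \<otimes>\<^bsub>\<pi>\<^esub> ?R g" by metis
  then show ?thesis using w R by (metis \<pi>.l_cancel_one)
qed

lemma generate_gen_pairs:
  "generate \<pi> ((\<lambda>j. gen (4 * int j)) ` {..<g} \<union> (\<lambda>j. gen (4 * int j + 1)) ` {..<g}) = carrier \<pi>"
proof -
  have "gen ` {k. 0 \<le> k \<and> k < 4 * int g \<and> k mod 4 < 2}
      \<subseteq> (\<lambda>j. gen (4 * int j)) ` {..<g} \<union> (\<lambda>j. gen (4 * int j + 1)) ` {..<g}"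
  proof
    fix x assume "x \<in> gen ` {k. 0 \<le> k \<and> k < 4 * int g \<and> k mod 4 < 2}"
    then obtain k where k: "x = gen k" "0 \<le> k" "k < 4 * int g" "k mod 4 < 2" by auto
    define j where "j = nat (k div 4)"
    have "k mod 4 = 0 \<or> k mod 4 = 1" using k(4) pos_mod_sign[of 4 k] by linarith
    moreover have "int j = k div 4" "j < g" using k by (auto simp: j_def)
    ultimately have "k = 4 * int j \<or> k = 4 * int j + 1" using div_mult_mod_eq[of k 4] by linarith
    then show "x \<in> (\<lambda>j. gen (4 * int j)) ` {..<g} \<union> (\<lambda>j. gen (4 * int j + 1)) ` {..<g}"
      using k(1) \<open>j < g\<close> by auto
  qed
  then have "carrier \<pi> \<subseteq> generate \<pi> ((\<lambda>j. gen (4 * int j)) ` {..<g} \<union> (\<lambda>j. gen (4 * int j + 1)) ` {..<g})"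
    using \<pi>.mono_generate unfolding generate_gen[symmetric] by blast
  moreover have "(\<lambda>j. gen (4 * int j)) ` {..<g} \<union> (\<lambda>j. gen (4 * int j + 1)) ` {..<g} \<subseteq> carrier \<pi>" by auto
  ultimately show ?thesis using \<pi>.generate_incl by blast
qed

text \<open>The corner labels are the partial products of the relator met on the way around the
  vertex. They are consistent with the period precisely because the full product is trivial.\<close>

lemma hom_from_relator:
  fixes K :: "'k monoid"
  assumes K: "group K" and ab: "\<And>j. a j \<in> carrier K" "\<And>j. b j \<in> carrier K"
    and rel: "surface_relator K a b g = \<one>\<^bsub>K\<^esub>"
  shows "\<exists>h\<in>hom \<pi> K. \<forall>j<g. h (gen (4 * int j)) = a j \<and> h (gen (4 * int j + 1)) = b j"
proof -
  interpret K: group K by fact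
  define idx where "idx = (\<lambda>k. nat ((k mod (4 * int g)) div 4))"
  define R where "R = surface_relator K a b"
  \<comment> \<open>The corners of block \<open>j\<close> are visited in the order 0, 3, 2, 1, which
    gives the prefixes 1, \<open>a\<close>, \<open>a b\<inverse>\<close>,
    \<open>a b\<inverse> a\<inverse>\<close> of the factor
    \<open>a b\<inverse> a\<inverse> b\<close>.\<close>
  define \<omega> where "\<omega> = (\<lambda>k::int. R (idx k) \<otimes>\<^bsub>K\<^esub>
     (if k mod 4 = 0 then \<one>\<^bsub>K\<^esub>
      else if k mod 4 = 1 then a (idx k) \<otimes>\<^bsub>K\<^esub> inv\<^bsub>K\<^esub> b (idx k) \<otimes>\<^bsub>K\<^esub> inv\<^bsub>K\<^esub> a (idx k)
      else if k mod 4 = 2 then a (idx k) \<otimes>\<^bsub>K\<^esub> inv\<^bsub>K\<^esub> b (idx k)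
      else a (idx k)))"
  \<comment> \<open>Normalised to be trivial on the first edge of each pair, so that the ratio
    across the pair is the prescribed image.\<close>
  define \<gamma> where "\<gamma> = (\<lambda>k::int. if k mod 4 < 2 then \<one>\<^bsub>K\<^esub> else if k mod 4 = 2 then a (idx k) else b (idx k))"
  have R: "R n \<in> carrier K" for n unfolding R_def by (intro K.surface_relator_closed ab)
  have idx_period: "idx (k + 4 * int g * n) = idx k" for k n by (simp add: idx_def)
  have mod_period: "(k + 4 * int g * n) mod 4 = k mod 4" for k n by (simp add: mult.assoc)
  have idx: "idx (4 * int j + i) = j" if "j < g" "0 \<le> i" "i < 4" for j i
  proof -
    have "(4 * int j + i) mod (4 * int g) = 4 * int j + i" using that by (intro mod_pos_pos_trivial) auto
    then show ?thesis using that by (simp add: idx_def)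
  qed
  \<comment> \<open>The case \<open>j = g\<close> is the wrap-around: the index returns to 0, and
    \<open>rel\<close> identifies \<open>R g\<close> with \<open>R 0\<close>.\<close>
  have \<omega>_0: "\<omega> (4 * int j) = R j" if "j \<le> g" for j
  proof (cases "j < g")
    case True
    then show ?thesis using idx[of j 0] R by (simp add: \<omega>_def)
  next
    case False
    then show ?thesis using that rel R g_pos by (simp add: \<omega>_def idx_def R_def)
  qed
  have \<omega>_i: "\<omega> (4 * int j + 1) = R j \<otimes>\<^bsub>K\<^esub> (a j \<otimes>\<^bsub>K\<^esub> inv\<^bsub>K\<^esub> b j \<otimes>\<^bsub>K\<^esub> inv\<^bsub>K\<^esub> a j)"
    "\<omega> (4 * int j + 2) = R j \<otimes>\<^bsub>K\<^esub> (a j \<otimes>\<^bsub>K\<^esub> inv\<^bsub>K\<^esub> b j)" "\<omega> (4 * int j + 3) = R j \<otimes>\<^bsub>K\<^esub> a j"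
    if "j < g" for j
    using idx[OF that, of 1] idx[OF that, of 2] idx[OF that, of 3] by (simp_all add: \<omega>_def)
  have \<gamma>_i: "\<gamma> (4 * int j) = \<one>\<^bsub>K\<^esub>" "\<gamma> (4 * int j + 1) = \<one>\<^bsub>K\<^esub>" "\<gamma> (4 * int j + 2) = a j" "\<gamma> (4 * int j + 3) = b j"
    if "j < g" for j
    using idx[OF that, of 0] idx[OF that, of 1] idx[OF that, of 2] idx[OF that, of 3] by (simp_all add: \<gamma>_def)
  have \<omega>_4: "\<omega> (4 * int j + 4) = R j \<otimes>\<^bsub>K\<^esub> (a j \<otimes>\<^bsub>K\<^esub> inv\<^bsub>K\<^esub> b j \<otimes>\<^bsub>K\<^esub> inv\<^bsub>K\<^esub> a j \<otimes>\<^bsub>K\<^esub> b j)" if "j < g" for j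
    using \<omega>_0[of "Suc j"] that by (simp add: R_def algebra_simps)
  have cancel: "inv\<^bsub>K\<^esub> x \<otimes>\<^bsub>K\<^esub> (x \<otimes>\<^bsub>K\<^esub> y) = y" "x \<otimes>\<^bsub>K\<^esub> (inv\<^bsub>K\<^esub> x \<otimes>\<^bsub>K\<^esub> y) = y" if "x \<in> carrier K" "y \<in> carrier K" for x y
    using that by (simp_all flip: K.m_assoc)
  have base: "inv\<^bsub>K\<^esub> \<omega> k \<otimes>\<^bsub>K\<^esub> \<omega> (mate k + 1) = inv\<^bsub>K\<^esub> \<gamma> k \<otimes>\<^bsub>K\<^esub> \<gamma> (mate k)"
    if k: "0 \<le> k" "k < 4 * int g" for k
  proof -
    define j where "j = nat (k div 4)"
    have j: "int j = k div 4" "j < g" using k by (auto simp: j_def)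
    have "k = 4 * int j + k mod 4" using j(1) by simp
    moreover have "k mod 4 \<in> {0, 1, 2, 3}" by auto
    ultimately consider "k = 4 * int j" | "k = 4 * int j + 1" | "k = 4 * int j + 2" | "k = 4 * int j + 3"
      by fastforce
    then show ?thesis
    proof cases
      case 1
      then have e: "mate k + 1 = 4 * int j + 3" "mate k = 4 * int j + 2" by simp_all
      show ?thesis unfolding e(1) unfolding e(2) unfolding 1 \<omega>_0[OF less_imp_le[OF j(2)]] \<omega>_i[OF j(2)] \<gamma>_i[OF j(2)]
        using R ab by (simp add: K.inv_mult_group K.m_assoc cancel)
    next
      case 2
      then have e: "mate k + 1 = 4 * int j + 4" "mate k = 4 * int j + 3" by simp_all
      show ?thesis unfolding e(1) unfolding e(2) unfolding 2 \<omega>_4[OF j(2)] \<omega>_i[OF j(2)] \<gamma>_i[OF j(2)]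
        using R ab by (simp add: K.inv_mult_group K.m_assoc cancel)
    next
      case 3
      then have e: "mate k + 1 = 4 * int j + 1" "mate k = 4 * int j" by simp_all
      show ?thesis unfolding e(1) unfolding e(2) unfolding 3 \<omega>_i[OF j(2)] \<gamma>_i[OF j(2)]
        using R ab by (simp add: K.inv_mult_group K.m_assoc cancel)
    next
      case 4
      then have e: "mate k + 1 = 4 * int j + 2" "mate k = 4 * int j + 1" by simp_all
      show ?thesis unfolding e(1) unfolding e(2) unfolding 4 \<omega>_i[OF j(2)] \<gamma>_i[OF j(2)]
        using R ab by (simp add: K.inv_mult_group K.m_assoc cancel)
    qed
  qed
  have \<omega>_period: "\<omega> (k + 4 * int g * n) = \<omega> k" and \<gamma>_period: "\<gamma> (k + 4 * int g * n) = \<gamma> k" for k n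
    unfolding \<omega>_def \<gamma>_def idx_period mod_period by simp_all
  interpret L: surface_labels g x0 K \<omega> \<gamma>
  proof
    show "\<omega> k \<in> carrier K" "\<gamma> k \<in> carrier K" for k using R ab by (auto simp: \<omega>_def \<gamma>_def)
    show "\<omega> (k + 4 * int g * n) = \<omega> k" "\<gamma> (k + 4 * int g * n) = \<gamma> k" for k n
      by (rule \<omega>_period, rule \<gamma>_period)
    fix k
    define m n where "m = k mod (4 * int g)" and "n = k div (4 * int g)"
    have k: "k = m + 4 * int g * n" by (simp add: m_def n_def)
    have m: "0 \<le> m" "m < 4 * int g" using g_pos by (auto simp: m_def)
    have "mate k + 1 = (mate m + 1) + 4 * int g * n" "mate k = mate m + 4 * int g * n"
      unfolding k mate_shift by simp_all
    then have "\<omega> k = \<omega> m" "\<gamma> k = \<gamma> m" "\<omega> (mate k + 1) = \<omega> (mate m + 1)" "\<gamma> (mate k) = \<gamma> (mate m)"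
      using \<omega>_period \<gamma>_period k by metis+
    then show "inv\<^bsub>K\<^esub> \<omega> k \<otimes>\<^bsub>K\<^esub> \<omega> (mate k + 1) = inv\<^bsub>K\<^esub> \<gamma> k \<otimes>\<^bsub>K\<^esub> \<gamma> (mate k)" using base[OF m] by simp
  qed
  obtain h where h: "h \<in> hom \<pi> K" "\<And>k. h (gen k) = inv\<^bsub>K\<^esub> \<omega> k \<otimes>\<^bsub>K\<^esub> \<omega> (mate k + 1)"
    using L.hom_exists by blast
  have "h (gen (4 * int j)) = a j \<and> h (gen (4 * int j + 1)) = b j" if "j < g" for j
  proof -
    have "h (gen (4 * int j)) = inv\<^bsub>K\<^esub> \<gamma> (4 * int j) \<otimes>\<^bsub>K\<^esub> \<gamma> (4 * int j + 2)"
      using h(2)[of "4 * int j"] L.labels[of "4 * int j"] by simp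
    moreover have "h (gen (4 * int j + 1)) = inv\<^bsub>K\<^esub> \<gamma> (4 * int j + 1) \<otimes>\<^bsub>K\<^esub> \<gamma> (4 * int j + 3)"
      using h(2)[of "4 * int j + 1"] L.labels[of "4 * int j + 1"] by simp
    ultimately show ?thesis using \<gamma>_i[OF that] ab by simp
  qed
  then show ?thesis using h(1) by blast
qed

end

text \<open>The presentation is expressed by its mapping property rather than by a quotient of a
  free group. The type of the target is a parameter, to be instantiated with the type of the
  Heisenberg-twisted group.\<close>

theorem surface_group_presentation:
  fixes G :: "'a monoid"
  assumes "surface_group_of_genus g G"
  obtains a b where "range a \<subseteq> carrier G" "range b \<subseteq> carrier G"
    "generate G (a ` {..<g} \<union> b ` {..<g}) = carrier G" "surface_relator G a b g = \<one>\<^bsub>G\<^esub>"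
    "\<And>(K :: 'k monoid) \<alpha> \<beta>. \<lbrakk>group K; range \<alpha> \<subseteq> carrier K; range \<beta> \<subseteq> carrier K;
        surface_relator K \<alpha> \<beta> g = \<one>\<^bsub>K\<^esub>\<rbrakk> \<Longrightarrow> \<exists>h\<in>hom G K. \<forall>j<g. h (a j) = \<alpha> j \<and> h (b j) = \<beta> j"
proof -
  obtain x where "group G" "g \<ge> 2" "x \<in> topspace (genus_surface g)"
    and iso: "G \<cong> fundamental_group (genus_surface g) x"
    using assms unfolding surface_group_of_genus_def by blast
  interpret G: group G by fact
  interpret surface g x by unfold_locales (use \<open>g \<ge> 2\<close> \<open>x \<in> _\<close> in auto)
  obtain \<theta> where \<theta>: "\<theta> \<in> iso G \<pi>" using iso by (auto simp: is_iso_def)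
  define \<theta>' where "\<theta>' = inv_into (carrier G) \<theta>"
  have \<theta>': "\<theta>' \<in> iso \<pi> G" unfolding \<theta>'_def using G.iso_set_sym[OF \<theta>] .
  have \<theta>\<theta>': "\<theta> (\<theta>' y) = y" if "y \<in> carrier \<pi>" for y
    using \<theta> that unfolding \<theta>'_def iso_def bij_betw_def by (auto simp: f_inv_into_f)
  interpret T: group_hom \<pi> G \<theta>'
    by unfold_locales (use \<theta>' in \<open>simp add: iso_def\<close>)
  define a b where "a = (\<lambda>j. \<theta>' (gen (4 * int j)))" and "b = (\<lambda>j. \<theta>' (gen (4 * int j + 1)))"
  show ?thesis
  proof (rule that[of a b])
    show "range a \<subseteq> carrier G" "range b \<subseteq> carrier G" by (auto simp: a_def b_def)
    have "generate G (a ` {..<g} \<union> b ` {..<g}) =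
        generate G (\<theta>' ` ((\<lambda>j. gen (4 * int j)) ` {..<g} \<union> (\<lambda>j. gen (4 * int j + 1)) ` {..<g}))"
      by (simp add: a_def b_def image_Un image_image)
    also have "\<dots> = \<theta>' ` carrier \<pi>"
      by (subst T.generate_img) (auto simp: generate_gen_pairs)
    also have "\<dots> = carrier G" using \<theta>' by (auto simp: iso_def bij_betw_def)
    finally show "generate G (a ` {..<g} \<union> b ` {..<g}) = carrier G" .
    show "surface_relator G a b g = \<one>\<^bsub>G\<^esub>"
      using T.hom_surface_relator[of g "\<lambda>j. gen (4 * int j)" "\<lambda>j. gen (4 * int j + 1)"] relator_gen
      by (simp add: a_def b_def)
    fix K :: "'k monoid" and \<alpha> \<beta>
    assume K: "group K" "range \<alpha> \<subseteq> carrier K" "range \<beta> \<subseteq> carrier K" "surface_relator K \<alpha> \<beta> g = \<one>\<^bsub>K\<^esub>"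
    obtain h where h: "h \<in> hom \<pi> K" "\<forall>j<g. h (gen (4 * int j)) = \<alpha> j \<and> h (gen (4 * int j + 1)) = \<beta> j"
      using hom_from_relator[OF K(1) _ _ K(4)] K(2,3) by blast
    have "h \<circ> \<theta> \<in> hom G K" using \<theta> h(1) hom_compose by (auto simp: iso_def)
    moreover have "\<forall>j<g. (h \<circ> \<theta>) (a j) = \<alpha> j \<and> (h \<circ> \<theta>) (b j) = \<beta> j"
      using h(2) by (simp add: a_def b_def \<theta>\<theta>')
    ultimately show "\<exists>h\<in>hom G K. \<forall>j<g. h (a j) = \<alpha> j \<and> h (b j) = \<beta> j" by blast
  qed
qed

section \<open>Counting homomorphisms and sections\<close>

text \<open>Counting by data: one datum is chosen for each member, and the choice is injective. A
  relation is used because a member may have several data, as a kernel comes from several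
  homomorphisms and a coset has several representatives.\<close>

lemma card_le_if_determined:
  assumes D: "finite D" and ex: "\<And>y. y \<in> Y \<Longrightarrow> \<exists>d\<in>D. rel d y"
    and det: "\<And>d y y'. d \<in> D \<Longrightarrow> y \<in> Y \<Longrightarrow> y' \<in> Y \<Longrightarrow> rel d y \<Longrightarrow> rel d y' \<Longrightarrow> y = y'"
  shows "finite Y \<and> card Y \<le> card D"
proof -
  define f where "f = (\<lambda>y. SOME d. d \<in> D \<and> rel d y)"
  have f: "f y \<in> D" "rel (f y) y" if "y \<in> Y" for y
    unfolding f_def using someI_ex[of "\<lambda>d. d \<in> D \<and> rel d y"] ex[OF that] by blast+
  have "inj_on f Y" using f det by (metis inj_onI)
  moreover have "f ` Y \<subseteq> D" using f by blast
  ultimately show ?thesis using D by (meson card_inj_on_le inj_on_finite)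
qed

lemma (in group_hom) eq_on_generate:
  assumes h': "group_hom G H h'" and U: "U \<subseteq> carrier G" and eq: "\<And>u. u \<in> U \<Longrightarrow> h u = h' u"
    and x: "x \<in> generate G U"
  shows "h x = h' x"
proof -
  interpret h': group_hom G H h' by fact
  show ?thesis using x
  proof (induction rule: generate.induct)
    case one
    then show ?case by simp
  next
    case (incl u)
    then show ?case using eq by simp
  next
    case (inv u)
    then show ?case using eq U by auto
  next
    case (eng u w)
    then have "u \<in> carrier G" "w \<in> carrier G" using G.generate_in_carrier[OF U] by auto
    then show ?case using eng by simp
  qed
qed

text \<open>Schreier's lemma: the generators are \<open>t s r\<inverse>\<close> with \<open>t\<close>, \<open>r\<close> coset representatives and \<open>s \<in> S\<close>.\<close>

lemma (in group) finite_index_generators: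
  assumes S: "S \<subseteq> carrier G" "finite S" "generate G S = carrier G"
    and H: "subgroup H G" and fin: "finite (rcosets H)"
  obtains U where "U \<subseteq> H" "finite U" "card U \<le> card (rcosets H) * card S" "generate G U = H"
proof -
  \<comment> \<open>The subgroup itself is represented by the unit, so that the Schreier product of
    an element of \<open>H\<close> is that element.\<close>
  define t where "t = (\<lambda>C. if C = H then \<one> else SOME y. y \<in> C)"
  define r where "r = (\<lambda>x. t (H #> x))"
  define U where "U = (\<lambda>(C, s). t C \<otimes> s \<otimes> inv r (t C \<otimes> s)) ` ((rcosets H) \<times> S)"
  have Hc: "H \<subseteq> carrier G" using H by (rule subgroup.subset)
  have HH: "H \<in> rcosets H" using subgroup.subgroup_in_rcosets[OF H is_group] .
  have t_in: "t C \<in> C" if "C \<in> rcosets H" for C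
  proof (cases "C = H")
    case True
    then show ?thesis using subgroup.one_closed[OF H] by (simp add: t_def)
  next
    case False
    obtain x where "x \<in> carrier G" "C = H #> x" using \<open>C \<in> rcosets H\<close> by (auto simp: RCOSETS_def)
    then have "x \<in> C" using rcos_self H by blast
    then show ?thesis using False unfolding t_def by (metis someI)
  qed
  have t_car: "t C \<in> carrier G" if "C \<in> rcosets H" for C
    using t_in[OF that] that rcosets_part_G[OF H] by blast
  have t_coset: "H #> t C = C" if C: "C \<in> rcosets H" for C
  proof -
    obtain x where x: "x \<in> carrier G" "C = H #> x" using C by (auto simp: RCOSETS_def)
    then show ?thesis using repr_independence[OF _ x(1) H, of "t C"] t_in[OF C] by simp
  qed
  have cos: "H #> x \<in> rcosets H" if "x \<in> carrier G" for x using that by (auto simp: RCOSETS_def)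
  have r_car: "r x \<in> carrier G" if "x \<in> carrier G" for x unfolding r_def using t_car[OF cos[OF that]] .
  have r_coset: "H #> r x = H #> x" if "x \<in> carrier G" for x unfolding r_def using t_coset[OF cos[OF that]] .
  have r_cong: "r x = r y" if "H #> x = H #> y" for x y unfolding r_def that ..
  have shift: "H #> (r x \<otimes> y) = H #> (x \<otimes> y)" if "x \<in> carrier G" "y \<in> carrier G" for x y
    using that r_coset[OF that(1)] r_car[OF that(1)] by (metis Hc coset_mult_assoc)
  have inH: "x \<otimes> inv r x \<in> H" if x: "x \<in> carrier G" for x
  proof -
    have "x \<in> H #> r x" using r_coset[OF x] rcos_self[OF x H] by simp
    then obtain h where h: "h \<in> H" "x = h \<otimes> r x" unfolding r_coset_def by auto
    then have "x \<otimes> inv r x = h" using r_car[OF x] Hc by (metis inv_solve_right' subsetD x)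
    then show ?thesis using h by simp
  qed
  have "U \<subseteq> H" unfolding U_def using t_car S(1) inH by (auto simp: subset_iff)
  moreover have "finite U" unfolding U_def using fin S(2) by simp
  moreover have "card U \<le> card (rcosets H) * card S"
    unfolding U_def using card_image_le[of "(rcosets H) \<times> S"] fin S(2) by (simp add: card_cartesian_product)
  moreover have "generate G U = H"
  proof
    have Uc: "U \<subseteq> carrier G" using \<open>U \<subseteq> H\<close> Hc by blast
    show "generate G U \<subseteq> H" using generate_subgroup_incl[OF \<open>U \<subseteq> H\<close> H] .
    \<comment> \<open>Schreier products are multiplicative along words once the starting coset is
      allowed to vary: the product for \<open>x y\<close> from \<open>C\<close> is the product for
      \<open>x\<close> from \<open>C\<close> times that for \<open>y\<close> from the coset reached.
      For an inverse letter, the generator at the coset reached is inverted.\<close>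
    have main: "\<forall>C\<in>rcosets H. t C \<otimes> x \<otimes> inv r (t C \<otimes> x) \<in> generate G U" if "x \<in> generate G S" for x
      using that
    proof (induction rule: generate.induct)
      case one
      then show ?case
        using t_car t_coset by (auto simp: r_def intro: generate.one)
    next
      case (incl s)
      then show ?case unfolding U_def by (auto intro!: generate.incl)
    next
      case (inv s)
      show ?case
      proof
        fix C assume C: "C \<in> rcosets H"
        have s: "s \<in> carrier G" using inv S(1) by blast
        note tc = t_car[OF C]
        define C' where "C' = H #> (t C \<otimes> inv s)"
        have C': "C' \<in> rcosets H" unfolding C'_def using tc s by (intro cos) simp
        note tc' = t_car[OF C']
        have e: "r (t C \<otimes> inv s) = t C'" by (simp add: r_def C'_def)
        have "H #> (t C' \<otimes> s) = H #> (t C \<otimes> inv s \<otimes> s)"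
          using shift[of "t C \<otimes> inv s" s] e tc s by simp
        also have "t C \<otimes> inv s \<otimes> s = t C" using tc s by (simp add: m_assoc)
        finally have "r (t C' \<otimes> s) = t C" using t_coset[OF C] by (simp add: r_def)
        then have "t C' \<otimes> s \<otimes> inv t C \<in> U" unfolding U_def using C' inv by force
        then have "inv (t C' \<otimes> s \<otimes> inv t C) \<in> generate G U" by (rule generate.inv)
        moreover have "inv (t C' \<otimes> s \<otimes> inv t C) = t C \<otimes> inv s \<otimes> inv t C'"
          using tc tc' s by (simp add: inv_mult_group m_assoc)
        ultimately show "t C \<otimes> inv s \<otimes> inv r (t C \<otimes> inv s) \<in> generate G U" by (simp add: e)
      qed
    next
      case (eng x y)
      show ?case
      proof
        fix C assume C: "C \<in> rcosets H"
        have xy: "x \<in> carrier G" "y \<in> carrier G" using eng generate_in_carrier[OF S(1)] by auto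
        note tc = t_car[OF C]
        define C' where "C' = H #> (t C \<otimes> x)"
        have C': "C' \<in> rcosets H" unfolding C'_def using tc xy by (intro cos) simp
        note tc' = t_car[OF C']
        have e: "r (t C \<otimes> x) = t C'" by (simp add: r_def C'_def)
        have e2: "r (t C' \<otimes> y) = r (t C \<otimes> (x \<otimes> y))"
          using shift[of "t C \<otimes> x" y] e tc xy by (intro r_cong) (simp add: m_assoc)
        let ?q = "r (t C \<otimes> (x \<otimes> y))"
        have q: "?q \<in> carrier G" using tc xy by (intro r_car) simp
        have "(t C \<otimes> x \<otimes> inv t C') \<otimes> (t C' \<otimes> y \<otimes> inv ?q) \<in> generate G U"
          using eng.IH C C' e e2 by (metis generate.eng)
        moreover have "(t C \<otimes> x \<otimes> inv t C') \<otimes> (t C' \<otimes> y \<otimes> inv ?q) = t C \<otimes> x \<otimes> (inv t C' \<otimes> (t C' \<otimes> (y \<otimes> inv ?q)))"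
          using tc tc' xy q by (simp add: m_assoc)
        moreover have "inv t C' \<otimes> (t C' \<otimes> (y \<otimes> inv ?q)) = y \<otimes> inv ?q"
          using tc' xy q by (simp flip: m_assoc)
        ultimately show "t C \<otimes> (x \<otimes> y) \<otimes> inv ?q \<in> generate G U"
          using tc xy q by (simp add: m_assoc)
      qed
    qed
    show "H \<subseteq> generate G U"
    proof
      fix h assume h: "h \<in> H"
      then have hc: "h \<in> carrier G" using Hc by blast
      have "H #> h = H" using coset_join2[OF hc H h] .
      moreover have "t H = \<one>" by (simp add: t_def)
      ultimately have "t H \<otimes> h \<otimes> inv r (t H \<otimes> h) = h" using hc by (simp add: r_def)
      then show "h \<in> generate G U" using main[of h] HH S(3) hc by metis
    qed
  qed
  ultimately show ?thesis using that by blast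
qed

lemma (in group_hom) card_rcosets_kernel:
  assumes "finite (carrier H)"
  shows "finite (rcosets kernel G H h) \<and> card (rcosets kernel G H h) \<le> card (carrier H)"
proof -
  have "carrier (G Mod kernel G H h) = rcosets kernel G H h" by (simp add: FactGroup_def)
  moreover have "(\<lambda>X. the_elem (h ` X)) ` carrier (G Mod kernel G H h) \<subseteq> carrier H"
    using FactGroup_the_elem_mem by blast
  ultimately show ?thesis
    using FactGroup_inj_on assms by (metis card_inj_on_le inj_on_finite)
qed

lemma (in group) card_kernels_le:
  assumes S: "S \<subseteq> carrier G" "finite S" "generate G S = carrier G"
    and L: "group L" "finite (carrier L)"
  shows "finite {kernel G L h | h. h \<in> hom G L} \<and> card {kernel G L h | h. h \<in> hom G L} \<le> card (carrier L) ^ card S"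
proof -
  let ?D = "S \<rightarrow>\<^sub>E carrier L"
  have "card ?D = card (carrier L) ^ card S" using S(2) by (simp add: card_PiE)
  moreover have "finite {kernel G L h | h. h \<in> hom G L} \<and> card {kernel G L h | h. h \<in> hom G L} \<le> card ?D"
  proof (rule card_le_if_determined[where rel = "\<lambda>d y. \<exists>h\<in>hom G L. y = kernel G L h \<and> d = restrict h S"])
    show "finite ?D" using S(2) L(2) by (intro finite_PiE) auto
    show "\<exists>d\<in>?D. \<exists>h\<in>hom G L. y = kernel G L h \<and> d = restrict h S" if y: "y \<in> {kernel G L h | h. h \<in> hom G L}" for y
    proof -
      obtain h where h: "h \<in> hom G L" "y = kernel G L h" using y by blast
      have "restrict h S \<in> ?D" using h(1) S(1) by (auto simp: hom_def)
      then show ?thesis using h by blast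
    qed
    fix d y y'
    assume "\<exists>h\<in>hom G L. y = kernel G L h \<and> d = restrict h S" "\<exists>h\<in>hom G L. y' = kernel G L h \<and> d = restrict h S"
    then obtain h h' where h: "h \<in> hom G L" "y = kernel G L h" "d = restrict h S"
      and h': "h' \<in> hom G L" "y' = kernel G L h'" "d = restrict h' S" by blast
    interpret group_hom G L h using L(1) h(1) is_group by (simp add: group_hom_def group_hom_axioms_def)
    have "group_hom G L h'" using L(1) h'(1) is_group by (simp add: group_hom_def group_hom_axioms_def)
    moreover have "h u = h' u" if "u \<in> S" for u using h(3) h'(3) that by (metis restrict_apply')
    ultimately have "h x = h' x" if "x \<in> carrier G" for x
      using eq_on_generate[of h' S x] S that by simp
    then show "y = y'" unfolding h(2) h'(2) kernel_def by auto
  qed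
  ultimately show ?thesis by simp
qed

lemma (in group_hom) card_sections_le:
  assumes K: "subgroup K H" and U: "U \<subseteq> K" "finite U" "generate H U = K"
    and fib: "\<And>u. u \<in> U \<Longrightarrow> finite {x \<in> carrier G. h x = u} \<and> card {x \<in> carrier G. h x = u} \<le> m"
  shows "finite {s ` K | s. s \<in> hom (H\<lparr>carrier := K\<rparr>) G \<and> (\<forall>k\<in>K. h (s k) = k)} \<and>
    card {s ` K | s. s \<in> hom (H\<lparr>carrier := K\<rparr>) G \<and> (\<forall>k\<in>K. h (s k) = k)} \<le> m ^ card U"
    (is "finite ?Y \<and> card ?Y \<le> _")
proof -
  let ?D = "\<Pi>\<^sub>E u\<in>U. {x \<in> carrier G. h x = u}"
  let ?sec = "\<lambda>s. s \<in> hom (H\<lparr>carrier := K\<rparr>) G \<and> (\<forall>k\<in>K. h (s k) = k)"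
  have "card ?D = (\<Prod>u\<in>U. card {x \<in> carrier G. h x = u})" using U(2) by (simp add: card_PiE)
  also have "\<dots> \<le> (\<Prod>u\<in>U. m)" using fib by (intro prod_mono) auto
  finally have "card ?D \<le> m ^ card U" by simp
  moreover have "finite ?Y \<and> card ?Y \<le> card ?D"
  proof (rule card_le_if_determined[where rel = "\<lambda>d y. \<exists>s. ?sec s \<and> y = s ` K \<and> d = restrict s U"])
    show "finite ?D" using U(2) fib by (intro finite_PiE) auto
    show "\<exists>d\<in>?D. \<exists>s. ?sec s \<and> y = s ` K \<and> d = restrict s U" if y: "y \<in> ?Y" for y
    proof -
      obtain s where s: "?sec s" "y = s ` K" using y by blast
      have "restrict s U \<in> ?D" using s(1) U(1) by (auto simp: hom_def)
      then show ?thesis using s by blast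
    qed
    fix d y y'
    assume "\<exists>s. ?sec s \<and> y = s ` K \<and> d = restrict s U" "\<exists>s. ?sec s \<and> y' = s ` K \<and> d = restrict s U"
    then obtain s s' where s: "?sec s" "y = s ` K" "d = restrict s U"
      and s': "?sec s'" "y' = s' ` K" "d = restrict s' U" by blast
    have KG: "group (H\<lparr>carrier := K\<rparr>)" using subgroup.subgroup_is_group[OF K H.is_group] .
    have hs: "group_hom (H\<lparr>carrier := K\<rparr>) G s" "group_hom (H\<lparr>carrier := K\<rparr>) G s'"
      using s(1) s'(1) KG by (auto simp: group_hom_def group_hom_axioms_def)
    have eq: "s u = s' u" if "u \<in> U" for u using s(3) s'(3) that by (metis restrict_apply')
    have "generate (H\<lparr>carrier := K\<rparr>) U = K" using H.generate_consistent[OF U(1) K] U(3) by simp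
    then have "s k = s' k" if "k \<in> K" for k
      using group_hom.eq_on_generate[OF hs(1) hs(2), of U k] U(1) eq that by simp
    then show "y = y'" unfolding s(2) s'(2) by auto
  qed
  ultimately show ?thesis by simp
qed

lemma (in group) index_normalizer_le:
  assumes I: "I \<subseteq> carrier G" and C: "finite C"
    and conj: "\<And>x. x \<in> carrier G \<Longrightarrow> (\<lambda>y. inv x \<otimes> y \<otimes> x) ` I \<in> C"
  shows "finite (rcosets normalizer G I) \<and> card (rcosets normalizer G I) \<le> card C"
proof (rule card_le_if_determined[OF C, where rel = "\<lambda>d y. \<exists>x\<in>carrier G. y = normalizer G I #> x
      \<and> d = (\<lambda>y. inv x \<otimes> y \<otimes> x) ` I"])
  show "\<exists>d\<in>C. \<exists>x\<in>carrier G. y = normalizer G I #> x \<and> d = (\<lambda>y. inv x \<otimes> y \<otimes> x) ` I"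
    if "y \<in> rcosets normalizer G I" for y
    using that conj by (auto simp: RCOSETS_def)
  fix d y y'
  assume "\<exists>x\<in>carrier G. y = normalizer G I #> x \<and> d = (\<lambda>y. inv x \<otimes> y \<otimes> x) ` I"
    "\<exists>x\<in>carrier G. y' = normalizer G I #> x \<and> d = (\<lambda>y. inv x \<otimes> y \<otimes> x) ` I"
  then obtain x x' where x: "x \<in> carrier G" "y = normalizer G I #> x" "d = (\<lambda>y. inv x \<otimes> y \<otimes> x) ` I"
    and x': "x' \<in> carrier G" "y' = normalizer G I #> x'" "d = (\<lambda>y. inv x' \<otimes> y \<otimes> x') ` I" by blast
  have N: "subgroup (normalizer G I) G" using normalizer_imp_subgroup[OF I] .
  define w where "w = x' \<otimes> inv x"
  have w: "w \<in> carrier G" using x x' by (simp add: w_def)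
  have "w <# I #> inv w = (\<lambda>y. w \<otimes> y \<otimes> inv w) ` I"
    unfolding l_coset_def r_coset_def by auto
  also have "\<dots> = (\<lambda>y. x' \<otimes> y \<otimes> inv x') ` (\<lambda>y. inv x \<otimes> y \<otimes> x) ` I"
    unfolding image_image using I x x' by (intro image_cong) (auto simp: w_def inv_mult_group m_assoc)
  also have "\<dots> = (\<lambda>y. x' \<otimes> y \<otimes> inv x') ` (\<lambda>y. inv x' \<otimes> y \<otimes> x') ` I"
    using x(3) x'(3) by simp
  also have "\<dots> = I"
  proof -
    have "x' \<otimes> (inv x' \<otimes> y \<otimes> x') \<otimes> inv x' = y" if "y \<in> carrier G" for y
    proof -
      have "x' \<otimes> (inv x' \<otimes> y \<otimes> x') \<otimes> inv x' = x' \<otimes> (inv x' \<otimes> (y \<otimes> (x' \<otimes> inv x')))"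
        using x'(1) that by (simp add: m_assoc)
      also have "\<dots> = y" using x'(1) that by (simp flip: m_assoc)
      finally show ?thesis .
    qed
    then have "(\<lambda>y. x' \<otimes> (inv x' \<otimes> y \<otimes> x') \<otimes> inv x') ` I = id ` I"
      using I by (intro image_cong) auto
    then show ?thesis unfolding image_image by simp
  qed
  finally have "w \<in> normalizer G I" unfolding normalizer_def stabilizer_def using w I by simp
  moreover have "w \<otimes> x = x'" using x x' by (simp add: w_def m_assoc)
  ultimately have "x' \<in> normalizer G I #> x" unfolding r_coset_def by force
  then show "y = y'" unfolding x(2) x'(2) using repr_independence[OF _ x(1) N] by simp
qed

section \<open>Splitting the central extension over a cyclic cover\<close>

text \<open>For central \<open>z\<close> this is the central product of \<open>\<Gamma>\<close> with the integral Heisenberg group, the generator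
  of whose centre is identified with \<open>z\<close>.\<close>

definition twisted_group :: "'b monoid \<Rightarrow> 'b \<Rightarrow> ('b \<times> int \<times> int) monoid" where
  "twisted_group \<Gamma> z = \<lparr>carrier = carrier \<Gamma> \<times> UNIV,
     mult = (\<lambda>(x, m, n) (x', m', n'). (x \<otimes>\<^bsub>\<Gamma>\<^esub> x' \<otimes>\<^bsub>\<Gamma>\<^esub> z [^]\<^bsub>\<Gamma>\<^esub> (m * n'), m + m', n + n')),
     one = (\<one>\<^bsub>\<Gamma>\<^esub>, 0, 0)\<rparr>"

locale central_element = group \<Gamma> for \<Gamma> :: "'b monoid" (structure) +
  fixes z :: 'b
  assumes z_closed [simp]: "z \<in> carrier \<Gamma>" and z_central: "\<And>x. x \<in> carrier \<Gamma> \<Longrightarrow> z \<otimes> x = x \<otimes> z"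
begin

abbreviation "T \<equiv> twisted_group \<Gamma> z"

lemma z_pow_central: "x \<in> carrier \<Gamma> \<Longrightarrow> z [^] (k::int) \<otimes> x = x \<otimes> z [^] k"
proof -
  assume x: "x \<in> carrier \<Gamma>"
  have nat: "z [^] (n::nat) \<otimes> x = x \<otimes> z [^] n" for n
  proof (induction n)
    case (Suc n)
    have "z [^] Suc n \<otimes> x = z [^] n \<otimes> (z \<otimes> x)" using x by (simp add: m_assoc)
    also have "\<dots> = (z [^] n \<otimes> x) \<otimes> z" using x by (simp add: z_central m_assoc)
    finally show ?case using Suc x by (simp add: m_assoc)
  qed (use x in simp)
  show ?thesis
  proof (cases k rule: int_cases2)
    case (nonneg n)
    then show ?thesis using nat[of n] by (simp add: int_pow_int)
  next
    case (nonpos n)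
    let ?w = "z [^] n"
    have w: "?w \<in> carrier \<Gamma>" by simp
    have "inv ?w \<otimes> x = inv ?w \<otimes> ((x \<otimes> ?w) \<otimes> inv ?w)" using x w by (simp add: m_assoc)
    also have "\<dots> = inv ?w \<otimes> ((?w \<otimes> x) \<otimes> inv ?w)" by (simp only: nat)
    also have "\<dots> = inv ?w \<otimes> ?w \<otimes> (x \<otimes> inv ?w)" using x w by (simp only: m_assoc inv_closed m_closed)
    also have "\<dots> = x \<otimes> inv ?w" using x w by simp
    finally show ?thesis using nonpos by (simp add: int_pow_neg_int)
  qed
qed

lemma T_mult: "(x, m, n) \<otimes>\<^bsub>T\<^esub> (x', m', n') = (x \<otimes> x' \<otimes> z [^] (m * n'), m + m', n + n')"
  by (simp add: twisted_group_def)

lemma T_carrier [simp]: "(x, m, n) \<in> carrier T \<longleftrightarrow> x \<in> carrier \<Gamma>"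
  by (simp add: twisted_group_def)

lemma T_one: "\<one>\<^bsub>T\<^esub> = (\<one>, 0, 0)"
  by (simp add: twisted_group_def)

lemma T_left_inverse:
  assumes x: "x \<in> carrier \<Gamma>"
  shows "(inv x \<otimes> z [^] (m * n), - m, - n) \<otimes>\<^bsub>T\<^esub> (x, m, n) = \<one>\<^bsub>T\<^esub>"
proof -
  have "inv x \<otimes> z [^] (m * n) \<otimes> x \<otimes> z [^] (- m * n) = inv x \<otimes> (z [^] (m * n) \<otimes> x) \<otimes> z [^] (- m * n)"
    using x by (simp add: m_assoc)
  also have "\<dots> = inv x \<otimes> x \<otimes> (z [^] (m * n) \<otimes> z [^] (- m * n))"
    unfolding z_pow_central[OF x] using x by (simp only: m_assoc inv_closed m_closed int_pow_closed z_closed)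
  also have "\<dots> = \<one>" using x by (simp flip: int_pow_mult)
  finally show ?thesis by (simp add: T_mult T_one)
qed

lemma group_T: "group T"
proof (rule groupI)
  show "\<one>\<^bsub>T\<^esub> \<in> carrier T" by (simp add: T_one)
  fix a assume "a \<in> carrier T"
  then obtain x m n where a: "a = (x, m, n)" "x \<in> carrier \<Gamma>" by (cases a) auto
  show "\<one>\<^bsub>T\<^esub> \<otimes>\<^bsub>T\<^esub> a = a" using a by (simp add: T_one T_mult)
  have "(inv x \<otimes> z [^] (m * n), - m, - n) \<otimes>\<^bsub>T\<^esub> a = \<one>\<^bsub>T\<^esub>"
    using T_left_inverse a by simp
  moreover have "(inv x \<otimes> z [^] (m * n), - m, - n) \<in> carrier T" using a by simp
  ultimately show "\<exists>b\<in>carrier T. b \<otimes>\<^bsub>T\<^esub> a = \<one>\<^bsub>T\<^esub>" by blast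
  fix b assume "b \<in> carrier T"
  then obtain x' m' n' where b: "b = (x', m', n')" "x' \<in> carrier \<Gamma>" by (cases b) auto
  show "a \<otimes>\<^bsub>T\<^esub> b \<in> carrier T" using a b by (simp add: T_mult)
  fix c assume "c \<in> carrier T"
  then obtain x'' m'' n'' where c: "c = (x'', m'', n'')" "x'' \<in> carrier \<Gamma>" by (cases c) auto
  have "x \<otimes> x' \<otimes> z [^] (m * n') \<otimes> x'' \<otimes> z [^] ((m + m') * n'')
      = x \<otimes> x' \<otimes> (z [^] (m * n') \<otimes> x'') \<otimes> z [^] ((m + m') * n'')"
    using a b c by (simp add: m_assoc)
  also have "\<dots> = x \<otimes> (x' \<otimes> x'') \<otimes> (z [^] (m * n') \<otimes> z [^] ((m + m') * n''))"
    unfolding z_pow_central[OF c(2)] using a b c by (simp add: m_assoc)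
  also have "z [^] (m * n') \<otimes> z [^] ((m + m') * n'') = z [^] (m' * n'') \<otimes> z [^] (m * (n' + n''))"
  proof -
    have "m * n' + (m + m') * n'' = m' * n'' + m * (n' + n'')" by (simp add: algebra_simps)
    then show ?thesis by (simp only: int_pow_mult[OF z_closed, symmetric])
  qed
  also have "x \<otimes> (x' \<otimes> x'') \<otimes> (z [^] (m' * n'') \<otimes> z [^] (m * (n' + n'')))
      = x \<otimes> (x' \<otimes> x'' \<otimes> z [^] (m' * n'')) \<otimes> z [^] (m * (n' + n''))"
    using a b c by (simp add: m_assoc)
  finally show "a \<otimes>\<^bsub>T\<^esub> b \<otimes>\<^bsub>T\<^esub> c = a \<otimes>\<^bsub>T\<^esub> (b \<otimes>\<^bsub>T\<^esub> c)"
    using a b c by (simp add: T_mult)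
qed

lemma T_inv:
  assumes x: "x \<in> carrier \<Gamma>" shows "inv\<^bsub>T\<^esub> (x, m, n) = (inv x \<otimes> z [^] (m * n), - m, - n)"
proof -
  interpret T: group T by (rule group_T)
  show ?thesis using x T_left_inverse[OF x] by (intro T.inv_equality) auto
qed

text \<open>Only the pair with index 0 has integer coordinates. Its commutator
  \<open>a b\<inverse> a\<inverse> b\<close> picks up \<open>inv z\<close>, which is central and can
  be moved to the end; \<open>Suc n\<close> ensures that this pair occurs.\<close>

lemma twisted_relator:
  assumes a: "\<And>j. a j \<in> carrier \<Gamma>" and b: "\<And>j. b j \<in> carrier \<Gamma>"
  shows "surface_relator T (\<lambda>j. (a j, if j = 0 then 1 else 0, 0)) (\<lambda>j. (b j, 0, if j = 0 then 1 else 0)) (Suc n)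
    = (surface_relator \<Gamma> a b (Suc n) \<otimes> inv z, 0, 0)"
proof (induction n)
  case 0
  have "a 0 \<otimes> inv b 0 \<otimes> inv z \<otimes> inv a 0 \<otimes> b 0 = a 0 \<otimes> inv b 0 \<otimes> (inv z \<otimes> (inv a 0 \<otimes> b 0))"
    using a b by (simp add: m_assoc)
  also have "inv z \<otimes> (inv a 0 \<otimes> b 0) = (inv a 0 \<otimes> b 0) \<otimes> inv z"
    using z_pow_central[of "inv a 0 \<otimes> b 0" "-1"] a b by (simp add: int_pow_neg)
  finally show ?case using a b
    by (simp add: T_one T_inv T_mult int_pow_neg m_assoc)
next
  case (Suc n)
  let ?c = "a (Suc n) \<otimes> inv b (Suc n) \<otimes> inv a (Suc n) \<otimes> b (Suc n)"
  have c: "?c \<in> carrier \<Gamma>" using a b by simp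
  have R: "surface_relator \<Gamma> a b (Suc n) \<in> carrier \<Gamma>" using a b by (intro surface_relator_closed)
  have "inv z \<otimes> ?c = ?c \<otimes> inv z"
    using z_pow_central[OF c, of "-1"] by (simp add: int_pow_neg)
  then have e: "surface_relator \<Gamma> a b (Suc n) \<otimes> inv z \<otimes> ?c = surface_relator \<Gamma> a b (Suc n) \<otimes> ?c \<otimes> inv z"
    using c R by (simp only: m_assoc inv_closed z_closed m_closed)
  have "surface_relator T (\<lambda>j. (a j, if j = 0 then 1 else 0, 0)) (\<lambda>j. (b j, 0, if j = 0 then 1 else 0)) (Suc (Suc n))
    = (surface_relator \<Gamma> a b (Suc n) \<otimes> inv z, 0, 0) \<otimes>\<^bsub>T\<^esub> (?c, 0, 0)"
    unfolding surface_relator.simps(2)[of _ _ _ "Suc n"] Suc.IH using a b by (simp add: T_inv T_mult)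
  also have "\<dots> = (surface_relator \<Gamma> a b (Suc (Suc n)) \<otimes> inv z, 0, 0)"
    using e c R by (simp add: T_mult del: surface_relator.simps) (simp add: surface_relator.simps(2)[of _ _ _ "Suc n"])
  finally show ?case .
qed

end

lemma group_exponent:
  assumes "group A" "finite (carrier A)"
  shows "group_exponent A > 0" "\<And>a. a \<in> carrier A \<Longrightarrow> a [^]\<^bsub>A\<^esub> group_exponent A = \<one>\<^bsub>A\<^esub>"
proof -
  have "order A > 0" using assms by (simp add: order_def card_gt_0_iff) (metis empty_iff group.is_monoid monoid.one_closed)
  then have "\<exists>m::nat. m > 0 \<and> (\<forall>a\<in>carrier A. a [^]\<^bsub>A\<^esub> m = \<one>\<^bsub>A\<^esub>)"
    using group.pow_order_eq_1[OF assms(1)] by blast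
  from LeastI_ex[OF this] show "group_exponent A > 0" "\<And>a. a \<in> carrier A \<Longrightarrow> a [^]\<^bsub>A\<^esub> group_exponent A = \<one>\<^bsub>A\<^esub>"
    by (auto simp: group_exponent_def)
qed

lemma cyclic_integer_mod_group: "cyclic_group (integer_mod_group n)"
proof (rule group.cyclic_group_epimorphic_image[OF group_integer_group])
  have "(\<lambda>k. k mod int n) ` UNIV = carrier (integer_mod_group n)"
  proof
    show "(\<lambda>k. k mod int n) ` UNIV \<subseteq> carrier (integer_mod_group n)"
      by (auto simp: carrier_integer_mod_group)
    show "carrier (integer_mod_group n) \<subseteq> (\<lambda>k. k mod int n) ` UNIV"
    proof
      fix k assume "k \<in> carrier (integer_mod_group n)"
      then have "k = k mod int n" by (auto simp: carrier_integer_mod_group split: if_splits)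
      then show "k \<in> (\<lambda>k. k mod int n) ` UNIV" by blast
    qed
  qed
  then show "(\<lambda>k. k mod int n) \<in> epi integer_group (integer_mod_group n)"
    unfolding epi_def hom_def by (auto simp: integer_group_def mod_add_eq)
qed auto

text \<open>The three components of a homomorphism into the twisted group are \<open>s\<close>,
  \<open>x\<close> and \<open>y\<close>, and its group law is the twisted multiplicativity of
  \<open>s\<close>. An element with \<open>x = 1\<close> makes the reduction of \<open>x\<close>
  modulo any positive integer surjective.\<close>

lemma central_extension_twisted_section:
  fixes A :: "'a monoid" and \<Gamma> :: "'b monoid" and G :: "'c monoid"
  assumes ext: "central_extension A \<Gamma> G \<iota> \<phi>" and N: "subgroup N G"
    and surf: "surface_group_of_genus g (G\<lparr>carrier := N\<rparr>)"
  obtains S s z u\<^sub>0 and x y :: "'c \<Rightarrow> int" where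
    "S \<subseteq> N" "finite S" "card S \<le> 2 * g" "generate (G\<lparr>carrier := N\<rparr>) S = N"
    "z \<in> \<iota> ` carrier A" "\<forall>u\<in>N. s u \<in> carrier \<Gamma> \<and> \<phi> (s u) = u"
    "\<forall>u\<in>N. \<forall>w\<in>N. s (u \<otimes>\<^bsub>G\<^esub> w) = s u \<otimes>\<^bsub>\<Gamma>\<^esub> s w \<otimes>\<^bsub>\<Gamma>\<^esub> z [^]\<^bsub>\<Gamma>\<^esub> (x u * y w)"
    "\<forall>u\<in>N. \<forall>w\<in>N. x (u \<otimes>\<^bsub>G\<^esub> w) = x u + x w"
    "u\<^sub>0 \<in> N" "x u\<^sub>0 = 1"
proof -
  let ?G1 = "G\<lparr>carrier := N\<rparr>"
  have E: "group_hom A \<Gamma> \<iota>" "group_hom \<Gamma> G \<phi>" "\<phi> ` carrier \<Gamma> = carrier G"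
    "kernel \<Gamma> G \<phi> = \<iota> ` carrier A"
    "\<forall>a\<in>carrier A. \<forall>x\<in>carrier \<Gamma>. \<iota> a \<otimes>\<^bsub>\<Gamma>\<^esub> x = x \<otimes>\<^bsub>\<Gamma>\<^esub> \<iota> a"
    using ext unfolding central_extension_def by auto
  interpret \<phi>: group_hom \<Gamma> G \<phi> by (rule E(2))
  have G1: "group ?G1" using subgroup.subgroup_is_group[OF N \<phi>.H.is_group] .
  have Nc: "N \<subseteq> carrier G" using N by (rule subgroup.subset)
  have incl: "group_hom ?G1 G (\<lambda>u. u)"
    using G1 \<phi>.H.is_group Nc by (auto simp: group_hom_def group_hom_axioms_def hom_def)
  have "g \<ge> 2" using surf by (simp add: surface_group_of_genus_def)
  obtain a b where ab: "range a \<subseteq> N" "range b \<subseteq> N"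
    and gen: "generate ?G1 (a ` {..<g} \<union> b ` {..<g}) = N" and rel: "surface_relator ?G1 a b g = \<one>\<^bsub>G\<^esub>"
    and univ: "\<And>(K :: ('b \<times> int \<times> int) monoid) \<alpha> \<beta>. \<lbrakk>group K; range \<alpha> \<subseteq> carrier K; range \<beta> \<subseteq> carrier K;
        surface_relator K \<alpha> \<beta> g = \<one>\<^bsub>K\<^esub>\<rbrakk> \<Longrightarrow> \<exists>h\<in>hom ?G1 K. \<forall>j<g. h (a j) = \<alpha> j \<and> h (b j) = \<beta> j"
    by (rule surface_group_presentation[OF surf, where 'k = "'b \<times> int \<times> int", simplified]) (rule that)
  have a: "a j \<in> N" and b: "b j \<in> N" for j using ab by auto
  have lift: "\<exists>x\<in>carrier \<Gamma>. \<phi> x = u" if "u \<in> N" for u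
    using that Nc E(3) by (metis image_iff subsetD)
  define l where "l = (\<lambda>u. SOME x. x \<in> carrier \<Gamma> \<and> \<phi> x = u)"
  have l: "l u \<in> carrier \<Gamma>" "\<phi> (l u) = u" if "u \<in> N" for u
    unfolding l_def using someI_ex[of "\<lambda>x. x \<in> carrier \<Gamma> \<and> \<phi> x = u"] lift[OF that] by blast+
  \<comment> \<open>The relator evaluated on arbitrary lifts maps to the trivial relator, hence lies
    in the kernel of \<phi>. It is also the central element used for the twist, so the relator in
    the twisted group becomes \<open>z\<close> times its inverse.\<close>
  define z where "z = surface_relator \<Gamma> (\<lambda>j. l (a j)) (\<lambda>j. l (b j)) g"
  have z: "z \<in> carrier \<Gamma>" unfolding z_def using l a b by (intro \<phi>.G.surface_relator_closed) auto
  have "\<phi> z = surface_relator G a b g"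
    unfolding z_def using \<phi>.hom_surface_relator[of g "\<lambda>j. l (a j)" "\<lambda>j. l (b j)"] l a b by simp
  also have "\<dots> = \<one>\<^bsub>G\<^esub>"
    using group_hom.hom_surface_relator[OF incl, of g a b] a b rel by simp
  finally have \<phi>z: "\<phi> z = \<one>\<^bsub>G\<^esub>" .
  then have zA: "z \<in> \<iota> ` carrier A" using z E(4) by (auto simp: kernel_def)
  interpret central_element \<Gamma> z
    by unfold_locales (use z zA E(5) in auto)
  define \<alpha> where "\<alpha> = (\<lambda>j::nat. (l (a j), if j = 0 then 1 else 0 :: int, 0 :: int))"
  define \<beta> where "\<beta> = (\<lambda>j::nat. (l (b j), 0 :: int, if j = 0 then 1 else 0 :: int))"
  obtain n where n: "g = Suc n" using \<open>g \<ge> 2\<close> by (cases g) auto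
  have "surface_relator T \<alpha> \<beta> g = (z \<otimes>\<^bsub>\<Gamma>\<^esub> inv\<^bsub>\<Gamma>\<^esub> z, 0, 0)"
    unfolding \<alpha>_def \<beta>_def n using twisted_relator[of "\<lambda>j. l (a j)" "\<lambda>j. l (b j)" n] l a b
    by (simp only: z_def n)
  also have "\<dots> = \<one>\<^bsub>T\<^esub>" by (simp add: T_one)
  finally have "\<exists>h\<in>hom ?G1 T. \<forall>j<g. h (a j) = \<alpha> j \<and> h (b j) = \<beta> j"
    using l a b by (intro univ group_T) (auto simp: \<alpha>_def \<beta>_def)
  then obtain h where h: "h \<in> hom ?G1 T" "\<forall>j<g. h (a j) = \<alpha> j \<and> h (b j) = \<beta> j" by blast
  define s x y where "s = (\<lambda>u. fst (h u))" and "x = (\<lambda>u. fst (snd (h u)))" and "y = (\<lambda>u. snd (snd (h u)))"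
  have hu: "h u = (s u, x u, y u)" for u by (simp add: s_def x_def y_def)
  have s: "s u \<in> carrier \<Gamma>" if "u \<in> N" for u
  proof -
    have "h u \<in> carrier T" using h(1) that by (auto simp: hom_def)
    then show ?thesis by (simp add: hu)
  qed
  have mult: "s (u \<otimes>\<^bsub>G\<^esub> w) = s u \<otimes>\<^bsub>\<Gamma>\<^esub> s w \<otimes>\<^bsub>\<Gamma>\<^esub> z [^]\<^bsub>\<Gamma>\<^esub> (x u * y w)" "x (u \<otimes>\<^bsub>G\<^esub> w) = x u + x w"
    if "u \<in> N" "w \<in> N" for u w
  proof -
    have "h (u \<otimes>\<^bsub>G\<^esub> w) = h u \<otimes>\<^bsub>T\<^esub> h w" using h(1) that by (auto simp: hom_def)
    then show "s (u \<otimes>\<^bsub>G\<^esub> w) = s u \<otimes>\<^bsub>\<Gamma>\<^esub> s w \<otimes>\<^bsub>\<Gamma>\<^esub> z [^]\<^bsub>\<Gamma>\<^esub> (x u * y w)" "x (u \<otimes>\<^bsub>G\<^esub> w) = x u + x w"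
      by (simp_all add: hu T_mult)
  qed
  have \<phi>zk: "\<phi> (z [^]\<^bsub>\<Gamma>\<^esub> (k::int)) = \<one>\<^bsub>G\<^esub>" for k
    using \<phi>.hom_int_pow[OF z, of k] \<phi>z by simp
  \<comment> \<open>The twist is invisible after \<phi>, as \<phi> kills \<open>z\<close>; comparing
    with the identity on generators shows that \<open>s\<close> is a section.\<close>
  have "group_hom ?G1 G (\<lambda>u. \<phi> (s u))"
    using G1 \<phi>.H.is_group s z by (auto simp: group_hom_def group_hom_axioms_def hom_def mult \<phi>zk)
  then have \<phi>s: "\<phi> (s u) = u" if "u \<in> N" for u
  proof (rule group_hom.eq_on_generate[OF _ incl, where U = "a ` {..<g} \<union> b ` {..<g}"])
    show "a ` {..<g} \<union> b ` {..<g} \<subseteq> carrier ?G1" using a b by auto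
    show "\<phi> (s v) = v" if "v \<in> a ` {..<g} \<union> b ` {..<g}" for v
      using that h(2) l a b by (auto simp: s_def \<alpha>_def \<beta>_def)
    show "u \<in> generate ?G1 (a ` {..<g} \<union> b ` {..<g})" using gen that by simp
  qed
  show ?thesis
  proof (rule that[of "a ` {..<g} \<union> b ` {..<g}" z s x y "a 0"])
    show "card (a ` {..<g} \<union> b ` {..<g}) \<le> 2 * g"
      using card_Un_le[of "a ` {..<g}" "b ` {..<g}"] card_image_le[of "{..<g}" a] card_image_le[of "{..<g}" b] by simp
    show "x (a 0) = 1" using h(2) \<open>g \<ge> 2\<close> by (simp add: x_def \<alpha>_def)
  qed (use a b gen zA s mult \<phi>s in auto)
qed

section \<open>Trivializations of a central extension and multiplicative sections\<close>

lemma extension_trivialization_of_section: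
  fixes A :: "'a monoid" and \<Gamma> :: "'b monoid" and G :: "'c monoid"
  assumes ext: "central_extension A \<Gamma> G \<iota> \<phi>" and H: "subgroup H G"
    and s: "\<And>u. u \<in> H \<Longrightarrow> s u \<in> carrier \<Gamma>" "\<And>u. u \<in> H \<Longrightarrow> \<phi> (s u) = u"
      "\<And>u w. u \<in> H \<Longrightarrow> w \<in> H \<Longrightarrow> s (u \<otimes>\<^bsub>G\<^esub> w) = s u \<otimes>\<^bsub>\<Gamma>\<^esub> s w"
  shows "extension_trivialization A (restrict_over \<Gamma> \<phi> H) (G\<lparr>carrier := H\<rparr>) \<iota> \<phi> (\<lambda>(a, u). \<iota> a \<otimes>\<^bsub>\<Gamma>\<^esub> s u)"
proof -
  have E: "group_hom A \<Gamma> \<iota>" "group_hom \<Gamma> G \<phi>" "inj_on \<iota> (carrier A)" "kernel \<Gamma> G \<phi> = \<iota> ` carrier A"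
    "\<And>a x. a \<in> carrier A \<Longrightarrow> x \<in> carrier \<Gamma> \<Longrightarrow> \<iota> a \<otimes>\<^bsub>\<Gamma>\<^esub> x = x \<otimes>\<^bsub>\<Gamma>\<^esub> \<iota> a"
    using ext unfolding central_extension_def by auto
  interpret \<phi>: group_hom \<Gamma> G \<phi> by (rule E(2))
  interpret \<iota>: group_hom A \<Gamma> \<iota> by (rule E(1))
  have Hc: "H \<subseteq> carrier G" using H by (rule subgroup.subset)
  have \<phi>\<iota>: "\<phi> (\<iota> a) = \<one>\<^bsub>G\<^esub>" if "a \<in> carrier A" for a using E(4) that by (auto simp: kernel_def)
  have \<phi>\<psi>: "\<phi> (\<iota> a \<otimes>\<^bsub>\<Gamma>\<^esub> s u) = u" if "a \<in> carrier A" "u \<in> H" for a u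
    using that s Hc \<phi>\<iota> by (auto simp: subset_iff)
  have one: "\<one>\<^bsub>G\<^esub> \<in> H" using H by (rule subgroup.one_closed)
  have s1: "s \<one>\<^bsub>G\<^esub> = \<one>\<^bsub>\<Gamma>\<^esub>"
    using s(3)[OF one one] s(1)[OF one] \<phi>.G.l_cancel_one'[of "s \<one>\<^bsub>G\<^esub>" "s \<one>\<^bsub>G\<^esub>"] by simp
  let ?\<psi> = "\<lambda>(a, u). \<iota> a \<otimes>\<^bsub>\<Gamma>\<^esub> s u"
  have hom: "?\<psi> \<in> hom (A \<times>\<times> G\<lparr>carrier := H\<rparr>) (restrict_over \<Gamma> \<phi> H)"
  proof (rule homI)
    fix p assume "p \<in> carrier (A \<times>\<times> G\<lparr>carrier := H\<rparr>)"
    then obtain a u where p: "p = (a, u)" "a \<in> carrier A" "u \<in> H" by auto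
    then show "?\<psi> p \<in> carrier (restrict_over \<Gamma> \<phi> H)" using s \<phi>\<psi> by (simp add: restrict_over_def)
    fix q assume "q \<in> carrier (A \<times>\<times> G\<lparr>carrier := H\<rparr>)"
    then obtain a' u' where q: "q = (a', u')" "a' \<in> carrier A" "u' \<in> H" by auto
    note c = p q s(1)[OF p(3)] s(1)[OF q(3)]
    have "(\<iota> a \<otimes>\<^bsub>\<Gamma>\<^esub> s u) \<otimes>\<^bsub>\<Gamma>\<^esub> (\<iota> a' \<otimes>\<^bsub>\<Gamma>\<^esub> s u') = \<iota> a \<otimes>\<^bsub>\<Gamma>\<^esub> (s u \<otimes>\<^bsub>\<Gamma>\<^esub> \<iota> a') \<otimes>\<^bsub>\<Gamma>\<^esub> s u'"
      using c by (simp add: \<phi>.G.m_assoc)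
    also have "s u \<otimes>\<^bsub>\<Gamma>\<^esub> \<iota> a' = \<iota> a' \<otimes>\<^bsub>\<Gamma>\<^esub> s u" using E(5) c by simp
    also have "\<iota> a \<otimes>\<^bsub>\<Gamma>\<^esub> (\<iota> a' \<otimes>\<^bsub>\<Gamma>\<^esub> s u) \<otimes>\<^bsub>\<Gamma>\<^esub> s u' = \<iota> (a \<otimes>\<^bsub>A\<^esub> a') \<otimes>\<^bsub>\<Gamma>\<^esub> s (u \<otimes>\<^bsub>G\<^esub> u')"
      using c s(3) by (simp add: \<phi>.G.m_assoc)
    finally show "?\<psi> (p \<otimes>\<^bsub>A \<times>\<times> G\<lparr>carrier := H\<rparr>\<^esub> q) = ?\<psi> p \<otimes>\<^bsub>restrict_over \<Gamma> \<phi> H\<^esub> ?\<psi> q"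
      using p q by (simp add: restrict_over_def)
  qed
  have "inj_on ?\<psi> (carrier (A \<times>\<times> G\<lparr>carrier := H\<rparr>))"
  proof (rule inj_onI)
    fix p q assume "p \<in> carrier (A \<times>\<times> G\<lparr>carrier := H\<rparr>)" "q \<in> carrier (A \<times>\<times> G\<lparr>carrier := H\<rparr>)"
      and eq: "?\<psi> p = ?\<psi> q"
    then obtain a u a' u' where p: "p = (a, u)" "a \<in> carrier A" "u \<in> H" and q: "q = (a', u')" "a' \<in> carrier A" "u' \<in> H"
      by auto
    have "u = u'" using \<phi>\<psi>[OF p(2,3)] \<phi>\<psi>[OF q(2,3)] eq p q by simp
    moreover have "\<iota> a = \<iota> a'" using eq p q calculation s(1)[OF p(3)] by simp
    ultimately show "p = q" using inj_onD[OF E(3)] p q by simp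
  qed
  moreover have "?\<psi> ` carrier (A \<times>\<times> G\<lparr>carrier := H\<rparr>) = carrier (restrict_over \<Gamma> \<phi> H)"
  proof
    show "?\<psi> ` carrier (A \<times>\<times> G\<lparr>carrier := H\<rparr>) \<subseteq> carrier (restrict_over \<Gamma> \<phi> H)"
      using hom_carrier[OF hom] .
    show "carrier (restrict_over \<Gamma> \<phi> H) \<subseteq> ?\<psi> ` carrier (A \<times>\<times> G\<lparr>carrier := H\<rparr>)"
    proof
      fix w assume "w \<in> carrier (restrict_over \<Gamma> \<phi> H)"
      then have w: "w \<in> carrier \<Gamma>" "\<phi> w \<in> H" by (auto simp: restrict_over_def)
      let ?u = "s (\<phi> w)"
      have u: "?u \<in> carrier \<Gamma>" "\<phi> ?u = \<phi> w" using s w by auto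
      have "w \<otimes>\<^bsub>\<Gamma>\<^esub> inv\<^bsub>\<Gamma>\<^esub> ?u \<in> kernel \<Gamma> G \<phi>" using w u by (simp add: kernel_def)
      then obtain a where a: "a \<in> carrier A" "w \<otimes>\<^bsub>\<Gamma>\<^esub> inv\<^bsub>\<Gamma>\<^esub> ?u = \<iota> a" using E(4) by auto
      then have "w = \<iota> a \<otimes>\<^bsub>\<Gamma>\<^esub> ?u"
        using w u by (metis \<phi>.G.inv_closed \<phi>.G.m_assoc \<phi>.G.l_inv \<phi>.G.r_one)
      then show "w \<in> ?\<psi> ` carrier (A \<times>\<times> G\<lparr>carrier := H\<rparr>)" using a(1) w(2) by force
    qed
  qed
  ultimately have "?\<psi> \<in> iso (A \<times>\<times> G\<lparr>carrier := H\<rparr>) (restrict_over \<Gamma> \<phi> H)"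
    using hom by (simp add: iso_def bij_betw_def)
  then show ?thesis
    unfolding extension_trivialization_def using s1 \<phi>\<psi> by auto
qed

lemma section_of_extension_trivialization:
  fixes A :: "'a monoid" and \<Gamma> :: "'b monoid" and G :: "'c monoid"
  assumes "group A" and \<psi>: "extension_trivialization A (restrict_over \<Gamma> \<phi> H) (G\<lparr>carrier := H\<rparr>) \<iota> \<phi> \<psi>"
  shows "(\<lambda>u. \<psi> (\<one>\<^bsub>A\<^esub>, u)) \<in> hom (G\<lparr>carrier := H\<rparr>) \<Gamma>" "\<And>u. u \<in> H \<Longrightarrow> \<phi> (\<psi> (\<one>\<^bsub>A\<^esub>, u)) = u"
proof -
  interpret A: group A by fact
  have h: "\<psi> \<in> hom (A \<times>\<times> G\<lparr>carrier := H\<rparr>) (restrict_over \<Gamma> \<phi> H)"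
    using \<psi> by (auto simp: extension_trivialization_def iso_def)
  show "(\<lambda>u. \<psi> (\<one>\<^bsub>A\<^esub>, u)) \<in> hom (G\<lparr>carrier := H\<rparr>) \<Gamma>"
  proof (rule homI)
    fix u assume u: "u \<in> carrier (G\<lparr>carrier := H\<rparr>)"
    then have "\<psi> (\<one>\<^bsub>A\<^esub>, u) \<in> carrier (restrict_over \<Gamma> \<phi> H)" using h by (auto simp: hom_def)
    then show "\<psi> (\<one>\<^bsub>A\<^esub>, u) \<in> carrier \<Gamma>" by (simp add: restrict_over_def)
    fix w assume "w \<in> carrier (G\<lparr>carrier := H\<rparr>)"
    then show "\<psi> (\<one>\<^bsub>A\<^esub>, u \<otimes>\<^bsub>G\<lparr>carrier := H\<rparr>\<^esub> w) = \<psi> (\<one>\<^bsub>A\<^esub>, u) \<otimes>\<^bsub>\<Gamma>\<^esub> \<psi> (\<one>\<^bsub>A\<^esub>, w)"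
      using u hom_mult[OF h, of "(\<one>\<^bsub>A\<^esub>, u)" "(\<one>\<^bsub>A\<^esub>, w)"] by (simp add: restrict_over_def)
  qed
  show "\<And>u. u \<in> H \<Longrightarrow> \<phi> (\<psi> (\<one>\<^bsub>A\<^esub>, u)) = u"
    using \<psi> by (simp add: extension_trivialization_def)
qed

text \<open>For trivial \<open>A\<close> the bound equals 1, while an index is at least 1; this is
  why strictness is restricted to nontrivial \<open>A\<close>. The inclusion \<open>i\<close>
  depends on the trivialization, so the estimate is made for every \<psi>.\<close>

theorem lemma3p4:
  fixes A :: "'a monoid" and \<Gamma> :: "'b monoid" and G :: "'c monoid"
    and n g\<^sub>1 :: nat and F :: "nat \<Rightarrow> 'c set"
    and \<iota> :: "'a \<Rightarrow> 'b" and \<phi> :: "'b \<Rightarrow> 'c"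
  assumes "comm_group A" and "finite (carrier A)"
    and "n \<ge> 1" and "polysurface_group G n F"
    and "surface_group_of_genus g\<^sub>1 (G\<lparr>carrier := F 1\<rparr>)"
    and "central_extension A \<Gamma> G \<iota> \<phi>"
  shows "\<exists>G1'. G1' \<lhd> G\<lparr>carrier := F 1\<rparr> \<and>
      finite (rcosets\<^bsub>G\<lparr>carrier := F 1\<rparr>\<^esub> G1') \<and>
      cyclic_group (G\<lparr>carrier := F 1\<rparr> Mod G1') \<and>
      order (G\<lparr>carrier := F 1\<rparr> Mod G1') = group_exponent A \<and>
      trivial_extension A (restrict_over \<Gamma> \<phi> G1') (G\<lparr>carrier := G1'\<rparr>) \<iota> \<phi> \<and>
      (\<forall>\<psi>. extension_trivialization A (restrict_over \<Gamma> \<phi> G1') (G\<lparr>carrier := G1'\<rparr>) \<iota> \<phi> \<psi> \<longrightarrow>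
        (let i = (\<lambda>x. \<psi> (\<one>\<^bsub>A\<^esub>, x));
             \<Gamma>' = normalizer \<Gamma> (i ` G1');
             B = card (carrier A) ^ (2 * group_exponent A * g\<^sub>1) *
                 (group_exponent A * fact (group_exponent A) ^ (2 * g\<^sub>1 + min_generators A))
         in finite (rcosets\<^bsub>\<Gamma>\<^esub> \<Gamma>') \<and>
            card (rcosets\<^bsub>\<Gamma>\<^esub> \<Gamma>') \<le> B \<and>
            (card (carrier A) > 1 \<longrightarrow> card (rcosets\<^bsub>\<Gamma>\<^esub> \<Gamma>') < B)))"
proof -
  define N where "N = F 1"
  define e where "e = group_exponent A"
  let ?G1 = "G\<lparr>carrier := N\<rparr>"
  let ?Z = "integer_mod_group e"
  interpret A: comm_group A by fact
  have e: "e > 0" "\<And>a. a \<in> carrier A \<Longrightarrow> a [^]\<^bsub>A\<^esub> e = \<one>\<^bsub>A\<^esub>"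
    unfolding e_def using group_exponent[OF A.is_group assms(2)] by auto
  have E: "group_hom A \<Gamma> \<iota>" "group_hom \<Gamma> G \<phi>" "kernel \<Gamma> G \<phi> = \<iota> ` carrier A" "\<phi> ` carrier \<Gamma> = carrier G"
    using assms(6) unfolding central_extension_def by auto
  interpret \<phi>: group_hom \<Gamma> G \<phi> by (rule E(2))
  interpret \<iota>: group_hom A \<Gamma> \<iota> by (rule E(1))
  have "N \<lhd> G" using assms(3,4) by (simp add: polysurface_group_def N_def)
  then interpret N: normal N G .
  have N: "subgroup N G" by (rule N.is_subgroup)
  interpret G1: group ?G1 using subgroup.subgroup_is_group[OF N \<phi>.H.is_group] .
  have surf: "surface_group_of_genus g\<^sub>1 ?G1" using assms(5) by (simp add: N_def)
  obtain S s z u\<^sub>0 and x y :: "'c \<Rightarrow> int" where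
    S: "S \<subseteq> N" "finite S" "card S \<le> 2 * g\<^sub>1" "generate ?G1 S = N"
    and z: "z \<in> \<iota> ` carrier A" and s': "\<forall>u\<in>N. s u \<in> carrier \<Gamma> \<and> \<phi> (s u) = u"
    and s_mult': "\<forall>u\<in>N. \<forall>w\<in>N. s (u \<otimes>\<^bsub>G\<^esub> w) = s u \<otimes>\<^bsub>\<Gamma>\<^esub> s w \<otimes>\<^bsub>\<Gamma>\<^esub> z [^]\<^bsub>\<Gamma>\<^esub> (x u * y w)"
    and x_mult': "\<forall>u\<in>N. \<forall>w\<in>N. x (u \<otimes>\<^bsub>G\<^esub> w) = x u + x w"
    and u\<^sub>0: "u\<^sub>0 \<in> N" "x u\<^sub>0 = 1"
    by (rule central_extension_twisted_section[OF assms(6) N surf]) (rule that)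
  note s = s'[rule_format, THEN conjunct1] s'[rule_format, THEN conjunct2]
  note s_mult = s_mult'[rule_format] and x_mult = x_mult'[rule_format]
  have zc: "z \<in> carrier \<Gamma>" using z by auto
  have z_pow: "z [^]\<^bsub>\<Gamma>\<^esub> k = \<one>\<^bsub>\<Gamma>\<^esub>" if k: "int e dvd k" for k :: int
  proof -
    obtain a where a: "a \<in> carrier A" "z = \<iota> a" using z by auto
    have "z [^]\<^bsub>\<Gamma>\<^esub> e = \<one>\<^bsub>\<Gamma>\<^esub>" using \<iota>.hom_nat_pow[OF a(1), of e] e(2)[OF a(1)] a(2) by simp
    moreover obtain m where "k = int e * m" using k by (elim dvdE)
    ultimately show ?thesis using \<phi>.G.int_pow_pow[OF zc, of "int e" m] by (simp add: int_pow_int)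
  qed
  define \<xi> where "\<xi> = (\<lambda>u. x u mod int e)"
  have \<xi>: "\<xi> \<in> hom ?G1 ?Z"
    using e(1) by (auto simp: hom_def \<xi>_def carrier_integer_mod_group x_mult mod_add_eq)
  interpret \<xi>: group_hom ?G1 ?Z \<xi>
    using \<xi> G1.is_group by (simp add: group_hom_def group_hom_axioms_def)
  define H where "H = kernel ?G1 ?Z \<xi>"
  have H_iff: "u \<in> H \<longleftrightarrow> u \<in> N \<and> int e dvd x u" for u
    by (simp add: H_def kernel_def \<xi>_def dvd_eq_mod_eq_0)
  have H_sub: "subgroup H G"
    using \<phi>.H.incl_subgroup[OF N] \<xi>.subgroup_kernel by (simp add: H_def)
  have finZ: "finite (carrier ?Z)" "card (carrier ?Z) = e" using e(1) by (simp_all add: carrier_integer_mod_group)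
  have onto: "\<xi> ` carrier ?G1 = carrier ?Z"
  proof
    show "carrier ?Z \<subseteq> \<xi> ` carrier ?G1"
    proof
      fix k assume "k \<in> carrier ?Z"
      then have k: "0 \<le> k" "k < int e" using e(1) by (auto simp: carrier_integer_mod_group)
      have "u\<^sub>0 [^]\<^bsub>?G1\<^esub> m \<in> N \<and> x (u\<^sub>0 [^]\<^bsub>?G1\<^esub> m) = int m" for m :: nat
      proof (induction m)
        case 0
        have "x \<one>\<^bsub>G\<^esub> = 0" using x_mult[of "\<one>\<^bsub>G\<^esub>" "\<one>\<^bsub>G\<^esub>"] subgroup.one_closed[OF N] by simp
        then show ?case using subgroup.one_closed[OF N] by simp
      next
        case (Suc m)
        then show ?case using u\<^sub>0 x_mult subgroup.m_closed[OF N] by simp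
      qed
      from this[of "nat k"] have "\<xi> (u\<^sub>0 [^]\<^bsub>?G1\<^esub> nat k) = k" "u\<^sub>0 [^]\<^bsub>?G1\<^esub> nat k \<in> carrier ?G1"
        using k by (simp_all add: \<xi>_def)
      then show "k \<in> \<xi> ` carrier ?G1" by (metis imageI)
    qed
  qed auto
  have Hnormal: "H \<lhd> ?G1" unfolding H_def by (rule \<xi>.normal_kernel)
  have iso: "?G1 Mod H \<cong> ?Z" unfolding H_def by (rule \<xi>.FactGroup_iso[OF onto])
  have "group (?G1 Mod H)" using normal.factorgroup_is_group[OF Hnormal] .
  then have cyc: "cyclic_group (?G1 Mod H)"
    using isomorphic_group_cyclicity[OF iso] cyclic_integer_mod_group by simp
  have ord: "order (?G1 Mod H) = e" using iso_same_card[OF iso] finZ(2) by (simp add: order_def)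
  have fin: "finite (rcosets\<^bsub>?G1\<^esub> H)" using \<xi>.card_rcosets_kernel[OF finZ(1)] by (simp add: H_def)
  have triv: "trivial_extension A (restrict_over \<Gamma> \<phi> H) (G\<lparr>carrier := H\<rparr>) \<iota> \<phi>"
  proof -
    \<comment> \<open>On \<open>H\<close> the exponent \<open>x u * y w\<close> is divisible by
      \<open>e\<close>, so the twist disappears.\<close>
    have "s (u \<otimes>\<^bsub>G\<^esub> w) = s u \<otimes>\<^bsub>\<Gamma>\<^esub> s w" if "u \<in> H" "w \<in> H" for u w
      using that s_mult[of u w] s(1) z_pow[of "x u * y w"] by (simp add: H_iff)
    then show ?thesis unfolding trivial_extension_def
      using extension_trivialization_of_section[OF assms(6) H_sub, of s] s by (auto simp: H_iff)
  qed
  have fibre: "finite {w \<in> carrier \<Gamma>. \<phi> w = u} \<and> card {w \<in> carrier \<Gamma>. \<phi> w = u} \<le> card (carrier A)"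
    if u: "u \<in> carrier G" for u
  proof -
    obtain w\<^sub>0 where w\<^sub>0: "w\<^sub>0 \<in> carrier \<Gamma>" "\<phi> w\<^sub>0 = u" using u E(4) by (metis imageE)
    have "{w \<in> carrier \<Gamma>. \<phi> w = u} \<subseteq> (\<lambda>a. w\<^sub>0 \<otimes>\<^bsub>\<Gamma>\<^esub> \<iota> a) ` carrier A"
    proof
      fix w assume w: "w \<in> {w \<in> carrier \<Gamma>. \<phi> w = u}"
      then have "inv\<^bsub>\<Gamma>\<^esub> w\<^sub>0 \<otimes>\<^bsub>\<Gamma>\<^esub> w \<in> kernel \<Gamma> G \<phi>" using w\<^sub>0 u by (simp add: kernel_def)
      then obtain a where "a \<in> carrier A" "inv\<^bsub>\<Gamma>\<^esub> w\<^sub>0 \<otimes>\<^bsub>\<Gamma>\<^esub> w = \<iota> a" using E(3) by auto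
      moreover have "w\<^sub>0 \<otimes>\<^bsub>\<Gamma>\<^esub> (inv\<^bsub>\<Gamma>\<^esub> w\<^sub>0 \<otimes>\<^bsub>\<Gamma>\<^esub> w) = w" using w w\<^sub>0 by (simp flip: \<phi>.G.m_assoc)
      ultimately show "w \<in> (\<lambda>a. w\<^sub>0 \<otimes>\<^bsub>\<Gamma>\<^esub> \<iota> a) ` carrier A" by force
    qed
    then show ?thesis using assms(2) by (meson card_image_le card_mono finite_imageI finite_subset order_trans)
  qed
  \<comment> \<open>Precomposing \<xi> with a conjugation gives another homomorphism to the integers
    mod \<open>e\<close>, so all conjugates of \<open>H\<close> are among these kernels.\<close>
  define Ks where "Ks = {kernel ?G1 ?Z h | h. h \<in> hom ?G1 ?Z}"
  define Sec where "Sec = (\<lambda>K. {t ` K | t. t \<in> hom (G\<lparr>carrier := K\<rparr>) \<Gamma> \<and> (\<forall>k\<in>K. \<phi> (t k) = k)})"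
  let ?a = "card (carrier A)"
  have a_pos: "?a > 0" using assms(2) A.one_closed by (metis card_gt_0_iff empty_iff)
  have Ks: "finite Ks" "card Ks \<le> e ^ (2 * g\<^sub>1)"
  proof -
    have *: "finite Ks \<and> card Ks \<le> e ^ card S"
      unfolding Ks_def using G1.card_kernels_le[of S ?Z] S finZ by simp
    then show "finite Ks" by blast
    have "e ^ card S \<le> e ^ (2 * g\<^sub>1)" using e(1) S(3) by (intro power_increasing) auto
    with * show "card Ks \<le> e ^ (2 * g\<^sub>1)" by linarith
  qed
  have Sec: "finite (Sec K) \<and> card (Sec K) \<le> ?a ^ (2 * e * g\<^sub>1)" if K: "K \<in> Ks" for K
  proof -
    obtain h where h: "h \<in> hom ?G1 ?Z" "K = kernel ?G1 ?Z h" using K by (auto simp: Ks_def)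
    interpret h: group_hom ?G1 ?Z h
      using h(1) G1.is_group by (simp add: group_hom_def group_hom_axioms_def)
    have idx: "finite (rcosets\<^bsub>?G1\<^esub> K)" "card (rcosets\<^bsub>?G1\<^esub> K) \<le> e"
      using h.card_rcosets_kernel[OF finZ(1)] finZ(2) h(2) by auto
    have K1: "subgroup K ?G1" using h.subgroup_kernel h(2) by simp
    have KG: "subgroup K G" using \<phi>.H.incl_subgroup[OF N K1] .
    have KN: "K \<subseteq> N" using subgroup.subset[OF K1] by simp
    obtain U where U: "U \<subseteq> K" "finite U" "card U \<le> card (rcosets\<^bsub>?G1\<^esub> K) * card S" "generate ?G1 U = K"
      using G1.finite_index_generators[of S K] S K1 idx(1) by auto
    have "generate G U = K" using \<phi>.H.generate_consistent[of U N] U(1,4) KN N by simp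
    then have *: "finite (Sec K) \<and> card (Sec K) \<le> ?a ^ card U"
      unfolding Sec_def using U fibre subgroup.subset[OF KG]
      by (intro \<phi>.card_sections_le[OF KG]) auto
    have "card U \<le> e * (2 * g\<^sub>1)"
      using U(3) mult_le_mono[OF idx(2) S(3)] by linarith
    then have "?a ^ card U \<le> ?a ^ (2 * e * g\<^sub>1)"
      using a_pos by (intro power_increasing) (auto simp: algebra_simps)
    with * show ?thesis by linarith
  qed
  \<comment> \<open>A finite set, independent of the trivialization, that contains every conjugate
    of the image of the section.\<close>
  define C where "C = (\<Union>K\<in>Ks. Sec K)"
  have C: "finite C" "card C \<le> ?a ^ (2 * e * g\<^sub>1) * e ^ (2 * g\<^sub>1)"
  proof -
    show "finite C" unfolding C_def using Ks(1) Sec by blast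
    have "card C \<le> (\<Sum>K\<in>Ks. card (Sec K))" unfolding C_def by (rule card_UN_le[OF Ks(1)])
    also have "\<dots> \<le> (\<Sum>K\<in>Ks. ?a ^ (2 * e * g\<^sub>1))" using Sec by (intro sum_mono) blast
    also have "\<dots> \<le> ?a ^ (2 * e * g\<^sub>1) * e ^ (2 * g\<^sub>1)"
      using Ks(2) by (simp add: mult.commute[of "card Ks"])
    finally show "card C \<le> ?a ^ (2 * e * g\<^sub>1) * e ^ (2 * g\<^sub>1)" .
  qed
  let ?B = "?a ^ (2 * e * g\<^sub>1) * (e * fact e ^ (2 * g\<^sub>1 + min_generators A))"
  have e_fact: "e ^ (2 * g\<^sub>1) \<le> fact e ^ (2 * g\<^sub>1 + min_generators A)"
  proof -
    have "e ^ (2 * g\<^sub>1) \<le> fact e ^ (2 * g\<^sub>1)" using fact_ge_self[of e] by (intro power_mono) auto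
    also have "\<dots> \<le> fact e ^ (2 * g\<^sub>1 + min_generators A)" by (intro power_increasing) auto
    finally show ?thesis .
  qed
  have bound: "card C \<le> ?B"
  proof -
    have "e ^ (2 * g\<^sub>1) \<le> e * fact e ^ (2 * g\<^sub>1 + min_generators A)"
      using e_fact e(1) by (metis Suc_leI le_trans mult_1 mult_le_mono1 One_nat_def)
    then have "?a ^ (2 * e * g\<^sub>1) * e ^ (2 * g\<^sub>1) \<le> ?B" by (rule mult_le_mono2)
    with C(2) show ?thesis by linarith
  qed
  \<comment> \<open>Bounding \<open>e ^ (2 * g\<^sub>1)\<close> by the factorial power alone leaves
    the factor \<open>e\<close> to spare, and a nontrivial group has exponent greater than
    1.\<close>
  have strict: "card C < ?B" if A1: "?a > 1"
  proof -
    have "e \<noteq> 1"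
    proof
      assume "e = 1"
      then have "carrier A \<subseteq> {\<one>\<^bsub>A\<^esub>}" using e(2) by fastforce
      then show False using A1 card_mono[of "{\<one>\<^bsub>A\<^esub>}" "carrier A"] by simp
    qed
    then have "1 < e" using e(1) by simp
    moreover have "fact e ^ (2 * g\<^sub>1 + min_generators A) > (0::nat)" by simp
    ultimately have "1 * fact e ^ (2 * g\<^sub>1 + min_generators A) < e * fact e ^ (2 * g\<^sub>1 + min_generators A)"
      by (intro mult_strict_right_mono)
    then have "e ^ (2 * g\<^sub>1) < e * fact e ^ (2 * g\<^sub>1 + min_generators A)"
      using e_fact by linarith
    then have "?a ^ (2 * e * g\<^sub>1) * e ^ (2 * g\<^sub>1) < ?B" using a_pos by (intro mult_strict_left_mono) auto
    with C(2) show ?thesis by (rule le_less_trans)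
  qed
  have index: "finite (rcosets\<^bsub>\<Gamma>\<^esub> normalizer \<Gamma> ((\<lambda>u. \<psi> (\<one>\<^bsub>A\<^esub>, u)) ` H)) \<and>
      card (rcosets\<^bsub>\<Gamma>\<^esub> normalizer \<Gamma> ((\<lambda>u. \<psi> (\<one>\<^bsub>A\<^esub>, u)) ` H)) \<le> card C"
    if \<psi>: "extension_trivialization A (restrict_over \<Gamma> \<phi> H) (G\<lparr>carrier := H\<rparr>) \<iota> \<phi> \<psi>" for \<psi>
  proof -
    define t where "t = (\<lambda>u. \<psi> (\<one>\<^bsub>A\<^esub>, u))"
    have t: "t \<in> hom (G\<lparr>carrier := H\<rparr>) \<Gamma>" "\<And>u. u \<in> H \<Longrightarrow> \<phi> (t u) = u"
      unfolding t_def using section_of_extension_trivialization[OF A.is_group \<psi>] by auto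
    have tc: "t u \<in> carrier \<Gamma>" if "u \<in> H" for u using t(1) that by (auto simp: hom_def)
    have tm: "t (u \<otimes>\<^bsub>G\<^esub> w) = t u \<otimes>\<^bsub>\<Gamma>\<^esub> t w" if "u \<in> H" "w \<in> H" for u w
      using t(1) that by (auto simp: hom_def)
    have "(\<lambda>w. inv\<^bsub>\<Gamma>\<^esub> \<gamma> \<otimes>\<^bsub>\<Gamma>\<^esub> w \<otimes>\<^bsub>\<Gamma>\<^esub> \<gamma>) ` t ` H \<in> C" if \<gamma>: "\<gamma> \<in> carrier \<Gamma>" for \<gamma>
    proof -
      let ?c = "\<phi> \<gamma>"
      have c: "?c \<in> carrier G" using \<gamma> by simp
      \<comment> \<open>The subgroups of \<Gamma> are conjugated with the inverse on the left, so
        their images in \<open>G\<close> are pulled back along the opposite conjugation; normality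
        of \<open>N\<close> in \<open>G\<close> keeps it inside \<open>N\<close>.\<close>
      define cj where "cj = (\<lambda>u. ?c \<otimes>\<^bsub>G\<^esub> u \<otimes>\<^bsub>G\<^esub> inv\<^bsub>G\<^esub> ?c)"
      have cjN: "cj u \<in> N" if "u \<in> N" for u unfolding cj_def using N.inv_op_closed2[OF c that] .
      have cjm: "cj (u \<otimes>\<^bsub>G\<^esub> w) = cj u \<otimes>\<^bsub>G\<^esub> cj w" if "u \<in> carrier G" "w \<in> carrier G" for u w
      proof -
        have "cj u \<otimes>\<^bsub>G\<^esub> cj w = ?c \<otimes>\<^bsub>G\<^esub> (u \<otimes>\<^bsub>G\<^esub> (inv\<^bsub>G\<^esub> ?c \<otimes>\<^bsub>G\<^esub> (?c \<otimes>\<^bsub>G\<^esub> (w \<otimes>\<^bsub>G\<^esub> inv\<^bsub>G\<^esub> ?c))))"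
          using that c by (simp add: cj_def \<phi>.H.m_assoc)
        also have "inv\<^bsub>G\<^esub> ?c \<otimes>\<^bsub>G\<^esub> (?c \<otimes>\<^bsub>G\<^esub> (w \<otimes>\<^bsub>G\<^esub> inv\<^bsub>G\<^esub> ?c)) = w \<otimes>\<^bsub>G\<^esub> inv\<^bsub>G\<^esub> ?c"
          using that c by (simp flip: \<phi>.H.m_assoc)
        finally show ?thesis using that c by (simp add: cj_def \<phi>.H.m_assoc)
      qed
      have Nc: "u \<in> carrier G" if "u \<in> N" for u using that subgroup.subset[OF N] by blast
      have h': "(\<lambda>u. \<xi> (cj u)) \<in> hom ?G1 ?Z"
      proof (rule homI)
        fix u assume u: "u \<in> carrier ?G1"
        show "\<xi> (cj u) \<in> carrier ?Z" using u cjN by simp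
        fix w assume w: "w \<in> carrier ?G1"
        have "\<xi> (cj u \<otimes>\<^bsub>?G1\<^esub> cj w) = \<xi> (cj u) \<otimes>\<^bsub>?Z\<^esub> \<xi> (cj w)"
          using u w cjN by (intro \<xi>.hom_mult) auto
        then show "\<xi> (cj (u \<otimes>\<^bsub>?G1\<^esub> w)) = \<xi> (cj u) \<otimes>\<^bsub>?Z\<^esub> \<xi> (cj w)"
          using u w Nc by (simp add: cjm)
      qed
      define K where "K = kernel ?G1 ?Z (\<lambda>u. \<xi> (cj u))"
      have K: "K \<in> Ks" using h' by (auto simp: Ks_def K_def)
      have K_iff: "u \<in> K \<longleftrightarrow> u \<in> N \<and> cj u \<in> H" for u
        using cjN by (auto simp: K_def H_def kernel_def)
      \<comment> \<open>The conjugated subgroup is again the image of a section, now over the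
        preimage \<open>K\<close> of \<open>H\<close> under \<open>cj\<close>.\<close>
      define t' where "t' = (\<lambda>u. inv\<^bsub>\<Gamma>\<^esub> \<gamma> \<otimes>\<^bsub>\<Gamma>\<^esub> t (cj u) \<otimes>\<^bsub>\<Gamma>\<^esub> \<gamma>)"
      have "t' \<in> hom (G\<lparr>carrier := K\<rparr>) \<Gamma>"
      proof (rule homI)
        fix u assume "u \<in> carrier (G\<lparr>carrier := K\<rparr>)"
        then have u: "u \<in> N" "cj u \<in> H" "t (cj u) \<in> carrier \<Gamma>" using K_iff tc by auto
        then show "t' u \<in> carrier \<Gamma>" using \<gamma> by (simp add: t'_def)
        fix w assume "w \<in> carrier (G\<lparr>carrier := K\<rparr>)"
        then have w: "w \<in> N" "cj w \<in> H" "t (cj w) \<in> carrier \<Gamma>" using K_iff tc by auto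
        have "t' u \<otimes>\<^bsub>\<Gamma>\<^esub> t' w = inv\<^bsub>\<Gamma>\<^esub> \<gamma> \<otimes>\<^bsub>\<Gamma>\<^esub> (t (cj u) \<otimes>\<^bsub>\<Gamma>\<^esub> (\<gamma> \<otimes>\<^bsub>\<Gamma>\<^esub> (inv\<^bsub>\<Gamma>\<^esub> \<gamma> \<otimes>\<^bsub>\<Gamma>\<^esub> (t (cj w) \<otimes>\<^bsub>\<Gamma>\<^esub> \<gamma>))))"
          using u w \<gamma> by (simp add: t'_def \<phi>.G.m_assoc)
        also have "\<gamma> \<otimes>\<^bsub>\<Gamma>\<^esub> (inv\<^bsub>\<Gamma>\<^esub> \<gamma> \<otimes>\<^bsub>\<Gamma>\<^esub> (t (cj w) \<otimes>\<^bsub>\<Gamma>\<^esub> \<gamma>)) = t (cj w) \<otimes>\<^bsub>\<Gamma>\<^esub> \<gamma>"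
          using w \<gamma> by (simp flip: \<phi>.G.m_assoc)
        finally show "t' (u \<otimes>\<^bsub>G\<lparr>carrier := K\<rparr>\<^esub> w) = t' u \<otimes>\<^bsub>\<Gamma>\<^esub> t' w"
          using u w \<gamma> tm[OF u(2) w(2)] cjm[of u w] Nc by (simp add: t'_def \<phi>.G.m_assoc)
      qed
      moreover have "\<phi> (t' u) = u" if "u \<in> K" for u
      proof -
        have u: "u \<in> carrier G" "t (cj u) \<in> carrier \<Gamma>" "\<phi> (t (cj u)) = cj u" using that K_iff Nc tc t(2) by auto
        have "\<phi> (t' u) = inv\<^bsub>G\<^esub> ?c \<otimes>\<^bsub>G\<^esub> (?c \<otimes>\<^bsub>G\<^esub> (u \<otimes>\<^bsub>G\<^esub> (inv\<^bsub>G\<^esub> ?c \<otimes>\<^bsub>G\<^esub> ?c)))"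
          using u \<gamma> c by (simp add: t'_def) (simp add: cj_def \<phi>.H.m_assoc)
        also have "\<dots> = u" using u(1) c by (simp flip: \<phi>.H.m_assoc)
        finally show ?thesis .
      qed
      moreover have "(\<lambda>w. inv\<^bsub>\<Gamma>\<^esub> \<gamma> \<otimes>\<^bsub>\<Gamma>\<^esub> w \<otimes>\<^bsub>\<Gamma>\<^esub> \<gamma>) ` t ` H = t' ` K"
      proof -
        have "cj ` K = H"
        proof
          show "cj ` K \<subseteq> H" using K_iff by auto
          show "H \<subseteq> cj ` K"
          proof
            fix u assume u: "u \<in> H"
            then have uN: "u \<in> N" by (simp add: H_iff)
            let ?u = "inv\<^bsub>G\<^esub> ?c \<otimes>\<^bsub>G\<^esub> u \<otimes>\<^bsub>G\<^esub> ?c"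
            have "?u \<in> N" using N.inv_op_closed1[OF c uN] .
            moreover have "cj ?u = u"
            proof -
              have "cj ?u = ?c \<otimes>\<^bsub>G\<^esub> (inv\<^bsub>G\<^esub> ?c \<otimes>\<^bsub>G\<^esub> (u \<otimes>\<^bsub>G\<^esub> (?c \<otimes>\<^bsub>G\<^esub> inv\<^bsub>G\<^esub> ?c)))"
                using c Nc[OF uN] by (simp add: cj_def \<phi>.H.m_assoc)
              also have "\<dots> = u" using c Nc[OF uN] by (simp flip: \<phi>.H.m_assoc)
              finally show ?thesis .
            qed
            ultimately have "?u \<in> K" "u = cj ?u" using u K_iff by auto
            then show "u \<in> cj ` K" by blast
          qed
        qed
        then show ?thesis unfolding t'_def by (metis (no_types, lifting) image_cong image_image)
      qed
      ultimately have "(\<lambda>w. inv\<^bsub>\<Gamma>\<^esub> \<gamma> \<otimes>\<^bsub>\<Gamma>\<^esub> w \<otimes>\<^bsub>\<Gamma>\<^esub> \<gamma>) ` t ` H \<in> Sec K" unfolding Sec_def by blast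
      then show ?thesis unfolding C_def using K by blast
    qed
    moreover have "t ` H \<subseteq> carrier \<Gamma>" using tc by blast
    ultimately show ?thesis using \<phi>.G.index_normalizer_le[of "t ` H" C] C(1) unfolding t_def by blast
  qed
  show ?thesis
    unfolding N_def[symmetric] e_def[symmetric] Let_def
    using Hnormal fin cyc ord triv index bound strict
    by (intro exI[of _ H]) (meson le_less_trans le_trans)
qed

end
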